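(* Let $d\ge1$, $\Omega=[0,1]^d$, $0<\beta<1$ and $c>0$. Then for any $m\ge 0$ there exist constants $c'>0$ and $C>0$, depending only on $\beta,c,d,m$, such that for every $f\in\mathcal{B}_{\beta,c}(\Omega)$ there is an $M\le C\|f\|_{\mathcal{B}_{\beta,c}(\Omega)}$ such that for all integers $n\ge1$ $$\inf_{f_n\in \Sigma_{n,M}} \|f-f_n\|_{H^m(\Omega)} \le C\,\|f\|_{\mathcal{B}_{\beta,c}(\Omega)}\,e^{-c' n^{\beta/d}}.$$
   Context: The Fourier transform is $\hat g(\xi)=\int_{\mathbb{R}^d} g(x)e^{-2\pi \mathrm{i}\,\xi\cdot x}\,dx$, and $|\cdot|$ is the Euclidean norm. For $0<\beta<1$ and $c>0$, the exponential spectral Barron space is $$\mathcal{B}_{\beta,c}(\Omega)=\Big\{f:\Omega\to\mathbb{R}:\ \|f\|_{\mathcal{B}_{\beta,c}(\Omega)}:=\inf_{f_e|_\Omega=f}\int_{\mathbb{R}^d}e^{c|\xi|^\beta}|\hat f_e(\xi)|\,d\xi<\infty\Big\},$$ where the infimum is over all extensions $f_e\in L^1(\mathbb{R}^d)$ of $f$. For $n\ge1$, $M\ge0$, $$\Sigma_{n,M}=\Big\{\sum_{j=1}^n a_je^{2\pi \mathrm{i}\,\theta_j\cdot x}:\ \theta_j\in\mathbb{R}^d,\ a_j\in\mathbb{C},\ \sum_{j=1}^n|a_j|\le M\Big\}.$$ $H^m(\Omega)$ is the usual $L^2$-based Sobolev space of order $m$ (the fractional, Sobolev–Slobodeckij,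 space if $m$ is not an integer), with $H^0=L^2$. Functions are identified when equal almost everywhere. *)

theory Defs
  imports "HOL-Analysis.Analysis"
begin

definition unit_cube :: "(real ^ 'n) set" where
  "unit_cube = cbox 0 1"

definition fourier :: "(real ^ 'n \<Rightarrow> complex) \<Rightarrow> real ^ 'n \<Rightarrow> complex" where
  "fourier g \<xi> =
     (LINT x|lebesgue. g x * exp (- 2 * of_real pi * \<i> * of_real (\<xi> \<bullet> x)))"

text \<open>
  A function on a set is represented by a total function whose values outside the set are
  irrelevant, and functions that agree almost everywhere are identified. Extensions may be
  complex valued; as taking real parts does not increase the weighted integral below, the
  infimum is the same as over real extensions. It is infinite if there is no extension.
\<close>

definition L1_extensions :: "(real ^ 'n) set \<Rightarrow> (real ^ 'n \<Rightarrow> real) \<Rightarrow> (real ^ 'n \<Rightarrow> complex) set" where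
  "L1_extensions \<Omega> f =
     {fe. integrable lebesgue fe \<and> (AE x in lebesgue. x \<in> \<Omega> \<longrightarrow> fe x = of_real (f x))}"

definition barron_norm :: "real \<Rightarrow> real \<Rightarrow> (real ^ 'n) set \<Rightarrow> (real ^ 'n \<Rightarrow> real) \<Rightarrow> ennreal" where
  "barron_norm \<beta> c \<Omega> f =
     (INF fe \<in> L1_extensions \<Omega> f.
        \<integral>\<^sup>+ \<xi>. ennreal (exp (c * norm \<xi> powr \<beta>) * norm (fourier fe \<xi>)) \<partial>lebesgue)"

definition barron_space :: "real \<Rightarrow> real \<Rightarrow> (real ^ 'n) set \<Rightarrow> (real ^ 'n \<Rightarrow> real) set" where
  "barron_space \<beta> c \<Omega> = {f. barron_norm \<beta> c \<Omega> f < \<infinity>}"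

definition exp_sums :: "nat \<Rightarrow> real \<Rightarrow> (real ^ 'n \<Rightarrow> complex) set" where
  "exp_sums n M =
     {(\<lambda>x. \<Sum>j<n. a j * exp (2 * of_real pi * \<i> * of_real (\<theta> j \<bullet> x))) | a \<theta>.
        (\<Sum>j<n. norm (a j)) \<le> M}"

fun iter_partial :: "'n list \<Rightarrow> (real ^ 'n \<Rightarrow> real) \<Rightarrow> real ^ 'n \<Rightarrow> real" where
  "iter_partial [] \<phi> = \<phi>"
| "iter_partial (i # is) \<phi> = (\<lambda>x. frechet_derivative (iter_partial is \<phi>) (at x) (axis i 1))"

definition test_functions :: "(real ^ 'n) set \<Rightarrow> (real ^ 'n \<Rightarrow> real) set" where
  "test_functions U =
     {\<phi>. (\<forall>is. iter_partial is \<phi> differentiable_on UNIV) \<and>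
         compact (closure {x. \<phi> x \<noteq> 0}) \<and> closure {x. \<phi> x \<noteq> 0} \<subseteq> U}"

definition locally_integrable_on :: "(real ^ 'n \<Rightarrow> complex) \<Rightarrow> (real ^ 'n) set \<Rightarrow> bool"
    (infix "locally'_integrable'_on" 50) where
  "g locally_integrable_on U \<longleftrightarrow>
     (\<forall>K. compact K \<longrightarrow> K \<subseteq> U \<longrightarrow> g absolutely_integrable_on K)"

text \<open>
  Multi-indices are functions \<open>'n \<Rightarrow> nat\<close>. A list of coordinates in which every \<open>i\<close> occurs
  \<open>\<alpha> i\<close> times spells out the derivative of order \<open>\<alpha>\<close>; since partial derivatives of smooth
  functions commute, all such lists give the same condition.
\<close>

definition has_weak_deriv ::
    "(real ^ 'n) set \<Rightarrow> ('n \<Rightarrow> nat) \<Rightarrow> (real ^ 'n \<Rightarrow> complex) \<Rightarrow> (real ^ 'n \<Rightarrow> complex) \<Rightarrow> bool" where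
  "has_weak_deriv U \<alpha> u g \<longleftrightarrow>
     u locally_integrable_on U \<and> g locally_integrable_on U \<and>
     (\<forall>\<phi> \<in> test_functions U. \<forall>is. (\<forall>i. count_list is i = \<alpha> i) \<longrightarrow>
        (LINT x:U|lebesgue. iter_partial is \<phi> x *\<^sub>R u x) =
        (- 1) ^ sum \<alpha> UNIV * (LINT x:U|lebesgue. \<phi> x *\<^sub>R g x))"

definition L2_sq :: "(real ^ 'n) set \<Rightarrow> (real ^ 'n \<Rightarrow> complex) \<Rightarrow> ennreal" where
  "L2_sq U g = (\<integral>\<^sup>+ x \<in> U. ennreal ((norm (g x))\<^sup>2) \<partial>lebesgue)"

definition slobodeckij_sq :: "real \<Rightarrow> (real ^ 'n) set \<Rightarrow> (real ^ 'n \<Rightarrow> complex) \<Rightarrow> ennreal" where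
  "slobodeckij_sq s U g =
     (\<integral>\<^sup>+ x \<in> U. (\<integral>\<^sup>+ y \<in> U.
        ennreal ((norm (g x - g y))\<^sup>2 / norm (x - y) powr (real CARD('n) + 2 * s))
      \<partial>lebesgue) \<partial>lebesgue)"

text \<open>
  The square of the norm of \<open>u\<close> in the Sobolev(-Slobodeckij) space of order \<open>m\<close> on the open set
  \<open>U\<close>. Weak derivatives are unique up to null sets, which do not affect the value, so the infimum
  is over a single number if \<open>u\<close> has all weak derivatives of order at most \<open>\<lfloor>m\<rfloor>\<close>; otherwise it is
  infinite. Thus \<open>u\<close> is in the Sobolev space iff the value is finite.
\<close>

definition sobolev_sq :: "real \<Rightarrow> (real ^ 'n) set \<Rightarrow> (real ^ 'n \<Rightarrow> complex) \<Rightarrow> ennreal" where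
  "sobolev_sq m U u =
     (INF D \<in> {D. \<forall>\<alpha>. sum \<alpha> UNIV \<le> nat \<lfloor>m\<rfloor> \<longrightarrow> has_weak_deriv U \<alpha> u (D \<alpha>)}.
        (\<Sum>\<alpha> | sum \<alpha> UNIV \<le> nat \<lfloor>m\<rfloor>. L2_sq U (D \<alpha>)) +
        (if frac m = 0 then 0
         else \<Sum>\<alpha> | sum \<alpha> UNIV = nat \<lfloor>m\<rfloor>. slobodeckij_sq (frac m) U (D \<alpha>)))"

definition sobolev_norm :: "real \<Rightarrow> (real ^ 'n) set \<Rightarrow> (real ^ 'n \<Rightarrow> complex) \<Rightarrow> ennreal" where
  "sobolev_norm m U u =
     (if sobolev_sq m U u = \<infinity> then \<infinity> else ennreal (sqrt (enn2real (sobolev_sq m U u))))"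

end

theory Submission
  imports Defs "HOL-Complex_Analysis.Cauchy_Integral_Formula"
    "HOL-Probability.Characteristic_Functions" "HOL-Real_Asymp.Real_Asymp"
begin

text \<open>
  Let \<open>fe\<close> be an extension of \<open>f\<close> whose weighted Fourier integral \<open>B\<close> is finite. On the cube \<open>f\<close> is a
  superposition of plane waves \<open>exp (2 \<pi> i \<xi> \<bullet> x)\<close> with density \<open>fourier fe \<xi>\<close>. The theorem follows once
  each plane wave is replaced, on the cube, by an exponential sum over a fixed finite grid of
  frequencies, with an error that is exponentially small and coefficients whose absolute values have
  a sum bounded independently of the size of the grid; the latter is what allows one \<open>M\<close> for all \<open>n\<close>.

  In one variable and on a short interval this is possible because of the identity
  \<open>exp (i s w) = H (sin w)\<close>, where \<open>H u = exp (i s arcsin u)\<close> has a power series with absolutely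
  summable coefficients, bounded uniformly for \<open>0 \<le> s \<le> 1\<close>, and because \<open>sin\<^sup>j w\<close> is a trigonometric
  polynomial of degree \<open>j\<close> whose coefficients have absolute sum at most 1. Truncating the power series
  at degree \<open>J\<close> therefore keeps the coefficient sum bounded, while the error is geometrically small in
  \<open>J\<close> wherever \<open>|sin w|\<close> stays away from 1. An integer shift of the frequency reaches all \<open>\<tau> = l + s\<close>
  (lemma \<open>exp_discretization\<close>), and products over the coordinates give grids in several variables
  (lemma \<open>exp_grid_approximation\<close>). Frequencies outside the grid are simply dropped; there the
  exponential weight gives the factor \<open>exp (- c1 J powr \<beta>)\<close>. The largest grid with at most \<open>n\<close> points has \<open>J\<close> of
  order \<open>n powr (1 / d)\<close>, which yields the rate.

  The norm of the error is estimated through derivatives taken under the integral over \<open>\<xi>\<close>. That these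
  are weak derivatives of \<open>f\<close> minus the exponential sum is checked directly against test functions
  (lemma \<open>has_weak_deriv_spectral_deriv\<close>): Fourier inversion is used in the form
  \<open>\<integral> fe \<psi> = \<integral> fourier fe \<xi> (\<integral> \<psi> exp (2 \<pi> i \<xi> \<bullet> x) dx) d\<xi>\<close> for bounded, integrable and
  continuous \<open>\<psi>\<close>, proved by Gaussian regularisation (lemma \<open>fourier_inversion_tested\<close>). Sup bounds on the derivatives up to order
  \<open>\<lfloor>m\<rfloor> + 1\<close> then control the Sobolev norm, the last order entering as a Lipschitz bound for the
  Slobodeckij part (lemma \<open>sobolev_norm_le_of_bounded_weak_derivs\<close>).
\<close>

section \<open>Discretising the frequency of an exponential in one variable\<close>

text \<open>
  The Taylor coefficients at the origin of \<open>exp (i s arcsin u)\<close>. The recursion comes from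
  the equation \<open>(1 - u\<^sup>2) H'' - u H' + s\<^sup>2 H = 0\<close> that this function satisfies.
\<close>

fun exp_arcsin_coeff :: "real \<Rightarrow> nat \<Rightarrow> complex" where
  "exp_arcsin_coeff s 0 = 1"
| "exp_arcsin_coeff s (Suc 0) = \<i> * of_real s"
| "exp_arcsin_coeff s (Suc (Suc j)) =
     exp_arcsin_coeff s j * of_real ((real j ^ 2 - s ^ 2) / (real (j + 1) * real (j + 2)))"

text \<open>
  This makes the coefficient sum telescope: for \<open>j \<ge> 1\<close> the quotient of \<open>b (j + 2)\<close> and \<open>b j\<close> is
  between 0 and \<open>j\<^sup>2 / ((j + 1) (j + 2))\<close>, so \<open>j |b j|\<close> drops by at least \<open>|b j| / 2\<close> in every double
  step.
\<close>

lemma norm_exp_arcsin_coeff_step: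
  assumes "0 \<le> s" "s \<le> 1" "1 \<le> j"
  shows "norm (exp_arcsin_coeff s j)
    \<le> 2 * (real j * norm (exp_arcsin_coeff s j) - real (j + 2) * norm (exp_arcsin_coeff s (j + 2)))"
proof -
  define b where "b = norm (exp_arcsin_coeff s j)"
  have sj: "s ^ 2 \<le> real j ^ 2"
    using assms by (intro power_mono) auto
  have "norm (exp_arcsin_coeff s (j + 2)) = b * ((real j ^ 2 - s ^ 2) / (real (j + 1) * real (j + 2)))"
    using sj by (simp add: b_def norm_mult del: of_real_divide of_real_diff of_real_mult)
  moreover have "B * (b * (x / (A * B))) = b * (x / A)" if "0 < B" for A B x :: real
    using that by simp
  ultimately have "real (j + 2) * norm (exp_arcsin_coeff s (j + 2)) = b * ((real j ^ 2 - s ^ 2) / real (j + 1))"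
    by simp
  also have "\<dots> \<le> b * (real j ^ 2 / real (j + 1))"
    by (intro mult_left_mono divide_right_mono) (auto simp: b_def)
  also have "\<dots> = real j * b - b * (real j / real (j + 1))"
    by (simp add: field_simps power2_eq_square)
  also have "\<dots> \<le> real j * b - b * (1 / 2)"
    using assms by (intro diff_left_mono mult_left_mono) (auto simp: b_def field_simps)
  finally show ?thesis by (simp add: b_def)
qed

text \<open>
  The power series thus converges absolutely up to the boundary of the unit disc, uniformly in
  \<open>s\<close>. All bounds on coefficient sums, and hence the constant \<open>M\<close> of the theorem, rest on this.
\<close>

lemma sum_norm_exp_arcsin_coeff_le:
  assumes "0 \<le> s" "s \<le> 1"
  shows "(\<Sum>j<n. norm (exp_arcsin_coeff s j)) \<le> 5"
proof -
  define g where "g j = real j * norm (exp_arcsin_coeff s j)" for j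
  have "(\<Sum>j=1..n. norm (exp_arcsin_coeff s j)) \<le> 2 * (g 1 + g 2 - g (n + 1) - g (n + 2))" for n
  proof (induction n)
    case (Suc n)
    then show ?case
      using norm_exp_arcsin_coeff_step[OF assms, of "n + 1"] by (simp add: g_def del: exp_arcsin_coeff.simps)
  qed (simp add: numeral_2_eq_2 del: exp_arcsin_coeff.simps)
  moreover have "g 1 + g 2 - g (n + 1) - g (n + 2) \<le> 2"
  proof -
    have "g 1 \<le> 1" using assms by (simp add: g_def norm_mult)
    moreover have "g 2 = s ^ 2"
      by (simp add: g_def numeral_2_eq_2 norm_power power2_eq_square norm_divide norm_mult abs_mult_self_eq)
    moreover have "s ^ 2 \<le> 1" using assms by (simp add: power_le_one)
    moreover have "g (n + 1) \<ge> 0" "g (n + 2) \<ge> 0" by (auto simp: g_def)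
    ultimately show ?thesis by linarith
  qed
  ultimately have *: "(\<Sum>j=1..n. norm (exp_arcsin_coeff s j)) \<le> 4"
    by (smt (verit, best))
  have "(\<Sum>j<n. norm (exp_arcsin_coeff s j)) \<le> (\<Sum>j\<in>insert 0 {1..n}. norm (exp_arcsin_coeff s j))"
    by (intro sum_mono2) auto
  also have "\<dots> = 1 + (\<Sum>j=1..n. norm (exp_arcsin_coeff s j))"
    by simp
  finally show ?thesis using * by linarith
qed

text \<open>
  The coefficient recursion, read off term by term.
\<close>

lemma exp_arcsin_series_solves_ode:
  fixes s :: real
  defines "b \<equiv> exp_arcsin_coeff s"
  assumes s: "0 \<le> s" "s \<le> 1" and u: "norm u < 1"
  defines "H \<equiv> \<lambda>u. \<Sum>j. b j * u ^ j" and "H1 \<equiv> \<lambda>u. \<Sum>j. diffs b j * u ^ j"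
    and "H2 \<equiv> \<lambda>u. \<Sum>j. diffs (diffs b) j * u ^ j"
  shows "(\<lambda>j. b j * u ^ j) sums H u"
    and "(H has_field_derivative H1 u) (at u)"
    and "(H1 has_field_derivative H2 u) (at u)"
    and "(1 - u ^ 2) * H2 u - u * H1 u + (of_real s) ^ 2 * H u = 0"
proof -
  have sm_norm: "summable (\<lambda>j. norm (b j))"
    using sum_norm_exp_arcsin_coeff_le[OF s] by (intro summableI_nonneg_bounded[where x = 5]) (auto simp: b_def)
  have sm0: "summable (\<lambda>j. b j * v ^ j)" if "norm v < 1" for v
  proof (rule summable_comparison_test'[OF sm_norm])
    show "norm (b n * v ^ n) \<le> norm (b n)" for n
      using that by (simp add: norm_mult norm_power mult_left_le power_le_one)
  qed
  have sm1: "summable (\<lambda>j. diffs b j * v ^ j)" if "norm v < 1" for v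
    by (rule termdiff_converges[OF that sm0])
  have sm2: "summable (\<lambda>j. diffs (diffs b) j * v ^ j)" if "norm v < 1" for v
    by (rule termdiff_converges[OF that sm1])
  show S0: "(\<lambda>j. b j * u ^ j) sums H u"
    unfolding H_def by (rule summable_sums[OF sm0[OF u]])
  show "(H has_field_derivative H1 u) (at u)"
    unfolding H_def H1_def by (rule termdiffs_strong'[OF sm0 u])
  show "(H1 has_field_derivative H2 u) (at u)"
    unfolding H1_def H2_def by (rule termdiffs_strong'[OF sm1 u])
  have S1: "(\<lambda>j. of_nat j * b j * u ^ j) sums (u * H1 u)"
  proof -
    have "(\<lambda>j. u * (diffs b j * u ^ j)) sums (u * H1 u)"
      unfolding H1_def by (intro sums_mult summable_sums sm1 u)
    then have "(\<lambda>j. of_nat (Suc j) * b (Suc j) * u ^ Suc j) sums (u * H1 u)"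
      by (simp add: diffs_def mult_ac)
    then show ?thesis
      by (subst (asm) sums_Suc_iff) simp
  qed
  have S2: "(\<lambda>j. diffs (diffs b) j * u ^ j) sums H2 u"
    unfolding H2_def by (intro summable_sums sm2 u)
  have S3: "(\<lambda>j. of_nat j * (of_nat j - 1) * b j * u ^ j) sums (u ^ 2 * H2 u)"
  proof -
    have "(\<lambda>j. u ^ 2 * (diffs (diffs b) j * u ^ j)) sums (u ^ 2 * H2 u)"
      by (intro sums_mult S2)
    then have "(\<lambda>j. (of_nat (Suc (Suc j)) * (of_nat (Suc (Suc j)) - 1) * b (Suc (Suc j)) * u ^ Suc (Suc j)))
        sums (u ^ 2 * H2 u)"
      by (simp add: diffs_def mult_ac power2_eq_square)
    then show ?thesis
      using sums_Suc_iff[of "\<lambda>j. of_nat (Suc j) * (of_nat (Suc j) - 1) * b (Suc j) * u ^ Suc j" "u ^ 2 * H2 u"]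
        sums_Suc_iff[of "\<lambda>j. of_nat j * (of_nat j - 1) * b j * u ^ j" "u ^ 2 * H2 u"]
      by simp
  qed
  have dd: "diffs (diffs b) j = (of_nat j ^ 2 - of_real s ^ 2) * b j" for j
  proof -
    have nz: "of_nat (j + 1) \<noteq> (0::complex)" "of_nat (j + 2) \<noteq> (0::complex)"
      using of_nat_neq_0[where 'a = complex, of j] of_nat_neq_0[where 'a = complex, of "j + 1"] by simp_all
    have "A * (B * (x * (y / (A * B)))) = y * x" if "A \<noteq> 0" "B \<noteq> 0" for A B x y :: complex
      using that by simp
    from this[OF nz] show ?thesis
      by (simp add: diffs_def b_def)
  qed
  have "diffs (diffs b) j * u ^ j - of_nat j * (of_nat j - 1) * b j * u ^ j - of_nat j * b j * u ^ j
      + of_real s ^ 2 * (b j * u ^ j) = 0" for j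
    unfolding dd by (simp add: algebra_simps power2_eq_square)
  moreover have "(\<lambda>j. diffs (diffs b) j * u ^ j - of_nat j * (of_nat j - 1) * b j * u ^ j - of_nat j * b j * u ^ j
      + of_real s ^ 2 * (b j * u ^ j)) sums (H2 u - u ^ 2 * H2 u - u * H1 u + of_real s ^ 2 * H u)"
    by (intro sums_add sums_diff sums_mult S0 S1 S2 S3)
  ultimately have "H2 u - u ^ 2 * H2 u - u * H1 u + of_real s ^ 2 * H u = 0"
    using sums_unique2[OF _ sums_zero] by simp
  then show "(1 - u ^ 2) * H2 u - u * H1 u + (of_real s) ^ 2 * H u = 0"
    by (simp add: algebra_simps)
qed

lemma norm_sin_le_mult_exp:
  fixes w :: complex
  shows "norm (sin w) \<le> norm w * exp (norm w)"
proof -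
  have "norm (sin w - sin 0) \<le> exp (norm w) * norm (w - 0)"
  proof (rule field_differentiable_bound[of "cball 0 (norm w)" sin cos])
    show "norm (cos z) \<le> exp (norm w)" if "z \<in> cball 0 (norm w)" for z :: complex
    proof -
      have "norm (cos z) \<le> exp \<bar>Im z\<bar>"
        using cmod_cos_le_exp[of 1 z] by simp
      also have "\<dots> \<le> exp (norm w)"
        using that abs_Im_le_cmod[of z] by simp
      finally show ?thesis .
    qed
  qed (auto intro!: derivative_eq_intros)
  then show ?thesis by (simp add: mult.commute)
qed

lemma exp_quarter_le: "exp (1 / 4 :: real) \<le> 4 / 3"
  using exp_ge_add_one_self[of "- 1 / 4 :: real"]
  by (simp add: exp_minus field_simps)

text \<open>
  By the differential equation for the power series \<open>H\<close>, the function \<open>g = H \<circ> sin\<close> solves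
  \<open>g'' = - s\<^sup>2 g\<close> with the initial values of \<open>exp (i s w)\<close>. The bound on \<open>w\<close> keeps \<open>sin w\<close> inside the
  unit disc.
\<close>

lemma exp_eq_exp_arcsin_series:
  assumes s: "0 \<le> s" "s \<le> 1" and w: "norm w \<le> 1 / 4"
  shows "(\<lambda>j. exp_arcsin_coeff s j * sin w ^ j) sums exp (\<i> * of_real s * w)"
proof -
  define b where "b = exp_arcsin_coeff s"
  define H where "H u = (\<Sum>j. b j * u ^ j)" for u :: complex
  define H1 where "H1 u = (\<Sum>j. diffs b j * u ^ j)" for u :: complex
  define H2 where "H2 u = (\<Sum>j. diffs (diffs b) j * u ^ j)" for u :: complex
  have lt1: "norm (sin w) < 1" if "norm w \<le> 1 / 4" for w :: complex
  proof -
    have "norm (sin w) \<le> norm w * exp (norm w)" by (rule norm_sin_le_mult_exp)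
    also have "\<dots> \<le> 1 / 4 * exp (1 / 4)"
      using that by (intro mult_mono) auto
    finally show ?thesis using exp_quarter_le by simp
  qed
  note ode = exp_arcsin_series_solves_ode[OF s, folded b_def, folded H_def H1_def H2_def]
  define g where "g w = H (sin w)" for w
  define g1 where "g1 w = H1 (sin w) * cos w" for w
  have Dg: "(g has_field_derivative g1 w) (at w)" if "norm w \<le> 1 / 4" for w
    unfolding g_def g1_def
    using DERIV_chain[OF ode(2)[OF lt1[OF that]] DERIV_sin] by (simp only: o_def)
  have Dg1: "(g1 has_field_derivative (- (of_real s ^ 2 * g w))) (at w)" if "norm w \<le> 1 / 4" for w
  proof -
    have "((\<lambda>w. H1 (sin w)) has_field_derivative H2 (sin w) * cos w) (at w)"
      using DERIV_chain[OF ode(3)[OF lt1[OF that]] DERIV_sin] by (simp only: o_def)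
    then have "(g1 has_field_derivative H2 (sin w) * cos w * cos w + H1 (sin w) * (- sin w)) (at w)"
      unfolding g1_def by (auto intro!: derivative_eq_intros)
    moreover have "H2 (sin w) * cos w * cos w + H1 (sin w) * (- sin w) = (1 - sin w ^ 2) * H2 (sin w) - sin w * H1 (sin w)"
      using cos_squared_eq[of w] by (simp add: power2_eq_square mult.assoc)
    moreover have "\<dots> = - (of_real s ^ 2 * g w)"
      using ode(4)[OF lt1[OF that]] by (simp add: g_def eq_neg_iff_add_eq_0)
    ultimately show ?thesis by simp
  qed
  have g0: "g 0 = 1"
    using powser_zero[of b] by (simp add: g_def H_def b_def)
  have g10: "g1 0 = \<i> * of_real s"
    using powser_zero[of "diffs b"] by (simp add: g1_def H1_def b_def diffs_def)
  \<comment> \<open>Factoring \<open>g'' + s\<^sup>2 g = 0\<close>: the function \<open>g' - i s g\<close> solves a first-order equation and vanishes at 0.\<close>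
  define p where "p w = (g1 w - \<i> * of_real s * g w) * exp (\<i> * of_real s * w)" for w
  have p0: "p w = 0" if "norm w \<le> 1 / 4" for w
  proof -
    have "p w = p 0"
    proof (rule has_field_derivative_zero_constant[of "cball 0 (1/4)" p, THEN exE])
      show "(p has_field_derivative 0) (at x within cball 0 (1 / 4))" if "x \<in> cball 0 (1/4)" for x
      proof -
        have "(p has_field_derivative 0) (at x)"
          unfolding p_def using that
          by (auto intro!: derivative_eq_intros Dg Dg1 simp: algebra_simps power2_eq_square)
        then show ?thesis by (rule has_field_derivative_at_within)
      qed
      fix c assume "\<forall>x\<in>cball 0 (1 / 4). p x = c"
      then show ?thesis using that by simp
    qed auto
    then show ?thesis by (simp add: p_def g0 g10)
  qed
  define q where "q w = g w * exp (- \<i> * of_real s * w)" for w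
  have "q w = q 0"
  proof (rule has_field_derivative_zero_constant[of "cball 0 (1/4)" q, THEN exE])
    show "(q has_field_derivative 0) (at x within cball 0 (1 / 4))" if "x \<in> cball 0 (1/4)" for x
    proof -
      have "g1 x = \<i> * of_real s * g x"
        using p0[of x] that by (simp add: p_def)
      then have "(q has_field_derivative 0) (at x)"
        unfolding q_def using that
        by (auto intro!: derivative_eq_intros Dg simp: algebra_simps)
      then show ?thesis by (rule has_field_derivative_at_within)
    qed
    fix c assume "\<forall>x\<in>cball 0 (1 / 4). q x = c"
    then show ?thesis using w by simp
  qed auto
  then have "g w = exp (\<i> * of_real s * w)"
    by (simp add: q_def g0 exp_minus field_simps)
  then show ?thesis
    using ode(1)[OF lt1[OF w]] by (simp add: g_def b_def)
qed

text \<open>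
  Multiplication by \<open>sin w = (e\<^sup>i\<^sup>w - e\<^sup>-\<^sup>i\<^sup>w) / (2 i)\<close> averages two shifts of the coefficient
  sequence, hence does not increase the sum of absolute values.
\<close>

lemma sin_power_trig_poly:
  "\<exists>\<sigma> :: int \<Rightarrow> complex. (\<forall>w. sin w ^ j = (\<Sum>k=-int j..int j. \<sigma> k * exp (\<i> * of_int k * w))) \<and>
     (\<Sum>k=-int j..int j. norm (\<sigma> k)) \<le> 1"
proof (induction j)
  case 0
  show ?case by (intro exI[of _ "\<lambda>_. 1"]) auto
next
  case (Suc j)
  then obtain \<sigma> where \<sigma>: "\<And>w. sin w ^ j = (\<Sum>k=-int j..int j. \<sigma> k * exp (\<i> * of_int k * w))"
    "(\<Sum>k=-int j..int j. norm (\<sigma> k)) \<le> 1" by blast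
  define \<tau> where "\<tau> k = (if k \<in> {-int j..int j} then \<sigma> k else 0)" for k
  define \<sigma>' where "\<sigma>' k = (\<tau> (k - 1) - \<tau> (k + 1)) / (2 * \<i>)" for k
  have up: "(\<Sum>k=-int (Suc j)..int (Suc j). h (k - 1) (\<tau> (k - 1))) = (\<Sum>k=-int j..int j. h k (\<sigma> k))"
    if "\<And>k. h k 0 = 0" for h :: "int \<Rightarrow> complex \<Rightarrow> 'b::comm_monoid_add"
  proof -
    have "(\<Sum>k=-int j..int j. h k (\<sigma> k)) = (\<Sum>k=-int j+1..int j+1. h (k - 1) (\<tau> (k - 1)))"
      by (rule sum.reindex_bij_witness[of _ "\<lambda>k. k - 1" "\<lambda>k. k + 1"]) (auto simp: \<tau>_def)
    also have "\<dots> = (\<Sum>k=-int (Suc j)..int (Suc j). h (k - 1) (\<tau> (k - 1)))"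
      by (rule sum.mono_neutral_left) (auto simp: \<tau>_def that)
    finally show ?thesis by simp
  qed
  have down: "(\<Sum>k=-int (Suc j)..int (Suc j). h (k + 1) (\<tau> (k + 1))) = (\<Sum>k=-int j..int j. h k (\<sigma> k))"
    if "\<And>k. h k 0 = 0" for h :: "int \<Rightarrow> complex \<Rightarrow> 'b::comm_monoid_add"
  proof -
    have "(\<Sum>k=-int j..int j. h k (\<sigma> k)) = (\<Sum>k=-int j-1..int j-1. h (k + 1) (\<tau> (k + 1)))"
      by (rule sum.reindex_bij_witness[of _ "\<lambda>k. k + 1" "\<lambda>k. k - 1"]) (auto simp: \<tau>_def)
    also have "\<dots> = (\<Sum>k=-int (Suc j)..int (Suc j). h (k + 1) (\<tau> (k + 1)))"
      by (rule sum.mono_neutral_left) (auto simp: \<tau>_def that)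
    finally show ?thesis by simp
  qed
  show ?case
  proof (intro exI[of _ \<sigma>'] conjI allI)
    fix w
    have "sin w ^ Suc j = (exp (\<i> * w) - exp (- (\<i> * w))) / (2 * \<i>) * (\<Sum>k=-int j..int j. \<sigma> k * exp (\<i> * of_int k * w))"
      by (simp add: \<sigma>(1)[symmetric] sin_exp_eq)
    also have "\<dots> = ((\<Sum>k=-int j..int j. \<sigma> k * exp (\<i> * of_int (k + 1) * w)) -
        (\<Sum>k=-int j..int j. \<sigma> k * exp (\<i> * of_int (k - 1) * w))) / (2 * \<i>)"
      by (simp add: sum_distrib_left sum_subtractf[symmetric] sum_divide_distrib diff_divide_distrib algebra_simps
          exp_add[symmetric] exp_diff exp_minus)
         (simp add: divide_simps exp_add exp_diff mult_ac)
    also have "(\<Sum>k=-int j..int j. \<sigma> k * exp (\<i> * of_int (k + 1) * w)) =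
        (\<Sum>k=-int (Suc j)..int (Suc j). \<tau> (k - 1) * exp (\<i> * of_int k * w))"
      using up[of "\<lambda>k z. z * exp (\<i> * of_int (k + 1) * w)"] by simp
    also have "(\<Sum>k=-int j..int j. \<sigma> k * exp (\<i> * of_int (k - 1) * w)) =
        (\<Sum>k=-int (Suc j)..int (Suc j). \<tau> (k + 1) * exp (\<i> * of_int k * w))"
      using down[of "\<lambda>k z. z * exp (\<i> * of_int (k - 1) * w)"] by simp
    finally show "sin w ^ Suc j = (\<Sum>k=-int (Suc j)..int (Suc j). \<sigma>' k * exp (\<i> * of_int k * w))"
      by (simp add: \<sigma>'_def sum_subtractf[symmetric] sum_divide_distrib algebra_simps diff_divide_distrib)
  next
    have "(\<Sum>k=-int (Suc j)..int (Suc j). norm (\<sigma>' k))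
        \<le> (\<Sum>k=-int (Suc j)..int (Suc j). (norm (\<tau> (k - 1)) + norm (\<tau> (k + 1))) / 2)"
      by (intro sum_mono) (auto simp: \<sigma>'_def norm_divide norm_mult norm_triangle_ineq4)
    also have "\<dots> = ((\<Sum>k=-int j..int j. norm (\<sigma> k)) + (\<Sum>k=-int j..int j. norm (\<sigma> k))) / 2"
      using up[of "\<lambda>k. norm"] down[of "\<lambda>k. norm"]
      by (simp only: sum_divide_distrib[symmetric] sum.distrib norm_zero simp_thms)
    finally show "(\<Sum>k=-int (Suc j)..int (Suc j). norm (\<sigma>' k)) \<le> 1"
      using \<sigma>(2) by simp
  qed
qed

lemma higher_deriv_exp_minus_exp_sum:
  fixes a m :: "'k \<Rightarrow> complex" and m0 :: complex
  shows "(deriv ^^ q) (\<lambda>w. exp (m0 * w) - (\<Sum>k\<in>A. a k * exp (m k * w)))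
    = (\<lambda>w. m0 ^ q * exp (m0 * w) - (\<Sum>k\<in>A. a k * m k ^ q * exp (m k * w)))"
proof (induction q)
  case (Suc q)
  have "deriv (\<lambda>w. m0 ^ q * exp (m0 * w) - (\<Sum>k\<in>A. a k * m k ^ q * exp (m k * w))) w
      = m0 ^ Suc q * exp (m0 * w) - (\<Sum>k\<in>A. a k * m k ^ Suc q * exp (m k * w))" for w
    by (rule DERIV_imp_deriv) (auto intro!: derivative_eq_intros sum.cong simp: mult_ac)
  then show ?case using Suc by auto
qed simp

lemma borel_measurable_exp_arcsin_coeff [measurable]:
  "(\<lambda>s. exp_arcsin_coeff s j) \<in> borel_measurable borel"
proof (rule borel_measurable_continuous_onI)
  show "continuous_on UNIV (\<lambda>s. exp_arcsin_coeff s j)"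
    by (induction j rule: induct_nat_012)
       (auto intro!: continuous_intros simp del: of_nat_Suc of_nat_add)
qed

text \<open>
  The one-dimensional heart of the proof. Write \<open>\<tau> = l + s\<close> with \<open>l = \<lfloor>\<tau>\<rfloor>\<close>; then
  \<open>e\<^sup>i\<^sup>\<tau>\<^sup>w = e\<^sup>i\<^sup>l\<^sup>w \<Sum> b j sin\<^sup>j w\<close>, and dropping the terms with \<open>j > J\<close> leaves a trigonometric polynomial
  with frequencies in \<open>[l - J, l + J]\<close> and coefficient sum at most 5, whatever \<open>J\<close> is. On the
  complex disc of radius 1/8 around a point of \<open>[0, 1/8]\<close> one has \<open>|sin| \<le> 1/3\<close> and
  \<open>|e\<^sup>i\<^sup>l\<^sup>w| \<le> (3/2)\<^sup>J\<close>, so the error there is of order \<open>(1/2)\<^sup>J\<close>; Cauchy's inequality carries this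
  over to all derivatives. Coefficients are set to zero when \<open>\<tau>\<close> is too large for the given \<open>J\<close>.
\<close>

lemma exp_discretization:
  obtains c :: "nat \<Rightarrow> int \<Rightarrow> real \<Rightarrow> complex" where
    "\<And>J \<kappa>. c J \<kappa> \<in> borel_measurable borel"
    "\<And>J \<tau>. (\<Sum>\<kappa>=-2*int J..2*int J. norm (c J \<kappa> \<tau>)) \<le> 5"
    "\<And>J \<kappa> \<tau>. int J < \<bar>\<lfloor>\<tau>\<rfloor>\<bar> \<Longrightarrow> c J \<kappa> \<tau> = 0"
    "\<And>J \<tau> q w. \<bar>\<lfloor>\<tau>\<rfloor>\<bar> \<le> int J \<Longrightarrow> 0 \<le> w \<Longrightarrow> w \<le> 1 / 8 \<Longrightarrow>
       norm ((\<i> * of_real \<tau>) ^ q * exp (\<i> * of_real \<tau> * of_real w) -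
         (\<Sum>\<kappa>=-2*int J..2*int J. c J \<kappa> \<tau> * (\<i> * of_int \<kappa>) ^ q * exp (\<i> * of_int \<kappa> * of_real w)))
       \<le> 5 * fact q * 8 ^ q * (1 / 2) ^ J"
proof -
  have "\<exists>\<sigma> :: nat \<Rightarrow> int \<Rightarrow> complex. \<forall>j. (\<forall>w. sin w ^ j = (\<Sum>k=-int j..int j. \<sigma> j k * exp (\<i> * of_int k * w))) \<and>
     (\<Sum>k=-int j..int j. norm (\<sigma> j k)) \<le> 1"
    by (intro choice allI sin_power_trig_poly)
  then obtain \<rho> :: "nat \<Rightarrow> int \<Rightarrow> complex" where
    \<rho>: "\<And>j w. sin w ^ j = (\<Sum>k=-int j..int j. \<rho> j k * exp (\<i> * of_int k * w))"
       "\<And>j. (\<Sum>k=-int j..int j. norm (\<rho> j k)) \<le> 1"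
    by blast
  define \<sigma> where "\<sigma> j k = (if \<bar>k\<bar> \<le> int j then \<rho> j k else 0)" for j k
  have \<sigma>_sum: "(\<Sum>k=-int J..int J. h k (\<sigma> j k)) = (\<Sum>k=-int j..int j. h k (\<rho> j k))"
    if "j \<le> J" "\<And>k. h k 0 = 0" for J j and h :: "int \<Rightarrow> complex \<Rightarrow> 'b::comm_monoid_add"
  proof -
    have "(\<Sum>k=-int j..int j. h k (\<rho> j k)) = (\<Sum>k=-int j..int j. h k (\<sigma> j k))"
      by (intro sum.cong) (auto simp: \<sigma>_def)
    also have "\<dots> = (\<Sum>k=-int J..int J. h k (\<sigma> j k))"
      using that by (intro sum.mono_neutral_left) (auto simp: \<sigma>_def)
    finally show ?thesis by simp
  qed
  define a where "a J k s = (\<Sum>j\<le>J. exp_arcsin_coeff s j * \<sigma> j k)" for J k s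
  have a_zero: "a J k s = 0" if "int J < \<bar>k\<bar>" for J k s
    using that by (auto simp: a_def \<sigma>_def intro!: sum.neutral)
  have a_norm: "(\<Sum>k=-int J..int J. norm (a J k s)) \<le> 5" if "0 \<le> s" "s \<le> 1" for J s
  proof -
    have "(\<Sum>k=-int J..int J. norm (a J k s))
        \<le> (\<Sum>k=-int J..int J. \<Sum>j\<le>J. norm (exp_arcsin_coeff s j) * norm (\<sigma> j k))"
      unfolding a_def by (intro sum_mono sum_norm_le) (simp add: norm_mult)
    also have "\<dots> = (\<Sum>j\<le>J. norm (exp_arcsin_coeff s j) * (\<Sum>k=-int J..int J. norm (\<sigma> j k)))"
      by (subst sum.swap) (simp add: sum_distrib_left)
    also have "\<dots> \<le> (\<Sum>j\<le>J. norm (exp_arcsin_coeff s j) * 1)"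
      using \<sigma>_sum[of _ J "\<lambda>_. norm"] \<rho>(2) by (intro sum_mono mult_left_mono) auto
    also have "\<dots> \<le> 5"
      using sum_norm_exp_arcsin_coeff_le[OF that, of "Suc J"] by (simp add: lessThan_Suc_atMost)
    finally show ?thesis .
  qed
  have a_sum: "(\<Sum>k=-int J..int J. a J k s * exp (\<i> * of_int k * w)) = (\<Sum>j\<le>J. exp_arcsin_coeff s j * sin w ^ j)"
    for J s w
  proof -
    have "(\<Sum>k=-int J..int J. a J k s * exp (\<i> * of_int k * w))
        = (\<Sum>j\<le>J. exp_arcsin_coeff s j * (\<Sum>k=-int J..int J. \<sigma> j k * exp (\<i> * of_int k * w)))"
      unfolding a_def sum_distrib_right sum_distrib_left by (subst sum.swap) (simp add: mult_ac)
    also have "\<dots> = (\<Sum>j\<le>J. exp_arcsin_coeff s j * sin w ^ j)"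
      using \<sigma>_sum[of _ J "\<lambda>k z. z * exp (\<i> * of_int k * w)"] by (intro sum.cong) (auto simp: \<rho>(1))
    finally show ?thesis .
  qed
  \<comment> \<open>Multiplication by \<open>e\<^sup>i\<^sup>l\<^sup>w\<close> with \<open>l = \<lfloor>\<tau>\<rfloor>\<close> shifts the coefficients by \<open>l\<close>.\<close>
  define c where "c J \<kappa> \<tau> = (if \<bar>\<lfloor>\<tau>\<rfloor>\<bar> \<le> int J then a J (\<kappa> - \<lfloor>\<tau>\<rfloor>) (frac \<tau>) else 0)" for J \<kappa> \<tau>
  have shift: "(\<Sum>\<kappa>=-2*int J..2*int J. h \<kappa> (c J \<kappa> \<tau>)) = (\<Sum>k=-int J..int J. h (k + \<lfloor>\<tau>\<rfloor>) (a J k (frac \<tau>)))"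
    if "\<bar>\<lfloor>\<tau>\<rfloor>\<bar> \<le> int J" "\<And>k. h k 0 = 0" for J \<tau> and h :: "int \<Rightarrow> complex \<Rightarrow> 'b::comm_monoid_add"
  proof -
    have "(\<Sum>k=-int J..int J. h (k + \<lfloor>\<tau>\<rfloor>) (a J k (frac \<tau>)))
        = (\<Sum>\<kappa>=-int J+\<lfloor>\<tau>\<rfloor>..int J+\<lfloor>\<tau>\<rfloor>. h \<kappa> (c J \<kappa> \<tau>))"
      using that(1) by (intro sum.reindex_bij_witness[of _ "\<lambda>k. k - \<lfloor>\<tau>\<rfloor>" "\<lambda>k. k + \<lfloor>\<tau>\<rfloor>"]) (auto simp: c_def)
    also have "\<dots> = (\<Sum>\<kappa>=-2*int J..2*int J. h \<kappa> (c J \<kappa> \<tau>))"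
      using that by (intro sum.mono_neutral_left) (auto simp: c_def a_zero)
    finally show ?thesis by simp
  qed
  show ?thesis
  proof (rule that[of c])
    fix J \<kappa>
    have [measurable]: "(\<lambda>\<tau>. \<sigma> j (\<kappa> - \<lfloor>\<tau>::real\<rfloor>)) \<in> borel_measurable borel" for j
      by (rule measurable_compose[of "\<lambda>\<tau>. \<lfloor>\<tau>\<rfloor>" _ "count_space UNIV" "\<lambda>k. \<sigma> j (\<kappa> - k)"]) auto
    have [measurable]: "(\<lambda>\<tau>. frac \<tau> :: real) \<in> borel_measurable borel"
      unfolding frac_def by measurable
    have [measurable]: "(\<lambda>\<tau>. exp_arcsin_coeff (frac \<tau>) j) \<in> borel_measurable borel" for j
      by measurable
    have [measurable]: "Measurable.pred borel (\<lambda>\<tau>::real. \<bar>\<lfloor>\<tau>\<rfloor>\<bar> \<le> int J)"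
      by (rule measurable_compose[of "\<lambda>\<tau>. \<lfloor>\<tau>\<rfloor>" _ "count_space UNIV"]) auto
    show "c J \<kappa> \<in> borel_measurable borel"
      unfolding c_def[abs_def] a_def by measurable
  next
    fix J and \<tau> :: real
    show "(\<Sum>\<kappa>=-2*int J..2*int J. norm (c J \<kappa> \<tau>)) \<le> 5"
    proof (cases "\<bar>\<lfloor>\<tau>\<rfloor>\<bar> \<le> int J")
      case True
      then show ?thesis
        using shift[OF True, of "\<lambda>_. norm"] a_norm[of "frac \<tau>" J] frac_lt_1[of \<tau>] by simp
    qed (simp add: c_def)
  next
    fix J \<kappa> and \<tau> :: real assume "int J < \<bar>\<lfloor>\<tau>\<rfloor>\<bar>"
    then show "c J \<kappa> \<tau> = 0" by (simp add: c_def)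
  next
    fix J :: nat and \<tau> w :: real and q :: nat
    assume \<tau>: "\<bar>\<lfloor>\<tau>\<rfloor>\<bar> \<le> int J" and w: "0 \<le> w" "w \<le> 1 / 8"
    define E where "E = (\<lambda>z. exp (\<i> * of_real \<tau> * z) - (\<Sum>\<kappa>=-2*int J..2*int J. c J \<kappa> \<tau> * exp (\<i> * of_int \<kappa> * z)))"
    define s where "s = frac \<tau>"
    have s: "0 \<le> s" "s \<le> 1" using frac_lt_1[of \<tau>] by (auto simp: s_def)
    have bound: "norm (E z) \<le> 5 * (1 / 2) ^ J" if z: "norm (of_real w - z) = 1 / 8" for z
    proof -
      have nz: "norm z \<le> 1 / 4"
        using z w norm_triangle_ineq4[of "of_real w" "of_real w - z"] by simp
      have "norm (sin z) \<le> norm z * exp (norm z)" by (rule norm_sin_le_mult_exp)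
      also have "\<dots> \<le> 1 / 4 * exp (1 / 4)" using nz by (intro mult_mono) auto
      finally have sin_z: "norm (sin z) \<le> 1 / 3" using exp_quarter_le by simp
      have sum_eq: "(\<Sum>\<kappa>=-2*int J..2*int J. c J \<kappa> \<tau> * exp (\<i> * of_int \<kappa> * z))
          = exp (\<i> * of_int \<lfloor>\<tau>\<rfloor> * z) * (\<Sum>j\<le>J. exp_arcsin_coeff s j * sin z ^ j)"
      proof -
        have "(\<Sum>\<kappa>=-2*int J..2*int J. c J \<kappa> \<tau> * exp (\<i> * of_int \<kappa> * z))
          = (\<Sum>k=-int J..int J. a J k s * exp (\<i> * of_int (k + \<lfloor>\<tau>\<rfloor>) * z))"
        unfolding s_def by (rule shift[OF \<tau>]) simp
      also have "\<dots> = exp (\<i> * of_int \<lfloor>\<tau>\<rfloor> * z) * (\<Sum>j\<le>J. exp_arcsin_coeff s j * sin z ^ j)"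
          by (simp add: a_sum[symmetric] sum_distrib_left exp_add[symmetric] algebra_simps)
        finally show ?thesis .
      qed
      have exp_eq: "exp (\<i> * of_real \<tau> * z) = exp (\<i> * of_int \<lfloor>\<tau>\<rfloor> * z) * exp (\<i> * of_real s * z)"
      proof -
        have "of_real \<tau> = (of_int \<lfloor>\<tau>\<rfloor> + of_real s :: complex)"
          unfolding s_def frac_def by simp
        then show ?thesis by (simp add: exp_add[symmetric] algebra_simps)
      qed
      have E: "E z = exp (\<i> * of_int \<lfloor>\<tau>\<rfloor> * z) *
          (exp (\<i> * of_real s * z) - (\<Sum>j\<le>J. exp_arcsin_coeff s j * sin z ^ j))"
        unfolding E_def sum_eq exp_eq by (simp add: algebra_simps)
      have "norm (exp (\<i> * of_int \<lfloor>\<tau>\<rfloor> * z)) \<le> exp (real J * (1 / 8))"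
      proof -
        have "\<bar>Im z\<bar> \<le> 1 / 8"
          using abs_Im_le_cmod[of "of_real w - z"] z by simp
        then have "\<bar>of_int \<lfloor>\<tau>\<rfloor> * Im z\<bar> \<le> real J * (1 / 8)"
          unfolding abs_mult using \<tau> by (intro mult_mono) auto
        then show ?thesis by (simp add: norm_exp_eq_Re)
      qed
      also have "\<dots> = exp (1 / 8) ^ J" by (simp only: exp_of_nat_mult)
      also have "\<dots> \<le> (3 / 2) ^ J"
      proof (rule power_mono)
        have "exp (1 / 8 :: real) \<le> exp (1 / 4)" by simp
        then show "exp (1 / 8 :: real) \<le> 3 / 2" using exp_quarter_le by linarith
      qed simp
      finally have 1: "norm (exp (\<i> * of_int \<lfloor>\<tau>\<rfloor> * z)) \<le> (3 / 2) ^ J" .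
      have "norm (exp (\<i> * of_real s * z) - (\<Sum>j\<le>J. exp_arcsin_coeff s j * sin z ^ j)) \<le> 5 * (1 / 3) ^ J"
      proof (rule tendsto_upperbound)
        show "(\<lambda>n. norm ((\<Sum>j<n. exp_arcsin_coeff s j * sin z ^ j) - (\<Sum>j\<le>J. exp_arcsin_coeff s j * sin z ^ j)))
          \<longlonglongrightarrow> norm (exp (\<i> * of_real s * z) - (\<Sum>j\<le>J. exp_arcsin_coeff s j * sin z ^ j))"
          using exp_eq_exp_arcsin_series[OF s nz] by (intro tendsto_intros) (simp add: sums_def)
        show "\<forall>\<^sub>F n in sequentially. norm ((\<Sum>j<n. exp_arcsin_coeff s j * sin z ^ j) - (\<Sum>j\<le>J. exp_arcsin_coeff s j * sin z ^ j))
            \<le> 5 * (1 / 3) ^ J"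
          using eventually_gt_at_top[of J]
        proof eventually_elim
          case (elim n)
          have "(\<Sum>j<n. exp_arcsin_coeff s j * sin z ^ j) - (\<Sum>j\<le>J. exp_arcsin_coeff s j * sin z ^ j)
              = (\<Sum>j\<in>{..<n} - {..J}. exp_arcsin_coeff s j * sin z ^ j)"
            using elim by (subst sum_diff) auto
          also have "norm \<dots> \<le> (\<Sum>j\<in>{..<n} - {..J}. norm (exp_arcsin_coeff s j) * (1 / 3) ^ J)"
          proof (rule sum_norm_le)
            fix j assume j: "j \<in> {..<n} - {..J}"
            have "norm (sin z) ^ j \<le> (1 / 3) ^ j" using sin_z by (intro power_mono) auto
            also have "\<dots> \<le> (1 / 3) ^ J" using j by (intro power_decreasing) auto
            finally show "norm (exp_arcsin_coeff s j * sin z ^ j) \<le> norm (exp_arcsin_coeff s j) * (1 / 3) ^ J"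
              by (simp add: norm_mult norm_power mult_left_mono)
          qed
          also have "\<dots> \<le> (\<Sum>j<n. norm (exp_arcsin_coeff s j)) * (1 / 3) ^ J"
            unfolding sum_distrib_right by (intro sum_mono2) auto
          also have "\<dots> \<le> 5 * (1 / 3) ^ J"
            by (intro mult_right_mono sum_norm_exp_arcsin_coeff_le s) auto
          finally show ?case .
        qed
      qed simp
      then have "norm (E z) \<le> (3 / 2) ^ J * (5 * (1 / 3) ^ J)"
        unfolding E norm_mult using 1 by (intro mult_mono) auto
      also have "\<dots> = 5 * (1 / 2) ^ J" by (simp add: power_divide)
      finally show ?thesis .
    qed
    have "norm ((deriv ^^ q) E (of_real w)) \<le> fact q * (5 * (1 / 2) ^ J) / (1 / 8) ^ q"
    proof (rule Cauchy_inequality)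
      show "E holomorphic_on ball (of_real w) (1 / 8)" unfolding E_def by (intro holomorphic_intros)
      show "continuous_on (cball (of_real w) (1 / 8)) E" unfolding E_def by (intro continuous_intros)
    qed (use bound in auto)
    then show "norm ((\<i> * of_real \<tau>) ^ q * exp (\<i> * of_real \<tau> * of_real w) -
         (\<Sum>\<kappa>=-2*int J..2*int J. c J \<kappa> \<tau> * (\<i> * of_int \<kappa>) ^ q * exp (\<i> * of_int \<kappa> * of_real w)))
       \<le> 5 * fact q * 8 ^ q * (1 / 2) ^ J"
      unfolding E_def higher_deriv_exp_minus_exp_sum by (simp add: power_divide mult_ac)
  qed
qed

section \<open>Fourier inversion against test functions\<close>

definition plane_wave :: "'a::euclidean_space \<Rightarrow> 'a \<Rightarrow> complex" where
  "plane_wave \<xi> x = exp (2 * of_real pi * \<i> * of_real (\<xi> \<bullet> x))"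

lemma norm_plane_wave [simp]: "norm (plane_wave \<xi> x) = 1"
  by (simp add: plane_wave_def norm_exp_eq_Re)

lemma plane_wave_diff: "plane_wave \<xi> (x - y) = plane_wave \<xi> x * plane_wave (- \<xi>) y"
  by (simp add: plane_wave_def inner_diff_right exp_add[symmetric] algebra_simps)

lemma plane_wave_scaleR: "plane_wave (a *\<^sub>R \<xi>) x = plane_wave \<xi> (a *\<^sub>R x)"
  by (simp add: plane_wave_def)

lemma continuous_plane_wave [continuous_intros]:
  "continuous_on A f \<Longrightarrow> continuous_on A g \<Longrightarrow> continuous_on A (\<lambda>x. plane_wave (f x) (g x))"
  unfolding plane_wave_def by (intro continuous_intros)

lemma borel_measurable_plane_wave [measurable (raw)]:
  "f \<in> borel_measurable M \<Longrightarrow> g \<in> borel_measurable M \<Longrightarrow> (\<lambda>x. plane_wave (f x) (g x)) \<in> borel_measurable M"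
  unfolding plane_wave_def by measurable

lemma fourier_eq_plane_wave: "fourier g \<xi> = (LINT x|lebesgue. g x * plane_wave (- \<xi>) x)"
  by (simp add: fourier_def plane_wave_def)

text \<open>
  The form in which Fubini's theorem is applied throughout.
\<close>

lemma integral_swap_bounded_kernel:
  fixes f :: "'a::euclidean_space \<Rightarrow> complex" and g :: "'b::euclidean_space \<Rightarrow> complex"
  assumes f: "integrable lborel f" and g: "integrable lborel g"
    and K [measurable]: "case_prod K \<in> borel_measurable (borel \<Otimes>\<^sub>M borel)"
    and K_bound: "\<And>x y. norm (K x y) \<le> C"
  shows "(LINT x|lborel. f x * (LINT y|lborel. g y * K x y)) = (LINT y|lborel. g y * (LINT x|lborel. f x * K x y))"
proof -
  have [measurable]: "f \<in> borel_measurable borel" "g \<in> borel_measurable borel"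
    using f g by (auto dest: borel_measurable_integrable)
  have [measurable]: "K x \<in> borel_measurable borel" for x
    using measurable_Pair2[OF K, of x] by simp
  have [simp]: "C \<ge> 0" using K_bound[of undefined undefined] norm_ge_zero order_trans by blast
  have "integrable (lborel \<Otimes>\<^sub>M lborel) (\<lambda>(x, y). f x * g y * K x y)"
  proof (rule lborel_pair.Fubini_integrable)
    show "integrable lborel (\<lambda>x. \<integral>y. norm (case (x, y) of (x, y) \<Rightarrow> f x * g y * K x y) \<partial>lborel)"
    proof (rule Bochner_Integration.integrable_bound)
      show "integrable lborel (\<lambda>x. norm (f x) * (C * (\<integral>y. norm (g y) \<partial>lborel)))"
        using f by auto
      show "AE x in lborel. norm (\<integral>y. norm (case (x, y) of (x, y) \<Rightarrow> f x * g y * K x y) \<partial>lborel)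
          \<le> norm (norm (f x) * (C * (\<integral>y. norm (g y) \<partial>lborel)))"
      proof (rule AE_I2)
        fix x
        have "(\<integral>y. norm (f x * g y * K x y) \<partial>lborel) \<le> (\<integral>y. norm (f x) * C * norm (g y) \<partial>lborel)"
        proof (rule integral_mono')
          show "norm (f x * g y * K x y) \<le> norm (f x) * C * norm (g y)" for y
            using mult_left_mono[OF K_bound[of x y], of "norm (f x) * norm (g y)"]
            by (simp add: norm_mult mult_ac)
        qed (use g in auto)
        then show "norm (\<integral>y. norm (case (x, y) of (x, y) \<Rightarrow> f x * g y * K x y) \<partial>lborel)
          \<le> norm (norm (f x) * (C * (\<integral>y. norm (g y) \<partial>lborel)))"
          by (simp add: abs_mult integral_nonneg_AE mult_ac)
      qed
    qed measurable
    show "AE x in lborel. integrable lborel (\<lambda>y. case (x, y) of (x, y) \<Rightarrow> f x * g y * K x y)"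
    proof (rule AE_I2)
      fix x
      show "integrable lborel (\<lambda>y. case (x, y) of (x, y) \<Rightarrow> f x * g y * K x y)"
      proof (rule Bochner_Integration.integrable_bound)
        show "integrable lborel (\<lambda>y. norm (f x) * C * norm (g y))" using g by auto
        show "AE y in lborel. norm (case (x, y) of (x, y) \<Rightarrow> f x * g y * K x y) \<le> norm (norm (f x) * C * norm (g y))"
          using mult_left_mono[OF K_bound, of "norm (f x) * norm (g y)" for y]
          by (auto simp: norm_mult mult_ac)
      qed (simp only: prod.case, measurable)
    qed
  qed measurable
  note swap = lborel_pair.Fubini_integral[OF this]
  have "(LINT y|lborel. f x * g y * K x y) = f x * (LINT y|lborel. g y * K x y)" for x
    by (subst integral_mult_right_zero[symmetric]) (simp add: mult.assoc)
  moreover have "(LINT x|lborel. f x * g y * K x y) = g y * (LINT x|lborel. f x * K x y)" for y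
    by (subst integral_mult_right_zero[symmetric]) (simp add: mult_ac)
  ultimately show ?thesis using swap by simp
qed

lemma lborel_integral_affine:
  fixes f :: "'a::euclidean_space \<Rightarrow> complex"
  assumes [measurable]: "f \<in> borel_measurable borel" and c: "c \<noteq> 0"
  shows "(LINT x|lborel. f x) = \<bar>c\<bar> ^ DIM('a) *\<^sub>R (LINT x|lborel. f (t + c *\<^sub>R x))"
proof -
  have "(LINT x|lborel. f x) = (LINT x|density (distr lborel borel (\<lambda>x. t + c *\<^sub>R x)) (\<lambda>_. \<bar>c\<bar> ^ DIM('a)). f x)"
    using lborel_affine[OF c, where t = t] by simp
  then show ?thesis
    by (simp add: integral_density integral_distr)
qed

lemma lborel_integral_prod_Basis:
  fixes f :: "'a::euclidean_space \<Rightarrow> real \<Rightarrow> complex"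
  assumes f: "\<And>b. b \<in> Basis \<Longrightarrow> integrable lborel (f b)"
  shows "integrable lborel (\<lambda>x::'a. \<Prod>b\<in>Basis. f b (x \<bullet> b))"
    and "(LINT x|lborel. (\<Prod>b\<in>Basis. f b (x \<bullet> b))) = (\<Prod>b\<in>Basis. LINT t|lborel. f b t)"
proof -
  interpret product_sigma_finite "\<lambda>_::'a. lborel :: real measure" ..
  have [measurable]: "f b \<in> borel_measurable borel" if "b \<in> Basis" for b
    using f[OF that] by (auto dest: borel_measurable_integrable)
  have m: "(\<lambda>x::'a. \<Prod>b\<in>Basis. f b (x \<bullet> b)) \<in> borel_measurable borel"
    by measurable
  have T: "(\<lambda>y. \<Sum>b\<in>Basis. y b *\<^sub>R b) \<in> (\<Pi>\<^sub>M b\<in>Basis. (lborel :: real measure)) \<rightarrow>\<^sub>M (borel :: 'a measure)"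
    by measurable
  show "integrable lborel (\<lambda>x::'a. \<Prod>b\<in>Basis. f b (x \<bullet> b))"
    unfolding lborel_eq[where 'a = 'a] integrable_distr_eq[OF T m]
    using product_integrable_prod[OF finite_Basis f] by (simp cong: prod.cong)
  show "(LINT x|lborel. (\<Prod>b\<in>Basis. f b (x \<bullet> b))) = (\<Prod>b\<in>Basis. LINT t|lborel. f b t)"
    unfolding lborel_eq[where 'a = 'a] integral_distr[OF T m]
    using product_integral_prod[OF finite_Basis f] by (simp cong: prod.cong)
qed

lemma integral_gaussian_exp:
  fixes t :: real
  shows "integrable lborel (\<lambda>x. of_real (exp (- x\<^sup>2 / 2)) * exp (\<i> * of_real (t * x)))"
    and "(LINT x|lborel. of_real (exp (- x\<^sup>2 / 2)) * exp (\<i> * of_real (t * x))) = of_real (sqrt (2 * pi) * exp (- t\<^sup>2 / 2))"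
proof -
  have std: "exp (- x\<^sup>2 / 2) = sqrt (2 * pi) * std_normal_density x" for x :: real
    by (simp add: std_normal_density_def)
  have int: "integrable lborel (\<lambda>x. std_normal_density x)"
    by (rule integrable_normal_density) simp
  then have "integrable lborel (\<lambda>x. sqrt (2 * pi) * std_normal_density x)" by simp
  then show "integrable lborel (\<lambda>x. of_real (exp (- x\<^sup>2 / 2)) * exp (\<i> * of_real (t * x)))"
    unfolding std by (rule Bochner_Integration.integrable_bound) (auto simp: norm_mult)
  have "(LINT x|lborel. of_real (exp (- x\<^sup>2 / 2)) * exp (\<i> * of_real (t * x)))
      = of_real (sqrt (2 * pi)) * (LINT x|lborel. std_normal_density x *\<^sub>R exp (\<i> * of_real (t * x)))"
    unfolding std by (simp add: scaleR_conv_of_real mult.assoc del: integral_mult_right flip: integral_mult_right_zero)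
  also have "(LINT x|lborel. std_normal_density x *\<^sub>R exp (\<i> * of_real (t * x))) = char std_normal_distribution t"
    unfolding char_def by (subst integral_density) auto
  finally show "(LINT x|lborel. of_real (exp (- x\<^sup>2 / 2)) * exp (\<i> * of_real (t * x))) = of_real (sqrt (2 * pi) * exp (- t\<^sup>2 / 2))"
    by (simp add: char_std_normal_distribution)
qed

definition gauss :: "'a::euclidean_space \<Rightarrow> complex" where
  "gauss \<xi> = of_real (exp (- (norm \<xi>)\<^sup>2 / 2))"

text \<open>
  A multiple of a narrower Gaussian; the factor \<open>2 \<pi>\<close> in the plane wave makes its total mass 1.
\<close>

definition gauss_transform :: "'a::euclidean_space \<Rightarrow> complex" where
  "gauss_transform y = (LINT \<xi>|lborel. gauss \<xi> * plane_wave \<xi> y)"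

lemma norm_gauss_le_1: "norm (gauss \<xi>) \<le> 1"
  by (simp add: gauss_def)

lemma borel_measurable_gauss [measurable]: "gauss \<in> borel_measurable borel"
  unfolding gauss_def by measurable

lemma gauss_mult_plane_wave_eq_prod:
  "gauss \<xi> * plane_wave \<xi> y =
    (\<Prod>b\<in>Basis. of_real (exp (- (\<xi> \<bullet> b)\<^sup>2 / 2)) * exp (\<i> * of_real ((2 * pi * (y \<bullet> b)) * (\<xi> \<bullet> b))))"
proof -
  have "(norm \<xi>)\<^sup>2 = (\<Sum>b\<in>Basis. (\<xi> \<bullet> b)\<^sup>2)"
    unfolding power2_norm_eq_inner by (subst euclidean_inner) (simp add: power2_eq_square)
  then have "gauss \<xi> = (\<Prod>b\<in>Basis. of_real (exp (- (\<xi> \<bullet> b)\<^sup>2 / 2)))"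
    by (simp add: gauss_def exp_sum[symmetric] sum_negf sum_divide_distrib flip: of_real_prod)
  moreover have "plane_wave \<xi> y = (\<Prod>b\<in>Basis. exp (\<i> * of_real ((2 * pi * (y \<bullet> b)) * (\<xi> \<bullet> b))))"
    unfolding plane_wave_def
    by (subst euclidean_inner) (simp add: exp_sum[symmetric] sum_distrib_left mult_ac)
  ultimately show ?thesis by (simp only: prod.distrib)
qed

lemma integrable_gauss: "integrable lborel (gauss :: 'a::euclidean_space \<Rightarrow> complex)"
proof -
  have "integrable lborel (\<lambda>\<xi>::'a. gauss \<xi> * plane_wave \<xi> 0)"
    unfolding gauss_mult_plane_wave_eq_prod
    by (intro lborel_integral_prod_Basis(1)) (rule integral_gaussian_exp)
  then show ?thesis by (simp add: plane_wave_def)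
qed

lemma gauss_transform_eq_prod:
  "gauss_transform y = (\<Prod>b\<in>Basis. of_real (sqrt (2 * pi) * exp (- (2 * pi * (y \<bullet> b))\<^sup>2 / 2)))"
  unfolding gauss_transform_def gauss_mult_plane_wave_eq_prod
  by (subst lborel_integral_prod_Basis(2)) (simp_all only: integral_gaussian_exp)

lemma integral_gauss_transform:
  shows "integrable lborel (gauss_transform :: 'a::euclidean_space \<Rightarrow> complex)"
    and "(LINT y|lborel. gauss_transform (y :: 'a)) = 1"
proof -
  define f :: "real \<Rightarrow> complex" where "f t = of_real (sqrt (2 * pi) * exp (- (2 * pi * t)\<^sup>2 / 2))" for t
  have f_int: "integrable lborel f" "(LINT t|lborel. f t) = 1"
  proof -
    define g :: "real \<Rightarrow> complex" where "g t = of_real (exp (- t\<^sup>2 / 2))" for t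
    have g: "integrable lborel g" "(LINT t|lborel. g t) = of_real (sqrt (2 * pi))"
      using integral_gaussian_exp[of 0] by (simp_all add: g_def[abs_def])
    have f_eq: "f t = of_real (sqrt (2 * pi)) * g (0 + (2 * pi) * t)" for t by (simp add: f_def g_def)
    show "integrable lborel f"
      unfolding f_eq using lborel_integrable_real_affine[OF g(1), of "2 * pi" 0] by simp
    have "(LINT t|lborel. g t) = \<bar>2 * pi\<bar> *\<^sub>R (LINT t|lborel. g (0 + (2 * pi) * t))"
      by (rule lborel_integral_real_affine) simp
    then have "(LINT t|lborel. g (0 + (2 * pi) * t)) = of_real (sqrt (2 * pi) / (2 * pi))"
      unfolding g(2) by (simp add: scaleR_conv_of_real field_simps)
    then have "(LINT t|lborel. f t) = of_real (sqrt (2 * pi) * (sqrt (2 * pi) / (2 * pi)))"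
      unfolding f_eq by (subst integral_mult_right_zero) (simp only: of_real_mult)
    also have "sqrt (2 * pi) * (sqrt (2 * pi) / (2 * pi)) = 1" by simp
    finally show "(LINT t|lborel. f t) = 1" by simp
  qed
  have eq: "gauss_transform = (\<lambda>y::'a. \<Prod>b\<in>Basis. f (y \<bullet> b))"
    by (simp add: gauss_transform_eq_prod f_def fun_eq_iff)
  show "integrable lborel (gauss_transform :: 'a \<Rightarrow> complex)"
    unfolding eq by (rule lborel_integral_prod_Basis(1)) (rule f_int)
  show "(LINT y|lborel. gauss_transform (y :: 'a)) = 1"
    unfolding eq by (subst lborel_integral_prod_Basis(2)) (auto simp: f_int)
qed

text \<open>
  Fourier inversion, integrated against a continuous function \<open>\<psi>\<close>. Insert the factor
  \<open>gauss (a \<xi>)\<close> on the right. Fubini turns the result into the integral of \<open>g\<close> against the convolution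
  of \<open>\<psi>\<close> with a Gaussian of mass one whose width is proportional to \<open>a\<close>; as \<open>a\<close>
  tends to 0, both sides converge by dominated convergence.
\<close>

lemma fourier_inversion_tested:
  fixes g \<psi> :: "'a::euclidean_space \<Rightarrow> complex"
  defines "gh \<equiv> \<lambda>\<xi>. LINT x|lborel. g x * plane_wave (- \<xi>) x"
  assumes g: "integrable lborel g" and gh: "integrable lborel gh"
    and \<psi>: "integrable lborel \<psi>" and cont: "continuous_on UNIV \<psi>" and bound: "\<And>x. norm (\<psi> x) \<le> C"
  shows "(LINT x|lborel. g x * \<psi> x) = (LINT \<xi>|lborel. gh \<xi> * (LINT x|lborel. \<psi> x * plane_wave \<xi> x))"
proof -
  let ?G = "gauss_transform :: 'a \<Rightarrow> complex"
  note G = integral_gauss_transform[where 'a = 'a]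
  have [measurable]: "g \<in> borel_measurable borel" "\<psi> \<in> borel_measurable borel" "gh \<in> borel_measurable borel"
    "?G \<in> borel_measurable borel"
    using g \<psi> gh G by (auto dest: borel_measurable_integrable)
  have C: "C \<ge> 0" using bound[of 0] norm_ge_zero order_trans by blast
  define \<Psi> where "\<Psi> \<xi> = (LINT x|lborel. \<psi> x * plane_wave \<xi> x)" for \<xi>
  have [measurable]: "\<Psi> \<in> borel_measurable borel" unfolding \<Psi>_def by measurable
  have \<Psi>_bound: "norm (\<Psi> \<xi>) \<le> (LINT x|lborel. norm (\<psi> x))" for \<xi>
    unfolding \<Psi>_def using integral_norm_bound[of lborel "\<lambda>x. \<psi> x * plane_wave \<xi> x"] by (simp add: norm_mult)
  define a where "a n = inverse (real (Suc n))" for n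
  have a: "a n > 0" for n by (simp add: a_def)
  have a0: "a \<longlonglongrightarrow> 0" unfolding a_def by (rule LIMSEQ_inverse_real_of_nat)
  define L where "L n = (LINT x|lborel. g x * (LINT z|lborel. \<psi> (x + a n *\<^sub>R z) * ?G z))" for n
  define R where "R n = (LINT \<xi>|lborel. gh \<xi> * \<Psi> \<xi> * gauss (a n *\<^sub>R \<xi>))" for n
  have eq: "L n = R n" for n
  proof -
    have scaled: "integrable lborel (\<lambda>\<xi>::'a. gauss (a n *\<^sub>R \<xi>))"
    proof -
      have "integrable (density (distr lborel borel (\<lambda>x. 0 + a n *\<^sub>R x)) (\<lambda>_. \<bar>a n\<bar> ^ DIM('a))) (gauss :: 'a \<Rightarrow> complex)"
        using lborel_affine[of "a n" "0::'a"] a[of n] integrable_gauss[where 'a = 'a] by simp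
      then have "integrable lborel (\<lambda>\<xi>::'a. a n ^ DIM('a) *\<^sub>R gauss (a n *\<^sub>R \<xi>))"
        using a[of n] by (simp add: integrable_density integrable_distr_eq)
      then have "integrable lborel (\<lambda>\<xi>::'a. inverse (a n ^ DIM('a)) *\<^sub>R a n ^ DIM('a) *\<^sub>R gauss (a n *\<^sub>R \<xi>))"
        by (rule integrable_scaleR_right)
      then show ?thesis
        using a[of n] by simp
    qed
    have inner: "(LINT z|lborel. \<psi> (x + a n *\<^sub>R z) * ?G z)
        = (LINT \<xi>|lborel. gauss (a n *\<^sub>R \<xi>) * (LINT y|lborel. \<psi> y * plane_wave \<xi> (y - x)))" for x
    proof -
      have "(LINT \<xi>|lborel. gauss (a n *\<^sub>R \<xi>) * (LINT y|lborel. \<psi> y * plane_wave \<xi> (y - x)))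
          = (LINT y|lborel. \<psi> y * (LINT \<xi>|lborel. gauss (a n *\<^sub>R \<xi>) * plane_wave \<xi> (y - x)))"
        by (rule integral_swap_bounded_kernel[where C = 1]) (auto simp: scaled \<psi>)
      also have "\<dots> = (LINT y|lborel. \<psi> y * (?G ((y - x) /\<^sub>R a n) /\<^sub>R a n ^ DIM('a)))"
      proof -
        have "?G ((y - x) /\<^sub>R a n) = a n ^ DIM('a) *\<^sub>R (LINT \<xi>|lborel. gauss (a n *\<^sub>R \<xi>) * plane_wave \<xi> (y - x))" for y
          unfolding gauss_transform_def
          using a[of n] by (subst lborel_integral_affine[where c = "a n" and t = 0]) (auto simp: plane_wave_scaleR)
        then show ?thesis using a[of n] by simp
      qed
      also have "\<dots> = a n ^ DIM('a) *\<^sub>R (LINT z|lborel. \<psi> (x + a n *\<^sub>R z) * (?G z /\<^sub>R a n ^ DIM('a)))"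
        using a[of n] by (subst lborel_integral_affine[where c = "a n" and t = x]) auto
      also have "\<dots> = (LINT z|lborel. \<psi> (x + a n *\<^sub>R z) * ?G z)"
        using a[of n] by simp
      finally show ?thesis ..
    qed
    have "L n = (LINT x|lborel. g x * (LINT \<xi>|lborel. gauss (a n *\<^sub>R \<xi>) * (\<Psi> \<xi> * plane_wave (- \<xi>) x)))"
      unfolding L_def inner plane_wave_diff \<Psi>_def by (simp add: mult.assoc[symmetric])
    also have "\<dots> = (LINT \<xi>|lborel. gauss (a n *\<^sub>R \<xi>) * (LINT x|lborel. g x * (\<Psi> \<xi> * plane_wave (- \<xi>) x)))"
      using \<Psi>_bound
      by (intro integral_swap_bounded_kernel[where C = "LINT x|lborel. norm (\<psi> x)"]) (auto simp: scaled g norm_mult)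
    also have "\<dots> = R n"
      unfolding R_def gh_def by (simp add: mult_ac)
    finally show ?thesis .
  qed
  have "L \<longlonglongrightarrow> (LINT x|lborel. g x * \<psi> x)"
    unfolding L_def
  proof (rule integral_dominated_convergence)
    show "integrable lborel (\<lambda>x. norm (g x) * (C * (LINT z|lborel. norm (?G z))))"
      using g by auto
    show "AE x in lborel. (\<lambda>n. g x * (LINT z|lborel. \<psi> (x + a n *\<^sub>R z) * ?G z)) \<longlonglongrightarrow> g x * \<psi> x"
    proof (rule AE_I2)
      fix x
      have "(\<lambda>n. LINT z|lborel. \<psi> (x + a n *\<^sub>R z) * ?G z) \<longlonglongrightarrow> (LINT z|lborel. \<psi> x * ?G z)"
      proof (rule integral_dominated_convergence)
        show "integrable lborel (\<lambda>z. C * norm (?G z))" using G by auto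
        show "AE z in lborel. (\<lambda>n. \<psi> (x + a n *\<^sub>R z) * ?G z) \<longlonglongrightarrow> \<psi> x * ?G z"
        proof (intro AE_I2 tendsto_intros)
          fix z
          have "(\<lambda>n. x + a n *\<^sub>R z) \<longlonglongrightarrow> x + 0 *\<^sub>R z" by (intro tendsto_intros a0)
          then show "(\<lambda>n. \<psi> (x + a n *\<^sub>R z)) \<longlonglongrightarrow> \<psi> x"
            using cont by (auto intro!: isCont_tendsto_compose[of x \<psi>] simp: continuous_on_eq_continuous_at)
        qed
      qed (auto simp: norm_mult bound mult_right_mono)
      then show "(\<lambda>n. g x * (LINT z|lborel. \<psi> (x + a n *\<^sub>R z) * ?G z)) \<longlonglongrightarrow> g x * \<psi> x"
        using G by (intro tendsto_intros) simp
    qed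
    fix n
    show "AE x in lborel. norm (g x * (LINT z|lborel. \<psi> (x + a n *\<^sub>R z) * ?G z))
        \<le> norm (g x) * (C * (LINT z|lborel. norm (?G z)))"
    proof (rule AE_I2)
      fix x
      have "norm (LINT z|lborel. \<psi> (x + a n *\<^sub>R z) * ?G z) \<le> (LINT z|lborel. C * norm (?G z))"
        using G bound by (intro Bochner_Integration.integral_norm_bound_integral) (auto simp: norm_mult mult_right_mono abs_mult C
            intro!: Bochner_Integration.integrable_bound[of lborel "\<lambda>z. C * norm (?G z)" "\<lambda>z. \<psi> (x + a n *\<^sub>R z) * ?G z"])
      then show "norm (g x * (LINT z|lborel. \<psi> (x + a n *\<^sub>R z) * ?G z))
        \<le> norm (g x) * (C * (LINT z|lborel. norm (?G z)))"
        by (simp add: norm_mult mult_left_mono)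
    qed
  qed measurable
  moreover have "R \<longlonglongrightarrow> (LINT \<xi>|lborel. gh \<xi> * \<Psi> \<xi>)"
    unfolding R_def
  proof (rule integral_dominated_convergence)
    show "integrable lborel (\<lambda>\<xi>. norm (gh \<xi>) * (LINT x|lborel. norm (\<psi> x)))"
      using gh by auto
    show "AE \<xi> in lborel. (\<lambda>n. gh \<xi> * \<Psi> \<xi> * gauss (a n *\<^sub>R \<xi>)) \<longlonglongrightarrow> gh \<xi> * \<Psi> \<xi>"
    proof (rule AE_I2)
      fix \<xi>
      have "(\<lambda>n. gh \<xi> * \<Psi> \<xi> * gauss (a n *\<^sub>R \<xi>)) \<longlonglongrightarrow> gh \<xi> * \<Psi> \<xi> * of_real (exp (- (norm (0 *\<^sub>R \<xi>))\<^sup>2 / 2))"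
        unfolding gauss_def by (intro tendsto_intros a0) simp
      then show "(\<lambda>n. gh \<xi> * \<Psi> \<xi> * gauss (a n *\<^sub>R \<xi>)) \<longlonglongrightarrow> gh \<xi> * \<Psi> \<xi>" by simp
    qed
    fix n
    show "AE \<xi> in lborel. norm (gh \<xi> * \<Psi> \<xi> * gauss (a n *\<^sub>R \<xi>)) \<le> norm (gh \<xi>) * (LINT x|lborel. norm (\<psi> x))"
    proof (rule AE_I2)
      fix \<xi>
      have "norm (gh \<xi> * \<Psi> \<xi> * gauss (a n *\<^sub>R \<xi>)) \<le> norm (gh \<xi>) * (LINT x|lborel. norm (\<psi> x)) * 1"
        unfolding norm_mult by (intro mult_mono \<Psi>_bound norm_gauss_le_1) auto
      then show "norm (gh \<xi> * \<Psi> \<xi> * gauss (a n *\<^sub>R \<xi>)) \<le> norm (gh \<xi>) * (LINT x|lborel. norm (\<psi> x))" by simp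
    qed
  qed measurable
  ultimately show ?thesis
    unfolding eq[abs_def] \<Psi>_def by (blast intro: LIMSEQ_unique)
qed

section \<open>Test functions and integration by parts\<close>

text \<open>
  Integration by parts without boundary terms. Translation invariance of Lebesgue measure moves a
  difference quotient from \<open>\<psi>\<close> to the plane wave, and the step size then tends to 0.
\<close>

lemma integral_directional_derivative_plane_wave:
  fixes \<psi> :: "'a::euclidean_space \<Rightarrow> real"
  assumes diff: "\<And>x. \<psi> differentiable at x"
    and K: "compact K" "\<And>x. x \<notin> K \<Longrightarrow> \<psi> x = 0"
    and cont: "continuous_on UNIV (\<lambda>x. frechet_derivative \<psi> (at x) e)"
    and K': "\<And>x. x \<notin> K \<Longrightarrow> frechet_derivative \<psi> (at x) e = 0"
  shows "(LINT x|lborel. of_real (frechet_derivative \<psi> (at x) e) * plane_wave \<xi> x)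
    = - (2 * of_real pi * \<i> * of_real (\<xi> \<bullet> e)) * (LINT x|lborel. of_real (\<psi> x) * plane_wave \<xi> x)"
proof -
  define d where "d x = frechet_derivative \<psi> (at x) e" for x
  have \<psi>_cont: "continuous_on UNIV \<psi>"
    using diff by (simp add: continuous_on_eq_continuous_at differentiable_imp_continuous_within)
  have [measurable]: "\<psi> \<in> borel_measurable borel" "d \<in> borel_measurable borel"
    using \<psi>_cont cont unfolding d_def by (auto intro: borel_measurable_continuous_onI)
  have "bounded (d ` K)"
    using compact_imp_bounded[OF compact_continuous_image[OF continuous_on_subset[OF cont] K(1)]] by (simp add: d_def[abs_def])
  then obtain B where "\<And>x. x \<in> K \<Longrightarrow> norm (d x) \<le> B" by (auto simp: bounded_iff)
  then have B: "norm (d x) \<le> \<bar>B\<bar>" for x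
    by (cases "x \<in> K") (force simp: d_def K')+
  obtain R where R: "\<And>x. x \<in> K \<Longrightarrow> norm x \<le> R"
    using compact_imp_bounded[OF K(1)] by (auto simp: bounded_iff)
  have line: "((\<lambda>t. \<psi> (x + t *\<^sub>R e)) has_real_derivative d (x + t *\<^sub>R e)) (at t)" for x t
  proof -
    have "((\<lambda>t. \<psi> (x + t *\<^sub>R e)) has_derivative (\<lambda>s. frechet_derivative \<psi> (at (x + t *\<^sub>R e)) (s *\<^sub>R e))) (at t)"
      by (rule has_derivative_compose[of "\<lambda>t. x + t *\<^sub>R e" "\<lambda>s. s *\<^sub>R e" _ _ \<psi>])
         (auto intro!: derivative_eq_intros simp: frechet_derivative_works[symmetric] diff)
    moreover have "frechet_derivative \<psi> (at y) (s *\<^sub>R e) = d y * s" for y s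
      using linear_frechet_derivative[OF diff[of y]] by (simp add: linear_cmul d_def)
    ultimately show ?thesis by (simp add: has_field_derivative_def)
  qed
  define h where "h n = inverse (real (Suc n))" for n
  have h: "0 < h n" "h n \<le> 1" for n by (auto simp: h_def field_simps)
  have h0: "h \<longlonglongrightarrow> 0" unfolding h_def by (rule LIMSEQ_inverse_real_of_nat)
  then have h_at: "filterlim h (at 0) sequentially"
    using h by (auto simp: filterlim_at intro!: always_eventually) (metis less_irrefl)
  define q where "q n x = (\<psi> (x + h n *\<^sub>R e) - \<psi> x) / h n" for n x
  have [measurable]: "q n \<in> borel_measurable borel" for n unfolding q_def by measurable
  have \<psi>_int: "integrable lborel \<psi>"
  proof -
    have "integrable lborel (\<lambda>x. indicator K x *\<^sub>R \<psi> x)"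
      by (rule borel_integrable_compact[OF K(1) continuous_on_subset[OF \<psi>_cont]]) simp
    moreover have "indicator K x *\<^sub>R \<psi> x = \<psi> x" for x using K(2) by (cases "x \<in> K") simp_all
    ultimately show ?thesis by (simp only:)
  qed
  have lim1: "(\<lambda>n. LINT x|lborel. of_real (q n x) * plane_wave \<xi> x) \<longlonglongrightarrow> (LINT x|lborel. of_real (d x) * plane_wave \<xi> x)"
  proof (rule integral_dominated_convergence)
    let ?C = "cball 0 (R + norm e) :: 'a set"
    show "integrable lborel (\<lambda>x. \<bar>B\<bar> * indicator ?C x)"
      by (intro integrable_mult_right integrable_real_indicator) (use emeasure_bounded_finite[of ?C] in auto)
    show "AE x in lborel. (\<lambda>n. of_real (q n x) * plane_wave \<xi> x) \<longlonglongrightarrow> of_real (d x) * plane_wave \<xi> x"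
    proof (intro AE_I2 tendsto_intros)
      fix x
      have "((\<lambda>t. (\<psi> (x + t *\<^sub>R e) - \<psi> x) / t) \<longlongrightarrow> d x) (at 0)"
        using line[of x 0] by (simp add: has_field_derivative_iff)
      from filterlim_compose[OF this h_at] show "(\<lambda>n. q n x) \<longlonglongrightarrow> d x"
        by (simp add: q_def)
    qed
    fix n
    show "AE x in lborel. norm (of_real (q n x) * plane_wave \<xi> x) \<le> \<bar>B\<bar> * indicator ?C x"
    proof (rule AE_I2)
      fix x
      show "norm (of_real (q n x) * plane_wave \<xi> x) \<le> \<bar>B\<bar> * indicator ?C x"
      proof (cases "x \<in> ?C")
        case True
        have "norm (\<psi> (x + h n *\<^sub>R e) - \<psi> (x + 0 *\<^sub>R e)) \<le> \<bar>B\<bar> * norm (h n - 0)"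
          by (rule field_differentiable_bound[of UNIV "\<lambda>t. \<psi> (x + t *\<^sub>R e)" "\<lambda>t. d (x + t *\<^sub>R e)"])
             (use line B in auto)
        then have "\<bar>q n x\<bar> \<le> \<bar>B\<bar>" using h[of n] by (simp add: q_def abs_divide field_simps)
        then show ?thesis using True by (simp add: norm_mult)
      next
        case False
        have "norm (x + h n *\<^sub>R e) \<ge> norm x - h n * norm e"
          using norm_diff_ineq[of x "h n *\<^sub>R e"] h[of n] by simp
        moreover have "h n * norm e \<le> norm e" using h[of n] by (simp add: mult_left_le_one_le)
        ultimately have "norm (x + h n *\<^sub>R e) > R" "norm x > R" using False by auto (smt (verit) norm_ge_zero)
        then have "x \<notin> K" "x + h n *\<^sub>R e \<notin> K" using R by force+
        then show ?thesis using K(2) by (simp add: q_def)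
      qed
    qed
  qed measurable
  have q_eq: "(LINT x|lborel. of_real (q n x) * plane_wave \<xi> x)
      = ((plane_wave (- \<xi>) (h n *\<^sub>R e) - 1) / of_real (h n)) * (LINT x|lborel. of_real (\<psi> x) * plane_wave \<xi> x)" for n
  proof -
    have i1: "integrable lborel (\<lambda>x. of_real (\<psi> x) * plane_wave \<xi> x)"
      using \<psi>_int by (rule Bochner_Integration.integrable_bound) (auto simp: norm_mult)
    have s: "(LINT x|lborel. of_real (\<psi> (x + h n *\<^sub>R e)) * plane_wave \<xi> x)
        = plane_wave (- \<xi>) (h n *\<^sub>R e) * (LINT x|lborel. of_real (\<psi> x) * plane_wave \<xi> x)"
    proof -
      have "(LINT x|lborel. of_real (\<psi> x) * plane_wave \<xi> (x - h n *\<^sub>R e))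
          = \<bar>1\<bar> ^ DIM('a) *\<^sub>R (LINT x|lborel. of_real (\<psi> (h n *\<^sub>R e + 1 *\<^sub>R x)) * plane_wave \<xi> (h n *\<^sub>R e + 1 *\<^sub>R x - h n *\<^sub>R e))"
        by (rule lborel_integral_affine) auto
      then have "(LINT x|lborel. of_real (\<psi> x) * plane_wave \<xi> x) * plane_wave (- \<xi>) (h n *\<^sub>R e)
          = (LINT x|lborel. of_real (\<psi> (x + h n *\<^sub>R e)) * plane_wave \<xi> x)"
        by (simp add: add.commute plane_wave_diff flip: mult.assoc)
      then show ?thesis by (simp add: mult.commute)
    qed
    have i2: "integrable lborel (\<lambda>x. of_real (\<psi> (x + h n *\<^sub>R e)) * plane_wave \<xi> x)"
    proof -
      have "integrable (distr lborel borel ((+) (h n *\<^sub>R e))) \<psi>"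
        using \<psi>_int by (simp add: lborel_distr_plus)
      then have "integrable lborel (\<lambda>x. \<psi> (x + h n *\<^sub>R e))"
        by (simp add: integrable_distr_eq add.commute)
      then show ?thesis by (rule Bochner_Integration.integrable_bound) (auto simp: norm_mult)
    qed
    have "(LINT x|lborel. of_real (q n x) * plane_wave \<xi> x)
        = (LINT x|lborel. (of_real (\<psi> (x + h n *\<^sub>R e)) * plane_wave \<xi> x - of_real (\<psi> x) * plane_wave \<xi> x) / of_real (h n))"
      by (simp add: q_def algebra_simps diff_divide_distrib)
    also have "\<dots> = ((LINT x|lborel. of_real (\<psi> (x + h n *\<^sub>R e)) * plane_wave \<xi> x)
        - (LINT x|lborel. of_real (\<psi> x) * plane_wave \<xi> x)) / of_real (h n)"
      using i1 i2 by simp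
    finally show ?thesis unfolding s by (simp add: field_simps)
  qed
  have "(\<lambda>n. ((plane_wave (- \<xi>) (h n *\<^sub>R e) - 1) / of_real (h n)) * (LINT x|lborel. of_real (\<psi> x) * plane_wave \<xi> x))
      \<longlonglongrightarrow> (- (2 * of_real pi * \<i> * of_real (\<xi> \<bullet> e))) * (LINT x|lborel. of_real (\<psi> x) * plane_wave \<xi> x)"
  proof (intro tendsto_mult tendsto_const)
    let ?c = "- (2 * of_real pi * \<i> * of_real (\<xi> \<bullet> e)) :: complex"
    have "((\<lambda>z. exp (?c * z)) has_field_derivative ?c) (at 0)"
      by (auto intro!: derivative_eq_intros)
    then have *: "((\<lambda>z. (exp (?c * z) - 1) / z) \<longlongrightarrow> ?c) (at 0)"
      by (simp add: has_field_derivative_iff)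
    have "filterlim (\<lambda>n. of_real (h n) :: complex) (at 0) sequentially"
      using tendsto_of_real[OF h0, where 'a = complex] h
      by (auto simp: filterlim_at intro!: always_eventually) (metis less_irrefl)
    from filterlim_compose[OF * this]
    show "(\<lambda>n. (plane_wave (- \<xi>) (h n *\<^sub>R e) - 1) / of_real (h n)) \<longlonglongrightarrow> ?c"
      by (simp add: plane_wave_def mult_ac)
  qed
  with lim1 show ?thesis
    unfolding q_eq d_def by (blast intro: LIMSEQ_unique)
qed

lemma iter_partial_eq_0_outside_support:
  assumes "x \<notin> closure {x. \<phi> x \<noteq> 0}"
  shows "iter_partial is \<phi> x = 0"
  using assms
proof (induction "is" arbitrary: x)
  case Nil
  then show ?case using closure_subset[of "{x. \<phi> x \<noteq> 0}"] by auto
next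
  case (Cons i "is")
  let ?S = "- closure {x. \<phi> x \<noteq> 0}"
  have "(iter_partial is \<phi> has_derivative (\<lambda>_. 0)) (at x)"
  proof (rule has_derivative_transform_within_open)
    show "((\<lambda>_. 0) has_derivative (\<lambda>_. 0)) (at x)" by simp
    show "open ?S" by (rule open_Compl) simp
  qed (use Cons in auto)
  then show ?case by (simp add: frechet_derivative_at[symmetric])
qed

lemma test_function_iter_partial:
  fixes \<phi> :: "real ^ 'n \<Rightarrow> real"
  assumes \<phi>: "\<phi> \<in> test_functions U"
  shows "continuous_on UNIV (iter_partial is \<phi>)" and "integrable lborel (iter_partial is \<phi>)"
    and "\<exists>C. \<forall>x. \<bar>iter_partial is \<phi> x\<bar> \<le> C"
proof -
  let ?K = "closure {x. \<phi> x \<noteq> 0}" and ?\<psi> = "iter_partial is \<phi>"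
  have K: "compact ?K" using \<phi> by (simp add: test_functions_def)
  show cont: "continuous_on UNIV ?\<psi>"
    using \<phi> by (auto simp: test_functions_def intro: differentiable_imp_continuous_on)
  have zero: "?\<psi> x = 0" if "x \<notin> ?K" for x using iter_partial_eq_0_outside_support[OF that] .
  have "integrable lborel (\<lambda>x. indicator ?K x *\<^sub>R ?\<psi> x)"
    by (rule borel_integrable_compact[OF K continuous_on_subset[OF cont]]) simp
  moreover have "indicator ?K x *\<^sub>R ?\<psi> x = ?\<psi> x" for x
    using zero[of x] by (cases "x \<in> ?K") simp_all
  ultimately show "integrable lborel ?\<psi>" by (simp only:)
  have "bounded (?\<psi> ` ?K)"
    using K compact_continuous_image continuous_on_subset[OF cont] by (blast intro: compact_imp_bounded)
  then obtain B where B: "\<And>x. x \<in> ?K \<Longrightarrow> norm (?\<psi> x) \<le> B" by (auto simp: bounded_iff)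
  have "\<bar>?\<psi> x\<bar> \<le> \<bar>B\<bar>" for x
    using B[of x] zero[of x] by (cases "x \<in> ?K") auto
  then show "\<exists>C. \<forall>x. \<bar>?\<psi> x\<bar> \<le> C" by blast
qed

text \<open>
  The factor by which a derivative of order \<open>\<alpha>\<close> multiplies the plane wave of frequency \<open>\<xi>\<close>.
\<close>

definition freq_monomial :: "('n \<Rightarrow> nat) \<Rightarrow> real ^ 'n \<Rightarrow> complex" where
  "freq_monomial \<alpha> \<xi> = (\<Prod>i\<in>UNIV. (2 * of_real pi * \<i> * of_real (\<xi> $ i)) ^ \<alpha> i)"

lemma borel_measurable_freq_monomial [measurable]: "freq_monomial \<alpha> \<in> borel_measurable borel"
proof -
  have "continuous_on UNIV (freq_monomial \<alpha>)"
    unfolding freq_monomial_def by (intro continuous_intros)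
  then show ?thesis by (rule borel_measurable_continuous_onI)
qed

lemma prod_list_map_eq_prod_count_list:
  fixes g :: "'a::finite \<Rightarrow> 'b::comm_monoid_mult"
  shows "prod_list (map g xs) = (\<Prod>i\<in>UNIV. g i ^ count_list xs i)"
proof (induction xs)
  case (Cons a xs)
  have "(\<Prod>i\<in>UNIV. g i ^ count_list (a # xs) i) = (\<Prod>i\<in>UNIV. (if i = a then g i else 1) * g i ^ count_list xs i)"
    by (intro prod.cong) auto
  also have "\<dots> = g a * (\<Prod>i\<in>UNIV. g i ^ count_list xs i)"
    by (simp add: prod.distrib)
  finally show ?case using Cons by simp
qed simp

lemma integral_iter_partial_plane_wave:
  fixes \<phi> :: "real ^ 'n \<Rightarrow> real"
  assumes \<phi>: "\<phi> \<in> test_functions U" and \<alpha>: "\<And>i. count_list is i = \<alpha> i"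
  shows "(LINT x|lborel. of_real (iter_partial is \<phi> x) * plane_wave \<xi> x)
    = (- 1) ^ sum \<alpha> UNIV * (freq_monomial \<alpha> \<xi> * (LINT x|lborel. of_real (\<phi> x) * plane_wave \<xi> x))"
proof -
  have "(LINT x|lborel. of_real (iter_partial is \<phi> x) * plane_wave \<xi> x)
    = prod_list (map (\<lambda>i. - (2 * of_real pi * \<i> * of_real (\<xi> $ i))) is) * (LINT x|lborel. of_real (\<phi> x) * plane_wave \<xi> x)"
  proof (induction "is")
    case (Cons i "is")
    have "(LINT x|lborel. of_real (frechet_derivative (iter_partial is \<phi>) (at x) (axis i 1)) * plane_wave \<xi> x)
      = - (2 * of_real pi * \<i> * of_real (\<xi> \<bullet> axis i 1)) * (LINT x|lborel. of_real (iter_partial is \<phi> x) * plane_wave \<xi> x)"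
    proof (rule integral_directional_derivative_plane_wave)
      show "iter_partial is \<phi> differentiable at x" for x
        using \<phi> by (auto simp: test_functions_def differentiable_on_def)
      show "compact (closure {x. \<phi> x \<noteq> 0})" using \<phi> by (simp add: test_functions_def)
      show "iter_partial is \<phi> x = 0" if "x \<notin> closure {x. \<phi> x \<noteq> 0}" for x
        using iter_partial_eq_0_outside_support[OF that] .
      show "continuous_on UNIV (\<lambda>x. frechet_derivative (iter_partial is \<phi>) (at x) (axis i 1))"
        using test_function_iter_partial(1)[OF \<phi>, of "i # is"] by simp
      show "frechet_derivative (iter_partial is \<phi>) (at x) (axis i 1) = 0" if "x \<notin> closure {x. \<phi> x \<noteq> 0}" for x
        using iter_partial_eq_0_outside_support[OF that, of "i # is"] by simp
    qed
    then show ?case using Cons by (simp add: inner_axis)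
  qed simp
  also have "prod_list (map (\<lambda>i. - (2 * of_real pi * \<i> * of_real (\<xi> $ i))) is) = (- 1) ^ sum \<alpha> UNIV * freq_monomial \<alpha> \<xi>"
    unfolding prod_list_map_eq_prod_count_list freq_monomial_def power_sum \<alpha> prod.distrib[symmetric]
    by (simp flip: power_mult_distrib)
  finally show ?thesis by (simp add: mult.assoc)
qed

section \<open>Weak derivatives of spectral representations\<close>

text \<open>
  Passing to a Borel function makes product measurability, and with it Fubini's theorem,
  available.
\<close>

lemma lebesgue_integrable_borel_version:
  fixes f :: "real ^ 'n \<Rightarrow> complex"
  assumes f: "integrable lebesgue f"
  obtains g where "integrable lborel g" "AE x in lebesgue. f x = g x"
    "\<And>\<xi>. fourier f \<xi> = (LINT x|lborel. g x * plane_wave (- \<xi>) x)"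
proof -
  have m: "f \<in> borel_measurable lebesgue" using f by (rule borel_measurable_integrable)
  have "(\<lambda>x. Re (f x)) \<in> borel_measurable lebesgue" "(\<lambda>x. Im (f x)) \<in> borel_measurable lebesgue"
    using m by measurable
  from this[THEN completion_ex_borel_measurable_real] obtain r s where
    rs [measurable]: "r \<in> borel_measurable lborel" "s \<in> borel_measurable lborel"
    and ae: "AE x in lborel. Re (f x) = r x" "AE x in lborel. Im (f x) = s x"
    by auto
  define g where "g x = Complex (r x) (s x)" for x
  have g_eq: "g = (\<lambda>x. of_real (r x) + \<i> * of_real (s x))" by (auto simp: g_def complex_eq_iff)
  have [measurable]: "g \<in> borel_measurable lborel" unfolding g_eq by measurable
  have "AE x in lborel. f x = g x"
    using ae by eventually_elim (simp add: g_def complex_eq_iff)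
  then have ae': "AE x in lebesgue. f x = g x" by (rule AE_completion)
  have g_leb: "g \<in> borel_measurable lebesgue" by (intro measurable_completion) simp
  have "integrable lebesgue g"
    using integrable_cong_AE[OF m g_leb ae'] f by simp
  then have g_int: "integrable lborel g" by (simp add: integrable_completion)
  have "fourier f \<xi> = (LINT x|lborel. g x * plane_wave (- \<xi>) x)" for \<xi>
  proof -
    have pw: "plane_wave (- \<xi>) \<in> borel_measurable lebesgue"
      by (intro measurable_completion) (simp add: plane_wave_def[abs_def])
    have "fourier f \<xi> = (LINT x|lebesgue. g x * plane_wave (- \<xi>) x)"
      unfolding fourier_eq_plane_wave using ae' m g_leb pw by (intro integral_cong_AE) auto
    also have "\<dots> = (LINT x|lborel. g x * plane_wave (- \<xi>) x)"
      by (rule integral_completion) measurable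
    finally show ?thesis .
  qed
  with g_int ae' show ?thesis by (rule that)
qed

text \<open>
  The derivative of order \<open>\<alpha>\<close>, computed under the integral, of the difference between the
  superposition of plane waves with density \<open>h\<close> and a finite exponential sum.
\<close>

definition spectral_deriv ::
    "(real ^ 'n \<Rightarrow> complex) \<Rightarrow> 'k set \<Rightarrow> ('k \<Rightarrow> complex) \<Rightarrow> ('k \<Rightarrow> real ^ 'n) \<Rightarrow> ('n \<Rightarrow> nat) \<Rightarrow> real ^ 'n \<Rightarrow> complex" where
  "spectral_deriv h A a \<theta> \<alpha> x =
     (LINT \<xi>|lborel. h \<xi> * freq_monomial \<alpha> \<xi> * plane_wave \<xi> x) -
     (\<Sum>k\<in>A. a k * freq_monomial \<alpha> (\<theta> k) * plane_wave (\<theta> k) x)"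

lemma continuous_spectral_deriv:
  assumes "integrable lborel (\<lambda>\<xi>. h \<xi> * freq_monomial \<alpha> \<xi>)"
  shows "continuous_on UNIV (spectral_deriv h A a \<theta> \<alpha>)"
proof -
  have "isCont (\<lambda>x. LINT \<xi>|lborel. h \<xi> * freq_monomial \<alpha> \<xi> * plane_wave \<xi> x) x" for x
  proof (rule continuous_at_sequentiallyI)
    fix u assume u: "u \<longlonglongrightarrow> x"
    show "(\<lambda>n. LINT \<xi>|lborel. h \<xi> * freq_monomial \<alpha> \<xi> * plane_wave \<xi> (u n))
        \<longlonglongrightarrow> (LINT \<xi>|lborel. h \<xi> * freq_monomial \<alpha> \<xi> * plane_wave \<xi> x)"
    proof (rule integral_dominated_convergence)
      show "integrable lborel (\<lambda>\<xi>. norm (h \<xi> * freq_monomial \<alpha> \<xi>))"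
        using assms by (rule integrable_norm)
      have [measurable]: "(\<lambda>\<xi>. h \<xi> * freq_monomial \<alpha> \<xi>) \<in> borel_measurable borel"
        using assms by (auto dest: borel_measurable_integrable)
      show "(\<lambda>\<xi>. h \<xi> * freq_monomial \<alpha> \<xi> * plane_wave \<xi> (u n)) \<in> borel_measurable lborel"
        "(\<lambda>\<xi>. h \<xi> * freq_monomial \<alpha> \<xi> * plane_wave \<xi> x) \<in> borel_measurable lborel" for n by measurable
      show "AE \<xi> in lborel. (\<lambda>n. h \<xi> * freq_monomial \<alpha> \<xi> * plane_wave \<xi> (u n)) \<longlonglongrightarrow> h \<xi> * freq_monomial \<alpha> \<xi> * plane_wave \<xi> x"
        unfolding plane_wave_def by (intro AE_I2 tendsto_intros u)
    qed (auto simp: norm_mult)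
  qed
  then have "continuous_on UNIV (\<lambda>x. LINT \<xi>|lborel. h \<xi> * freq_monomial \<alpha> \<xi> * plane_wave \<xi> x)"
    by (simp add: continuous_on_eq_continuous_at)
  then show ?thesis
    unfolding spectral_deriv_def[abs_def] by (intro continuous_intros)
qed

text \<open>
  With \<open>\<Psi>\<close> and \<open>\<Phi>\<close> the integrals of \<open>\<psi> = \<partial>\<^sup>\<alpha> \<phi>\<close> and of \<open>\<phi>\<close> against a plane wave, tested
  inversion turns the left-hand side of the weak derivative identity into an integral of
  \<open>fourier fe\<close> against \<open>\<Psi>\<close>. Integration by parts expresses \<open>\<Psi>\<close> through \<open>\<Phi>\<close>, and Fubini leads back
  to an integral over \<open>x\<close>. In this way \<open>f\<close> and its spectral representation are identified in the
  weak sense on \<open>U\<close>.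
\<close>

lemma has_weak_deriv_spectral_deriv:
  fixes f :: "real ^ 'n \<Rightarrow> real"
  assumes fe: "fe \<in> L1_extensions \<Omega> f" and U: "open U" "U \<subseteq> \<Omega>"
    and int: "integrable lborel (fourier fe)"
    and int\<alpha>: "integrable lborel (\<lambda>\<xi>. fourier fe \<xi> * freq_monomial \<alpha> \<xi>)"
    and A: "finite A"
  shows "has_weak_deriv U \<alpha> (\<lambda>x. of_real (f x) - (\<Sum>k\<in>A. a k * plane_wave (\<theta> k) x))
    (spectral_deriv (fourier fe) A a \<theta> \<alpha>)"
proof -
  let ?u = "\<lambda>x. of_real (f x) - (\<Sum>k\<in>A. a k * plane_wave (\<theta> k) x)"
  let ?D = "spectral_deriv (fourier fe) A a \<theta> \<alpha>"
  from fe have fe_int: "integrable lebesgue fe" and ae: "AE x in lebesgue. x \<in> \<Omega> \<longrightarrow> fe x = of_real (f x)"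
    by (auto simp: L1_extensions_def)
  obtain g where g: "integrable lborel g" "AE x in lebesgue. fe x = g x"
    "\<And>\<xi>. fourier fe \<xi> = (LINT x|lborel. g x * plane_wave (- \<xi>) x)"
    by (rule lebesgue_integrable_borel_version[OF fe_int]) blast
  have [measurable]: "g \<in> borel_measurable borel" using g(1) by (auto dest: borel_measurable_integrable)
  have g_leb: "integrable lebesgue g" using g(1) by (simp add: integrable_completion)
  have "AE x in lebesgue. x \<in> U \<longrightarrow> of_real (f x) = g x"
    using ae g(2) by eventually_elim (use U in auto)
  then obtain N where N: "N \<in> null_sets lebesgue" "\<And>x. x \<in> U \<Longrightarrow> x \<notin> N \<Longrightarrow> of_real (f x) = g x"
    by (auto simp: eventually_ae_filter)
  have negN: "negligible N" using N(1) by (simp add: negligible_iff_null_sets)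
  define S where "S x = (\<Sum>k\<in>A. a k * plane_wave (\<theta> k) x)" for x
  have S_cont: "continuous_on B S" for B unfolding S_def by (intro continuous_intros)
  have [measurable]: "S \<in> borel_measurable borel"
    by (rule borel_measurable_continuous_onI[OF S_cont])
  have cont_abs: "h absolutely_integrable_on K" if "compact K" "continuous_on UNIV h" for K and h :: "real ^ 'n \<Rightarrow> complex"
  proof -
    have "integrable lborel (\<lambda>x. indicator K x *\<^sub>R h x)"
      by (rule borel_integrable_compact[OF that(1) continuous_on_subset[OF that(2)]]) simp
    then show ?thesis
      unfolding set_integrable_def by (simp add: integrable_completion borel_measurable_integrable)
  qed
  have u_abs: "?u absolutely_integrable_on K" if K: "compact K" "K \<subseteq> U" for K
  proof -
    have "g absolutely_integrable_on K"
      unfolding set_integrable_def using K(1) g_leb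
      by (intro integrable_mult_indicator) (auto intro!: lmeasurable_compact simp: compact_imp_closed)
    then have "(\<lambda>x. g x - S x) absolutely_integrable_on K"
      by (rule set_integral_diff(1)) (intro cont_abs S_cont K)
    then show ?thesis
      by (rule absolutely_integrable_spike[OF _ negN]) (use N(2) K in \<open>auto simp: S_def\<close>)
  qed
  have D_cont: "continuous_on UNIV ?D" by (rule continuous_spectral_deriv[OF int\<alpha>])
  have [measurable]: "?D \<in> borel_measurable borel" by (rule borel_measurable_continuous_onI[OF D_cont])
  show ?thesis
    unfolding has_weak_deriv_def locally_integrable_on_def
  proof (intro conjI allI impI ballI)
    fix \<phi> "is"
    assume \<phi>: "\<phi> \<in> test_functions U" and count: "\<forall>i. count_list is i = \<alpha> i"
    let ?K = "closure {x. \<phi> x \<noteq> 0}"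
    have K: "compact ?K" "?K \<subseteq> U" using \<phi> by (auto simp: test_functions_def)
    define \<psi> where "\<psi> = iter_partial is \<phi>"
    note \<psi> = test_function_iter_partial[OF \<phi>, of "is", folded \<psi>_def]
    note \<phi>' = test_function_iter_partial[OF \<phi>, of "[]", simplified]
    have \<psi>0: "\<psi> x = 0" and \<phi>0: "\<phi> x = 0" if "x \<notin> ?K" for x
      using iter_partial_eq_0_outside_support[OF that, of "is"] iter_partial_eq_0_outside_support[OF that, of "[]"]
      by (auto simp: \<psi>_def)
    have [measurable]: "\<psi> \<in> borel_measurable borel" "\<phi> \<in> borel_measurable borel"
      using \<psi> \<phi>' by (auto intro: borel_measurable_continuous_onI)
    obtain C where C: "\<And>x. \<bar>\<psi> x\<bar> \<le> C" using \<psi>(3) by auto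
    obtain C' where C': "\<And>x. \<bar>\<phi> x\<bar> \<le> C'" using \<phi>'(3) by auto
    define \<Psi> where "\<Psi> \<xi> = (LINT x|lborel. of_real (\<psi> x) * plane_wave \<xi> x)" for \<xi>
    define \<Phi> where "\<Phi> \<xi> = (LINT x|lborel. of_real (\<phi> x) * plane_wave \<xi> x)" for \<xi>
    have \<Psi>\<Phi>: "\<Psi> \<xi> = (- 1) ^ sum \<alpha> UNIV * (freq_monomial \<alpha> \<xi> * \<Phi> \<xi>)" for \<xi>
      unfolding \<Psi>_def \<Phi>_def \<psi>_def by (rule integral_iter_partial_plane_wave[OF \<phi>]) (use count in auto)
    have pw_int: "integrable lborel (\<lambda>x. of_real (\<psi> x) * plane_wave \<xi> x)"
      "integrable lborel (\<lambda>x. of_real (\<phi> x) * plane_wave \<xi> x)" for \<xi>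
      using \<psi>(2) \<phi>'(2) by (auto intro: Bochner_Integration.integrable_bound simp: norm_mult)
    have "(LINT x:U|lebesgue. \<psi> x *\<^sub>R ?u x) = (LINT x|lebesgue. of_real (\<psi> x) * (g x - S x))"
      unfolding set_lebesgue_integral_def
    proof (rule integral_cong_AE)
      have "(\<lambda>x. \<psi> x *\<^sub>R (indicator ?K x *\<^sub>R ?u x)) \<in> borel_measurable lebesgue"
      proof (rule borel_measurable_scaleR)
        show "\<psi> \<in> borel_measurable lebesgue" by (intro measurable_completion) simp
        show "(\<lambda>x. indicator ?K x *\<^sub>R ?u x) \<in> borel_measurable lebesgue"
          using u_abs[OF K] by (simp only: set_integrable_def borel_measurable_integrable)
      qed
      moreover have "\<psi> x *\<^sub>R (indicator ?K x *\<^sub>R ?u x) = indicator U x *\<^sub>R \<psi> x *\<^sub>R ?u x" for x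
      proof (cases "x \<in> ?K")
        case True
        moreover from this have "x \<in> U" using K(2) by blast
        ultimately show ?thesis by (simp only: indicator_simps scaleR_one)
      next
        case False
        then show ?thesis using \<psi>0 by simp
      qed
      ultimately show "(\<lambda>x. indicator U x *\<^sub>R \<psi> x *\<^sub>R ?u x) \<in> borel_measurable lebesgue"
        by (simp only:)
      show "(\<lambda>x. of_real (\<psi> x) * (g x - S x)) \<in> borel_measurable lebesgue"
        by (intro measurable_completion) simp
      show "AE x in lebesgue. indicator U x *\<^sub>R \<psi> x *\<^sub>R ?u x = of_real (\<psi> x) * (g x - S x)"
      proof (rule AE_I'[OF N(1)], rule subsetI)
        fix x assume x: "x \<in> {x \<in> space lebesgue. indicator U x *\<^sub>R \<psi> x *\<^sub>R ?u x \<noteq> of_real (\<psi> x) * (g x - S x)}"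
        show "x \<in> N"
        proof (rule ccontr)
          assume "x \<notin> N"
          then have "indicator U x *\<^sub>R \<psi> x *\<^sub>R ?u x = of_real (\<psi> x) * (g x - S x)"
            using N(2)[of x] \<psi>0[of x] K(2) by (cases "x \<in> U") (auto simp: S_def scaleR_conv_of_real)
          with x show False by blast
        qed
      qed
    qed
    also have "\<dots> = (LINT x|lborel. of_real (\<psi> x) * (g x - S x))"
      by (rule integral_completion) measurable
    also have "\<dots> = (LINT x|lborel. g x * of_real (\<psi> x)) - (LINT x|lborel. (\<Sum>k\<in>A. a k * (of_real (\<psi> x) * plane_wave (\<theta> k) x)))"
    proof -
      have "integrable lborel (\<lambda>x. g x * of_real (\<psi> x))"
      proof (rule Bochner_Integration.integrable_bound)
        show "integrable lborel (\<lambda>x. C * norm (g x))" using g(1) by auto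
        show "AE x in lborel. norm (g x * of_real (\<psi> x)) \<le> norm (C * norm (g x))"
        proof (rule AE_I2)
          fix x
          have "norm (g x * of_real (\<psi> x)) \<le> norm (g x) * \<bar>C\<bar>"
            using C[of x] by (auto simp: norm_mult intro!: mult_left_mono)
          then show "norm (g x * of_real (\<psi> x)) \<le> norm (C * norm (g x))" by (simp add: abs_mult mult_ac)
        qed
      qed measurable
      moreover have "integrable lborel (\<lambda>x. \<Sum>k\<in>A. a k * (of_real (\<psi> x) * plane_wave (\<theta> k) x))"
        by (intro Bochner_Integration.integrable_sum integrable_mult_right pw_int)
      ultimately show ?thesis
        by (subst Bochner_Integration.integral_diff[symmetric]) (auto simp: S_def algebra_simps sum_distrib_left)
    qed
    also have "\<dots> = (LINT \<xi>|lborel. fourier fe \<xi> * \<Psi> \<xi>) - (\<Sum>k\<in>A. a k * \<Psi> (\<theta> k))"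
    proof -
      have "(LINT x|lborel. g x * of_real (\<psi> x)) = (LINT \<xi>|lborel. fourier fe \<xi> * \<Psi> \<xi>)"
        unfolding \<Psi>_def g(3)
      proof (rule fourier_inversion_tested)
        show "integrable lborel (\<lambda>x. complex_of_real (\<psi> x))" using \<psi>(2) by simp
        show "continuous_on UNIV (\<lambda>x. complex_of_real (\<psi> x))" using \<psi>(1) by (intro continuous_intros)
        show "norm (complex_of_real (\<psi> x)) \<le> C" for x using C by simp
        have "fourier fe = (\<lambda>\<xi>. LINT x|lborel. g x * plane_wave (- \<xi>) x)" using g(3) by (rule ext)
        then show "integrable lborel (\<lambda>\<xi>. LINT x|lborel. g x * plane_wave (- \<xi>) x)" using int by simp
      qed (rule g(1))
      then show ?thesis using pw_int by (simp add: \<Psi>_def)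
    qed
    also have "\<dots> = (- 1) ^ sum \<alpha> UNIV * ((LINT \<xi>|lborel. fourier fe \<xi> * freq_monomial \<alpha> \<xi> * \<Phi> \<xi>)
        - (\<Sum>k\<in>A. a k * freq_monomial \<alpha> (\<theta> k) * \<Phi> (\<theta> k)))"
    proof -
      have "(LINT \<xi>|lborel. fourier fe \<xi> * \<Psi> \<xi>) = (- 1) ^ sum \<alpha> UNIV * (LINT \<xi>|lborel. fourier fe \<xi> * freq_monomial \<alpha> \<xi> * \<Phi> \<xi>)"
        by (subst integral_mult_right_zero[symmetric]) (simp add: \<Psi>\<Phi> mult_ac)
      then show ?thesis
        by (simp add: \<Psi>\<Phi> right_diff_distrib sum_distrib_left mult_ac)
    qed
    also have "(LINT \<xi>|lborel. fourier fe \<xi> * freq_monomial \<alpha> \<xi> * \<Phi> \<xi>) - (\<Sum>k\<in>A. a k * freq_monomial \<alpha> (\<theta> k) * \<Phi> (\<theta> k))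
        = (LINT x:U|lebesgue. \<phi> x *\<^sub>R ?D x)"
    proof -
      have swap: "(LINT \<xi>|lborel. fourier fe \<xi> * freq_monomial \<alpha> \<xi> * \<Phi> \<xi>)
          = (LINT x|lborel. of_real (\<phi> x) * (LINT \<xi>|lborel. fourier fe \<xi> * freq_monomial \<alpha> \<xi> * plane_wave \<xi> x))"
        unfolding \<Phi>_def using \<phi>'(2) int\<alpha>
        by (intro integral_swap_bounded_kernel[where C = 1]) auto
      have int1: "integrable lborel (\<lambda>x. of_real (\<phi> x) * (LINT \<xi>|lborel. fourier fe \<xi> * freq_monomial \<alpha> \<xi> * plane_wave \<xi> x))"
      proof (rule Bochner_Integration.integrable_bound)
        let ?I = "LINT \<xi>|lborel. norm (fourier fe \<xi> * freq_monomial \<alpha> \<xi>)"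
        show "integrable lborel (\<lambda>x. \<phi> x * ?I)" using \<phi>'(2) by auto
        have [measurable]: "(\<lambda>\<xi>. fourier fe \<xi> * freq_monomial \<alpha> \<xi>) \<in> borel_measurable borel"
          using int\<alpha> by (auto dest: borel_measurable_integrable)
        show "(\<lambda>x. of_real (\<phi> x) * (LINT \<xi>|lborel. fourier fe \<xi> * freq_monomial \<alpha> \<xi> * plane_wave \<xi> x)) \<in> borel_measurable lborel"
          by measurable
        show "AE x in lborel. norm (of_real (\<phi> x) * (LINT \<xi>|lborel. fourier fe \<xi> * freq_monomial \<alpha> \<xi> * plane_wave \<xi> x))
            \<le> norm (\<phi> x * ?I)"
        proof (rule AE_I2)
          fix x
          have "norm (LINT \<xi>|lborel. fourier fe \<xi> * freq_monomial \<alpha> \<xi> * plane_wave \<xi> x) \<le> ?I"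
            using integral_norm_bound[of lborel "\<lambda>\<xi>. fourier fe \<xi> * freq_monomial \<alpha> \<xi> * plane_wave \<xi> x"] by (simp add: norm_mult)
          then show "norm (of_real (\<phi> x) * (LINT \<xi>|lborel. fourier fe \<xi> * freq_monomial \<alpha> \<xi> * plane_wave \<xi> x))
            \<le> norm (\<phi> x * ?I)"
            by (auto simp: norm_mult abs_mult intro!: mult_left_mono)
        qed
      qed
      have "(LINT x:U|lebesgue. \<phi> x *\<^sub>R ?D x) = (LINT x|lebesgue. of_real (\<phi> x) * ?D x)"
        unfolding set_lebesgue_integral_def
      proof (rule Bochner_Integration.integral_cong[OF refl])
        fix x
        show "indicator U x *\<^sub>R \<phi> x *\<^sub>R ?D x = of_real (\<phi> x) * ?D x"
          using \<phi>0[of x] K(2) by (cases "x \<in> U") (auto simp: scaleR_conv_of_real)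
      qed
      also have "\<dots> = (LINT x|lborel. of_real (\<phi> x) * ?D x)"
        by (rule integral_completion) measurable
      also have "\<dots> = (LINT x|lborel. of_real (\<phi> x) * (LINT \<xi>|lborel. fourier fe \<xi> * freq_monomial \<alpha> \<xi> * plane_wave \<xi> x)
          - (\<Sum>k\<in>A. a k * freq_monomial \<alpha> (\<theta> k) * (of_real (\<phi> x) * plane_wave (\<theta> k) x)))"
        unfolding spectral_deriv_def by (simp add: right_diff_distrib sum_distrib_left mult_ac)
      also have "\<dots> = (LINT x|lborel. of_real (\<phi> x) * (LINT \<xi>|lborel. fourier fe \<xi> * freq_monomial \<alpha> \<xi> * plane_wave \<xi> x))
          - (\<Sum>k\<in>A. a k * freq_monomial \<alpha> (\<theta> k) * \<Phi> (\<theta> k))"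
        using int1 pw_int by (simp add: \<Phi>_def)
      finally show ?thesis unfolding swap ..
    qed
    finally show "(LINT x:U|lebesgue. iter_partial is \<phi> x *\<^sub>R ?u x)
        = (- 1) ^ sum \<alpha> UNIV * (LINT x:U|lebesgue. \<phi> x *\<^sub>R ?D x)"
      by (simp only: \<psi>_def)
  qed (use u_abs cont_abs D_cont in auto)
qed

section \<open>Sobolev norms and the error kernel\<close>

text \<open>
  On the dyadic shell of outer radius \<open>r k\<close> the integrand is comparable to \<open>r k powr (p - d)\<close> and
  the volume to \<open>r k powr d\<close>, so the shells contribute a geometric series with ratio \<open>2 powr (- p)\<close>.
\<close>

lemma nn_integral_norm_powr_cball_finite:
  fixes p R :: real
  assumes p: "0 < p" and R: "0 < R"
  shows "(\<integral>\<^sup>+ z\<in>cball 0 R. ennreal (norm (z :: 'a::euclidean_space) powr (p - real DIM('a))) \<partial>lborel) < \<infinity>"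
proof -
  define d where "d = real DIM('a)"
  define r where "r k = R * (1 / 2) ^ k" for k
  have r: "0 < r k" for k using R by (simp add: r_def)
  define M where "M = max 1 (2 powr (d - p))"
  define c where "c k = M * r k powr (p - d)" for k
  have c: "0 \<le> c k" for k by (simp add: c_def M_def)
  have [measurable]: "cball (0 :: 'a) \<rho> \<in> sets borel" for \<rho> by simp
  have pointwise: "ennreal (norm z powr (p - d)) * indicator (cball 0 R) z \<le> (\<Sum>k. ennreal (c k) * indicator (cball 0 (r k)) z)" for z :: 'a
  proof (cases "z \<in> cball 0 R \<and> z \<noteq> 0")
    case True
    then have nz: "0 < norm z" "norm z \<le> R" by auto
    have ex: "\<exists>n. r n < norm z"
      using real_arch_pow_inv[of "norm z / R" "1 / 2"] nz R by (auto simp: r_def field_simps)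
    define n where "n = (LEAST n. r n < norm z)"
    have n: "r n < norm z" unfolding n_def by (rule LeastI_ex[OF ex])
    then have "n \<noteq> 0" using nz by (intro notI) (simp add: r_def)
    then obtain k where k: "n = Suc k" by (cases n) auto
    have zk: "norm z \<le> r k"
      using not_less_Least[of k "\<lambda>n. r n < norm z"] k by (simp add: n_def)
    define t where "t = norm z / r k"
    have t: "1 / 2 \<le> t" "t \<le> 1" using n zk r[of k] by (auto simp: t_def k r_def field_simps)
    have "t powr (p - d) \<le> M"
    proof (cases "p \<ge> d")
      case True
      then have "t powr (p - d) \<le> 1 powr (p - d)" using t by (intro powr_mono2) auto
      then show ?thesis by (simp add: M_def)
    next
      case False
      then have "t powr (p - d) \<le> (1 / 2) powr (p - d)" using t by (intro powr_mono2') auto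
      also have "\<dots> = 2 powr (d - p)"
      proof -
        have "1 / 2 = (2 :: real) powr (- 1)" by (simp add: powr_minus)
        then have "(1 / 2) powr (p - d) = (2 powr (- 1)) powr (p - d)" by (rule arg_cong)
        also have "\<dots> = 2 powr (d - p)" unfolding powr_powr by (rule arg_cong[of _ _ "(powr) 2"]) simp
        finally show ?thesis .
      qed
      finally show ?thesis by (simp add: M_def)
    qed
    then have "norm z powr (p - d) \<le> c k"
      using r[of k] nz by (simp add: t_def c_def powr_divide field_simps)
    then have "ennreal (norm z powr (p - d)) \<le> ennreal (c k) * indicator (cball 0 (r k)) z"
      using zk by (simp add: ennreal_leI)
    also have "\<dots> = (\<Sum>j\<in>{k}. ennreal (c j) * indicator (cball 0 (r j)) z)"
      by (simp only: sum.insert finite.emptyI empty_iff sum.empty add_0_right not_False_eq_True)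
    also have "\<dots> \<le> (\<Sum>j. ennreal (c j) * indicator (cball 0 (r j)) z)"
      by (intro sum_le_suminf) auto
    finally show ?thesis using True by simp
  qed (auto simp: indicator_def)
  have "(\<integral>\<^sup>+ z\<in>cball 0 R. ennreal (norm (z :: 'a) powr (p - d)) \<partial>lborel)
      \<le> (\<integral>\<^sup>+ z. (\<Sum>k. ennreal (c k) * indicator (cball 0 (r k)) (z :: 'a)) \<partial>lborel)"
    by (intro nn_integral_mono pointwise)
  also have "\<dots> = (\<Sum>k. ennreal (c k) * emeasure lborel (cball (0 :: 'a) (r k)))"
    by (subst nn_integral_suminf) (auto simp: nn_integral_cmult_indicator)
  also have "\<dots> = (\<Sum>k. ennreal (M * unit_ball_vol d * R powr p * (2 powr (- p)) ^ k))"
  proof (intro suminf_cong)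
    fix k
    have "r k powr (p - d) * r k ^ DIM('a) = r k powr p"
      using r[of k] by (simp add: d_def powr_diff powr_realpow)
    then have "c k * (unit_ball_vol d * r k ^ DIM('a)) = M * unit_ball_vol d * r k powr p"
      by (simp add: c_def mult_ac)
    also have "r k powr p = R powr p * (2 powr (- p)) ^ k"
    proof -
      have "(1 / 2) ^ k = (2 :: real) powr (- real k)"
        by (simp add: powr_minus powr_realpow power_one_over inverse_eq_divide)
      then have "r k powr p = R powr p * (2 powr (- real k)) powr p"
        using R by (simp only: r_def powr_mult less_imp_le powr_ge_zero)
      also have "(2 powr (- real k)) powr p = (2 :: real) powr ((- p) * real k)"
        unfolding powr_powr by (simp add: mult.commute)
      also have "\<dots> = (2 powr (- p)) ^ k"
        by (simp only: powr_powr[symmetric] powr_realpow powr_gt_zero zero_neq_numeral)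
      finally show ?thesis .
    qed
    finally have "c k * (unit_ball_vol d * r k ^ DIM('a)) = M * unit_ball_vol d * R powr p * (2 powr (- p)) ^ k"
      by (simp only: mult.assoc)
    moreover have "ennreal (c k) * emeasure lborel (cball (0 :: 'a) (r k)) = ennreal (c k * (unit_ball_vol d * r k ^ DIM('a)))"
      using r[of k] c[of k] by (simp add: emeasure_cball ennreal_mult'[symmetric] d_def)
    ultimately show "ennreal (c k) * emeasure lborel (cball (0 :: 'a) (r k))
        = ennreal (M * unit_ball_vol d * R powr p * (2 powr (- p)) ^ k)"
      by (simp only:)
  qed
  also have "\<dots> < \<infinity>"
  proof -
    have "2 powr (- p) < 2 powr 0" using p by (intro powr_less_mono) auto
    then have "summable (\<lambda>k. M * unit_ball_vol d * R powr p * (2 powr (- p)) ^ k)"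
      by (intro summable_mult summable_geometric) auto
    then show ?thesis
      by (subst suminf_ennreal2) (auto simp: M_def d_def)
  qed
  finally show ?thesis by (simp add: d_def)
qed

lemma lborel_nn_integral_reflect_shift:
  fixes f :: "'a::euclidean_space \<Rightarrow> ennreal"
  assumes [measurable]: "f \<in> borel_measurable borel"
  shows "(\<integral>\<^sup>+ y. f (x - y) \<partial>lborel) = (\<integral>\<^sup>+ y. f y \<partial>lborel)"
proof -
  have "(\<integral>\<^sup>+ y. f y \<partial>lborel) = (\<integral>\<^sup>+ y. f y \<partial>density (distr lborel borel (\<lambda>y. x + (- 1) *\<^sub>R y)) (\<lambda>_. 1))"
    using lborel_affine[of "- 1" x] by simp
  also have "\<dots> = (\<integral>\<^sup>+ y. f (x - y) \<partial>lborel)"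
    by (subst nn_integral_density) (auto simp: nn_integral_distr)
  finally show ?thesis ..
qed

lemma interior_unit_cube:
  "interior (unit_cube :: (real ^ 'n) set) = box 0 1"
  "emeasure lborel (box 0 1 :: (real ^ 'n) set) = 1"
proof -
  show 1: "interior (unit_cube :: (real ^ 'n) set) = box 0 1"
    by (simp add: unit_cube_def)
  show "emeasure lborel (box 0 1 :: (real ^ 'n) set) = 1"
    by (subst emeasure_lborel_box) (auto simp: Basis_vec_def inner_axis intro!: prod.neutral)
qed

text \<open>
  For a Lipschitz function the double integral has the integrable singularity
  \<open>|x - y| powr (2 - 2 s - d)\<close>.
\<close>

lemma slobodeckij_sq_Lipschitz_le:
  fixes s :: real
  assumes s: "s < 1"
  obtains K where "0 \<le> K" "\<And>(g :: real ^ 'n \<Rightarrow> complex) L. 0 \<le> L \<Longrightarrow>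
    (\<And>x y. x \<in> interior unit_cube \<Longrightarrow> y \<in> interior unit_cube \<Longrightarrow> norm (g x - g y) \<le> L * norm (x - y)) \<Longrightarrow>
    slobodeckij_sq s (interior unit_cube) g \<le> ennreal (K * L\<^sup>2)"
proof -
  let ?U = "interior unit_cube :: (real ^ 'n) set"
  define p where "p = 2 * (1 - s)"
  define R where "R = diameter ?U + 1"
  have bU: "bounded ?U" by (simp add: interior_unit_cube)
  have R: "0 < R" using diameter_ge_0[OF bU] by (simp add: R_def)
  define k where "k z = ennreal (norm (z :: real ^ 'n) powr (p - real CARD('n))) * indicator (cball 0 R) z" for z
  have [measurable]: "cball (0 :: real ^ 'n) R \<in> sets borel" by simp
  have [measurable]: "k \<in> borel_measurable borel" unfolding k_def by measurable
  have "(\<integral>\<^sup>+ z. k z \<partial>lborel) < \<infinity>"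
    using nn_integral_norm_powr_cball_finite[of p R, where 'a = "real ^ 'n"] s R by (simp add: k_def p_def)
  then obtain K where K: "0 \<le> K" "(\<integral>\<^sup>+ z. k z \<partial>lborel) = ennreal K"
    by (metis ennreal_cases infinity_ennreal_def less_irrefl)
  show ?thesis
  proof (rule that[OF K(1)])
    fix g :: "real ^ 'n \<Rightarrow> complex" and L :: real
    assume L: "0 \<le> L" and lip: "\<And>x y. x \<in> ?U \<Longrightarrow> y \<in> ?U \<Longrightarrow> norm (g x - g y) \<le> L * norm (x - y)"
    have inner: "(\<integral>\<^sup>+ y\<in>?U. ennreal ((norm (g x - g y))\<^sup>2 / norm (x - y) powr (real CARD('n) + 2 * s)) \<partial>lebesgue) \<le> ennreal (L\<^sup>2 * K)"
      if x: "x \<in> ?U" for x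
    proof -
      have "ennreal ((norm (g x - g y))\<^sup>2 / norm (x - y) powr (real CARD('n) + 2 * s)) * indicator ?U y \<le> ennreal (L\<^sup>2) * k (x - y)" for y
      proof (cases "y \<in> ?U \<and> x \<noteq> y")
        case True
        then have n0: "0 < norm (x - y)" by simp
        have "norm (x - y) \<le> R"
          using diameter_bounded_bound[OF bU x, of y] True by (simp add: R_def dist_norm)
        then have "k (x - y) = ennreal (norm (x - y) powr (p - real CARD('n)))" by (simp add: k_def)
        moreover have "(norm (g x - g y))\<^sup>2 / norm (x - y) powr (real CARD('n) + 2 * s) \<le> L\<^sup>2 * norm (x - y) powr (p - real CARD('n))"
        proof -
          have "(norm (g x - g y))\<^sup>2 \<le> (L * norm (x - y))\<^sup>2"
            using lip[OF x, of y] True by (intro power_mono) auto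
          also have "\<dots> = L\<^sup>2 * norm (x - y) powr 2" using n0 by (simp add: power_mult_distrib)
          finally have "(norm (g x - g y))\<^sup>2 / norm (x - y) powr (real CARD('n) + 2 * s)
              \<le> L\<^sup>2 * norm (x - y) powr 2 / norm (x - y) powr (real CARD('n) + 2 * s)"
            by (intro divide_right_mono) auto
          also have "\<dots> = L\<^sup>2 * norm (x - y) powr (2 - (real CARD('n) + 2 * s))"
            by (simp only: powr_diff times_divide_eq_right)
          finally show ?thesis by (simp add: p_def algebra_simps)
        qed
        ultimately show ?thesis using True by (simp add: ennreal_mult'[symmetric] ennreal_leI)
      qed auto
      then have "(\<integral>\<^sup>+ y\<in>?U. ennreal ((norm (g x - g y))\<^sup>2 / norm (x - y) powr (real CARD('n) + 2 * s)) \<partial>lebesgue)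
          \<le> (\<integral>\<^sup>+ y. ennreal (L\<^sup>2) * k (x - y) \<partial>lebesgue)"
        by (intro nn_integral_mono)
      also have "\<dots> = ennreal (L\<^sup>2) * (\<integral>\<^sup>+ y. k y \<partial>lborel)"
        by (simp add: nn_integral_completion nn_integral_cmult lborel_nn_integral_reflect_shift)
      finally show ?thesis using K by (simp add: ennreal_mult')
    qed
    have "slobodeckij_sq s ?U g \<le> (\<integral>\<^sup>+ x. ennreal (L\<^sup>2 * K) * indicator ?U x \<partial>lebesgue)"
      unfolding slobodeckij_sq_def
      by (intro nn_integral_mono) (use inner in \<open>auto simp: indicator_def\<close>)
    also have "\<dots> = ennreal (L\<^sup>2 * K)"
      by (subst nn_integral_cmult_indicator) (auto simp: interior_unit_cube)
    finally show "slobodeckij_sq s ?U g \<le> ennreal (K * L\<^sup>2)" by (simp add: mult.commute)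
  qed
qed

text \<open>
  Reduces the Sobolev norm of any order to sup bounds for the derivatives up to order \<open>\<lfloor>m\<rfloor>\<close> and a
  Lipschitz bound in the top order, which takes care of the fractional part.
\<close>

lemma sobolev_norm_le_of_bounded_weak_derivs:
  fixes m :: real
  obtains K where "0 < K" "\<And>(u :: real ^ 'n \<Rightarrow> complex) D \<epsilon>. 0 \<le> \<epsilon> \<Longrightarrow>
    (\<And>\<alpha>. sum \<alpha> UNIV \<le> nat \<lfloor>m\<rfloor> \<Longrightarrow> has_weak_deriv (interior unit_cube) \<alpha> u (D \<alpha>)) \<Longrightarrow>
    (\<And>\<alpha> x. sum \<alpha> UNIV \<le> nat \<lfloor>m\<rfloor> \<Longrightarrow> x \<in> interior unit_cube \<Longrightarrow> norm (D \<alpha> x) \<le> \<epsilon>) \<Longrightarrow>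
    (\<And>\<alpha> x y. sum \<alpha> UNIV = nat \<lfloor>m\<rfloor> \<Longrightarrow> x \<in> interior unit_cube \<Longrightarrow> y \<in> interior unit_cube \<Longrightarrow>
       norm (D \<alpha> x - D \<alpha> y) \<le> \<epsilon> * norm (x - y)) \<Longrightarrow>
    sobolev_norm m (interior unit_cube) u \<le> ennreal (K * \<epsilon>)"
proof -
  let ?U = "interior unit_cube :: (real ^ 'n) set"
  let ?A = "{\<alpha> :: 'n \<Rightarrow> nat. sum \<alpha> UNIV \<le> nat \<lfloor>m\<rfloor>}" and ?B = "{\<alpha> :: 'n \<Rightarrow> nat. sum \<alpha> UNIV = nat \<lfloor>m\<rfloor>}"
  obtain Ks where Ks: "0 \<le> Ks" "\<And>(g :: real ^ 'n \<Rightarrow> complex) L. 0 \<le> L \<Longrightarrow>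
    (\<And>x y. x \<in> ?U \<Longrightarrow> y \<in> ?U \<Longrightarrow> norm (g x - g y) \<le> L * norm (x - y)) \<Longrightarrow>
    slobodeckij_sq (frac m) ?U g \<le> ennreal (Ks * L\<^sup>2)"
    using slobodeckij_sq_Lipschitz_le[OF frac_lt_1[of m], where 'n = 'n] by metis
  define Q where "Q = real (card ?A) + real (card ?B) * Ks + 1"
  have Q: "0 < Q" using Ks(1) by (simp add: Q_def add_nonneg_pos)
  show ?thesis
  proof (rule that[of "sqrt Q"])
    fix u :: "real ^ 'n \<Rightarrow> complex" and D and \<epsilon> :: real
    assume \<epsilon>: "0 \<le> \<epsilon>" and weak: "\<And>\<alpha>. sum \<alpha> UNIV \<le> nat \<lfloor>m\<rfloor> \<Longrightarrow> has_weak_deriv ?U \<alpha> u (D \<alpha>)"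
      and bd: "\<And>\<alpha> x. sum \<alpha> UNIV \<le> nat \<lfloor>m\<rfloor> \<Longrightarrow> x \<in> ?U \<Longrightarrow> norm (D \<alpha> x) \<le> \<epsilon>"
      and lip: "\<And>\<alpha> x y. sum \<alpha> UNIV = nat \<lfloor>m\<rfloor> \<Longrightarrow> x \<in> ?U \<Longrightarrow> y \<in> ?U \<Longrightarrow> norm (D \<alpha> x - D \<alpha> y) \<le> \<epsilon> * norm (x - y)"
    have L2: "L2_sq ?U (D \<alpha>) \<le> ennreal (\<epsilon>\<^sup>2)" if "\<alpha> \<in> ?A" for \<alpha>
    proof -
      have "L2_sq ?U (D \<alpha>) \<le> (\<integral>\<^sup>+ x. ennreal (\<epsilon>\<^sup>2) * indicator ?U x \<partial>lebesgue)"
        unfolding L2_sq_def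
        by (intro nn_integral_mono) (use bd that in \<open>auto simp: indicator_def intro!: ennreal_leI power_mono\<close>)
      also have "\<dots> = ennreal (\<epsilon>\<^sup>2)"
        by (subst nn_integral_cmult_indicator) (auto simp: interior_unit_cube)
      finally show ?thesis .
    qed
    have "sobolev_sq m ?U u \<le> (\<Sum>\<alpha>\<in>?A. L2_sq ?U (D \<alpha>)) +
        (if frac m = 0 then 0 else \<Sum>\<alpha>\<in>?B. slobodeckij_sq (frac m) ?U (D \<alpha>))"
      unfolding sobolev_sq_def by (rule INF_lower) (use weak in auto)
    also have "\<dots> \<le> of_nat (card ?A) * ennreal (\<epsilon>\<^sup>2) + of_nat (card ?B) * ennreal (Ks * \<epsilon>\<^sup>2)"
    proof (rule add_mono)
      show "(\<Sum>\<alpha>\<in>?A. L2_sq ?U (D \<alpha>)) \<le> of_nat (card ?A) * ennreal (\<epsilon>\<^sup>2)"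
        by (rule sum_bounded_above) (rule L2)
      have "(\<Sum>\<alpha>\<in>?B. slobodeckij_sq (frac m) ?U (D \<alpha>)) \<le> of_nat (card ?B) * ennreal (Ks * \<epsilon>\<^sup>2)"
        by (rule sum_bounded_above) (auto intro!: Ks(2) \<epsilon> lip)
      then show "(if frac m = 0 then 0 else \<Sum>\<alpha>\<in>?B. slobodeckij_sq (frac m) ?U (D \<alpha>)) \<le> of_nat (card ?B) * ennreal (Ks * \<epsilon>\<^sup>2)"
        by simp
    qed
    also have "\<dots> = ennreal (real (card ?A) * \<epsilon>\<^sup>2 + real (card ?B) * (Ks * \<epsilon>\<^sup>2))"
      using Ks(1) by (simp add: ennreal_of_nat_eq_real_of_nat ennreal_mult''[symmetric] ennreal_plus[symmetric] del: ennreal_plus)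
    also have "\<dots> \<le> ennreal (Q * \<epsilon>\<^sup>2)"
      by (intro ennreal_leI) (simp add: Q_def algebra_simps)
    finally have le: "sobolev_sq m ?U u \<le> ennreal (Q * \<epsilon>\<^sup>2)" .
    then have fin: "sobolev_sq m ?U u \<noteq> \<infinity>" by (auto simp: top_unique)
    have "enn2real (sobolev_sq m ?U u) \<le> Q * \<epsilon>\<^sup>2"
      using Q le by (intro enn2real_leI) auto
    then have "sqrt (enn2real (sobolev_sq m ?U u)) \<le> sqrt Q * \<epsilon>"
      using \<epsilon> by (metis real_sqrt_le_iff real_sqrt_mult real_sqrt_unique)
    then show "sobolev_norm m ?U u \<le> ennreal (sqrt Q * \<epsilon>)"
      using fin by (simp add: sobolev_norm_def ennreal_leI)
  qed (use Q in simp)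
qed

text \<open>
  The error, together with its derivatives, that arises when the single plane wave of frequency \<open>\<xi>\<close>
  is replaced by an exponential sum with coefficients \<open>cf k \<xi>\<close>.
\<close>

definition spectral_kernel ::
    "'k set \<Rightarrow> ('k \<Rightarrow> real ^ 'n \<Rightarrow> complex) \<Rightarrow> ('k \<Rightarrow> real ^ 'n) \<Rightarrow> ('n \<Rightarrow> nat) \<Rightarrow> real ^ 'n \<Rightarrow> real ^ 'n \<Rightarrow> complex" where
  "spectral_kernel A cf \<theta> \<alpha> \<xi> x =
     freq_monomial \<alpha> \<xi> * plane_wave \<xi> x - (\<Sum>k\<in>A. cf k \<xi> * freq_monomial \<alpha> (\<theta> k) * plane_wave (\<theta> k) x)"

lemma spectral_deriv_eq_integral_kernel:
  assumes h: "integrable lborel (\<lambda>\<xi>. h \<xi> * freq_monomial \<alpha> \<xi>)"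
    and cf: "\<And>k. k \<in> A \<Longrightarrow> integrable lborel (\<lambda>\<xi>. h \<xi> * cf k \<xi>)"
  shows "integrable lborel (\<lambda>\<xi>. h \<xi> * spectral_kernel A cf \<theta> \<alpha> \<xi> x)"
    and "spectral_deriv h A (\<lambda>k. LINT \<xi>|lborel. h \<xi> * cf k \<xi>) \<theta> \<alpha> x = (LINT \<xi>|lborel. h \<xi> * spectral_kernel A cf \<theta> \<alpha> \<xi> x)"
proof -
  have [measurable]: "(\<lambda>\<xi>. h \<xi> * freq_monomial \<alpha> \<xi>) \<in> borel_measurable borel"
    using h by (auto dest: borel_measurable_integrable)
  have 1: "integrable lborel (\<lambda>\<xi>. h \<xi> * freq_monomial \<alpha> \<xi> * plane_wave \<xi> x)"
    using h by (rule Bochner_Integration.integrable_bound) (auto simp: norm_mult)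
  have 2: "integrable lborel (\<lambda>\<xi>. h \<xi> * cf k \<xi> * (freq_monomial \<alpha> (\<theta> k) * plane_wave (\<theta> k) x))" if "k \<in> A" for k
    using cf[OF that] by auto
  have eq: "h \<xi> * spectral_kernel A cf \<theta> \<alpha> \<xi> x = h \<xi> * freq_monomial \<alpha> \<xi> * plane_wave \<xi> x
      - (\<Sum>k\<in>A. h \<xi> * cf k \<xi> * (freq_monomial \<alpha> (\<theta> k) * plane_wave (\<theta> k) x))" for \<xi>
    by (simp add: spectral_kernel_def right_diff_distrib sum_distrib_left mult_ac)
  have 3: "integrable lborel (\<lambda>\<xi>. \<Sum>k\<in>A. h \<xi> * cf k \<xi> * (freq_monomial \<alpha> (\<theta> k) * plane_wave (\<theta> k) x))"
    by (rule Bochner_Integration.integrable_sum) (rule 2)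
  show "integrable lborel (\<lambda>\<xi>. h \<xi> * spectral_kernel A cf \<theta> \<alpha> \<xi> x)"
    unfolding eq by (intro Bochner_Integration.integrable_diff 1 3)
  have "(LINT \<xi>|lborel. (\<Sum>k\<in>A. h \<xi> * cf k \<xi> * (freq_monomial \<alpha> (\<theta> k) * plane_wave (\<theta> k) x)))
      = (\<Sum>k\<in>A. (LINT \<xi>|lborel. h \<xi> * cf k \<xi>) * (freq_monomial \<alpha> (\<theta> k) * plane_wave (\<theta> k) x))"
    by (subst Bochner_Integration.integral_sum) (auto intro: 2)
  then show "spectral_deriv h A (\<lambda>k. LINT \<xi>|lborel. h \<xi> * cf k \<xi>) \<theta> \<alpha> x = (LINT \<xi>|lborel. h \<xi> * spectral_kernel A cf \<theta> \<alpha> \<xi> x)"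
    unfolding eq using 1 3 by (simp add: spectral_deriv_def mult.assoc)
qed

lemma freq_monomial_Suc:
  "freq_monomial (\<alpha>(i := Suc (\<alpha> i))) \<xi> = 2 * of_real pi * \<i> * of_real (\<xi> $ i) * freq_monomial \<alpha> \<xi>"
  unfolding freq_monomial_def
  by (subst (1 2) prod.remove[of UNIV i]) (auto intro!: prod.cong)

text \<open>
  The derivative along the segment from \<open>y\<close> to \<open>x\<close> is a combination of kernels of the next
  order, with the coordinates of \<open>x - y\<close> as weights.
\<close>

lemma spectral_kernel_Lipschitz:
  fixes x y :: "real ^ 'n"
  assumes U: "convex U" "x \<in> U" "y \<in> U"
    and bd: "\<And>i z. z \<in> U \<Longrightarrow> norm (spectral_kernel A cf \<theta> (\<alpha>(i := Suc (\<alpha> i))) \<xi> z) \<le> B"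
  shows "norm (spectral_kernel A cf \<theta> \<alpha> \<xi> x - spectral_kernel A cf \<theta> \<alpha> \<xi> y) \<le> real CARD('n) * B * norm (x - y)"
proof -
  define v where "v = x - y"
  define \<gamma> where "\<gamma> t = y + t *\<^sub>R v" for t
  have \<gamma>: "\<gamma> t \<in> U" if "t \<in> {0..1}" for t
    using convexD_alt[OF U(1,3,2), of t] that by (simp add: \<gamma>_def v_def algebra_simps)
  define d where "d t = (\<Sum>i\<in>UNIV. of_real (v $ i) * spectral_kernel A cf \<theta> (\<alpha>(i := Suc (\<alpha> i))) \<xi> (\<gamma> t))" for t
  have wave: "((\<lambda>t. freq_monomial \<alpha> \<eta> * plane_wave \<eta> (\<gamma> t)) has_vector_derivative
      (\<Sum>i\<in>UNIV. of_real (v $ i) * (freq_monomial (\<alpha>(i := Suc (\<alpha> i))) \<eta> * plane_wave \<eta> (\<gamma> t)))) (at t within S)" for \<eta> t S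
  proof -
    have "((\<lambda>z. freq_monomial \<alpha> \<eta> * exp (2 * of_real pi * \<i> * (of_real (\<eta> \<bullet> y) + z * of_real (\<eta> \<bullet> v)))) has_field_derivative
        2 * of_real pi * \<i> * of_real (\<eta> \<bullet> v) * (freq_monomial \<alpha> \<eta> * exp (2 * of_real pi * \<i> * (of_real (\<eta> \<bullet> y) + of_real t * of_real (\<eta> \<bullet> v))))) (at (of_real t))"
      by (auto intro!: derivative_eq_intros)
    from has_vector_derivative_real_field[OF this]
    have "((\<lambda>t. freq_monomial \<alpha> \<eta> * plane_wave \<eta> (\<gamma> t)) has_vector_derivative
        2 * of_real pi * \<i> * of_real (\<eta> \<bullet> v) * (freq_monomial \<alpha> \<eta> * plane_wave \<eta> (\<gamma> t))) (at t within S)"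
      by (simp add: plane_wave_def \<gamma>_def inner_add_right o_def)
    moreover have "2 * of_real pi * \<i> * of_real (\<eta> \<bullet> v) * (freq_monomial \<alpha> \<eta> * plane_wave \<eta> (\<gamma> t))
        = (\<Sum>i\<in>UNIV. of_real (v $ i) * (freq_monomial (\<alpha>(i := Suc (\<alpha> i))) \<eta> * plane_wave \<eta> (\<gamma> t)))"
      unfolding freq_monomial_Suc by (simp add: inner_vec_def sum_distrib_left sum_distrib_right mult_ac)
    ultimately show ?thesis by simp
  qed
  have deriv: "((\<lambda>t. spectral_kernel A cf \<theta> \<alpha> \<xi> (\<gamma> t)) has_vector_derivative d t) (at t within {0..1})" for t
  proof -
    have "((\<lambda>t. freq_monomial \<alpha> \<xi> * plane_wave \<xi> (\<gamma> t) - (\<Sum>k\<in>A. cf k \<xi> * (freq_monomial \<alpha> (\<theta> k) * plane_wave (\<theta> k) (\<gamma> t))))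
      has_vector_derivative
        (\<Sum>i\<in>UNIV. of_real (v $ i) * (freq_monomial (\<alpha>(i := Suc (\<alpha> i))) \<xi> * plane_wave \<xi> (\<gamma> t))) -
        (\<Sum>k\<in>A. cf k \<xi> * (\<Sum>i\<in>UNIV. of_real (v $ i) * (freq_monomial (\<alpha>(i := Suc (\<alpha> i))) (\<theta> k) * plane_wave (\<theta> k) (\<gamma> t)))))
      (at t within {0..1})"
      by (intro has_vector_derivative_diff has_vector_derivative_sum has_vector_derivative_mult_right wave)
    moreover have "(\<Sum>k\<in>A. cf k \<xi> * (\<Sum>i\<in>UNIV. of_real (v $ i) * (freq_monomial (\<alpha>(i := Suc (\<alpha> i))) (\<theta> k) * plane_wave (\<theta> k) (\<gamma> t))))
        = (\<Sum>i\<in>UNIV. of_real (v $ i) * (\<Sum>k\<in>A. cf k \<xi> * freq_monomial (\<alpha>(i := Suc (\<alpha> i))) (\<theta> k) * plane_wave (\<theta> k) (\<gamma> t)))"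
      unfolding sum_distrib_left by (subst sum.swap) (simp add: mult_ac)
    ultimately show ?thesis
      by (simp add: spectral_kernel_def d_def mult.assoc sum_subtractf right_diff_distrib)
  qed
  have d_bound: "norm (d t) \<le> real CARD('n) * B * norm v" if "t \<in> {0..1}" for t
  proof -
    have "norm (d t) \<le> (\<Sum>i\<in>(UNIV :: 'n set). norm v * B)"
      unfolding d_def
    proof (rule sum_norm_le)
      fix i
      show "norm (of_real (v $ i) * spectral_kernel A cf \<theta> (\<alpha>(i := Suc (\<alpha> i))) \<xi> (\<gamma> t)) \<le> norm v * B"
        using component_le_norm_cart[of v i] bd[OF \<gamma>[OF that], of i] unfolding norm_mult by (intro mult_mono) auto
    qed
    then show ?thesis by (simp add: mult_ac)
  qed
  have on: "onorm (\<lambda>s. s *\<^sub>R d t) \<le> real CARD('n) * B * norm v" if "t \<in> {0..1}" for t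
  proof (rule onorm_bound)
    show "0 \<le> real CARD('n) * B * norm v"
      by (rule order_trans[OF norm_ge_zero d_bound[of 0]]) simp
    show "norm (s *\<^sub>R d t) \<le> real CARD('n) * B * norm v * norm s" for s
      using mult_right_mono[OF d_bound[OF that], of "norm s"] by (simp add: mult.commute)
  qed
  have "norm (spectral_kernel A cf \<theta> \<alpha> \<xi> (\<gamma> 1) - spectral_kernel A cf \<theta> \<alpha> \<xi> (\<gamma> 0)) \<le> real CARD('n) * B * norm v * norm (1 - 0 :: real)"
  proof (rule differentiable_bound[of "{0..1}" _ "\<lambda>t s. s *\<^sub>R d t"])
    show "((\<lambda>t. spectral_kernel A cf \<theta> \<alpha> \<xi> (\<gamma> t)) has_derivative (\<lambda>s. s *\<^sub>R d t)) (at t within {0..1})" for t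
      using deriv by (simp add: has_vector_derivative_def)
  qed (use on in auto)
  then show ?thesis by (simp add: \<gamma>_def v_def)
qed

section \<open>Frequency grids in several variables\<close>

text \<open>
  Absorbs the polynomial factors that derivatives produce into an exponential with an arbitrarily
  small constant.
\<close>

lemma power_le_exp_powr:
  fixes a \<beta> :: real
  assumes "0 < a" "0 < \<beta>"
  obtains C where "0 < C" "\<And>t. 0 \<le> t \<Longrightarrow> (1 + 2 * pi * t) ^ N \<le> C * exp (a * t powr \<beta>)"
proof -
  have "((\<lambda>t. ln (1 + 2 * pi * t) / t powr \<beta>) \<longlongrightarrow> 0) at_top"
    using assms by real_asymp
  then have "\<forall>\<^sub>F t in at_top. ln (1 + 2 * pi * t) / t powr \<beta> < a / (real N + 1)"
    using assms by (intro order_tendstoD) auto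
  then obtain X where X: "\<And>t. X \<le> t \<Longrightarrow> ln (1 + 2 * pi * t) / t powr \<beta> < a / (real N + 1)"
    by (auto simp: eventually_at_top_linorder)
  define Y where "Y = max X 1"
  have Y: "0 < Y" by (simp add: Y_def)
  show ?thesis
  proof (rule that[of "(1 + 2 * pi * Y) ^ N"])
    show "0 < (1 + 2 * pi * Y) ^ N" using Y by (intro zero_less_power add_pos_nonneg) auto
    fix t :: real assume t: "0 \<le> t"
    have ge1: "1 \<le> (1 + 2 * pi * Y) ^ N" "1 \<le> exp (a * t powr \<beta>)"
    proof -
      have "0 \<le> 2 * pi * Y" "0 \<le> a * t powr \<beta>" using Y assms by (auto intro!: mult_nonneg_nonneg)
      then show "1 \<le> (1 + 2 * pi * Y) ^ N" "1 \<le> exp (a * t powr \<beta>)"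
        by (auto intro!: one_le_power)
    qed
    show "(1 + 2 * pi * t) ^ N \<le> (1 + 2 * pi * Y) ^ N * exp (a * t powr \<beta>)"
    proof (cases "t \<le> Y")
      case True
      then have "(1 + 2 * pi * t) ^ N \<le> (1 + 2 * pi * Y) ^ N" using t by (intro power_mono) auto
      also have "\<dots> \<le> (1 + 2 * pi * Y) ^ N * exp (a * t powr \<beta>)"
        using mult_left_mono[OF ge1(2), of "(1 + 2 * pi * Y) ^ N"] ge1(1) by simp
      finally show ?thesis .
    next
      case False
      then have "X \<le> t" "1 \<le> t" by (auto simp: Y_def)
      then have "ln (1 + 2 * pi * t) < a / (real N + 1) * t powr \<beta>"
        using X[of t] by (simp add: pos_divide_less_eq)
      then have "real N * ln (1 + 2 * pi * t) \<le> real N * (a / (real N + 1) * t powr \<beta>)"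
        by (intro mult_left_mono) auto
      also have "\<dots> \<le> a * t powr \<beta>"
      proof -
        have "real N * (a / (real N + 1)) \<le> a" using assms by (simp add: field_simps)
        from mult_right_mono[OF this, of "t powr \<beta>"] show ?thesis by (simp add: mult.assoc)
      qed
      finally have "exp (real N * ln (1 + 2 * pi * t)) \<le> exp (a * t powr \<beta>)" by simp
      moreover have "exp (real N * ln (1 + 2 * pi * t)) = (1 + 2 * pi * t) ^ N"
        using t by (simp add: exp_of_nat_mult add_pos_nonneg)
      ultimately have "(1 + 2 * pi * t) ^ N \<le> exp (a * t powr \<beta>)" by simp
      also have "\<dots> \<le> (1 + 2 * pi * Y) ^ N * exp (a * t powr \<beta>)"
        using mult_right_mono[OF ge1(1), of "exp (a * t powr \<beta>)"] by simp
      finally show ?thesis .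
    qed
  qed
qed

lemma norm_freq_monomial_le:
  fixes \<xi> :: "real ^ 'n"
  assumes "sum \<alpha> UNIV \<le> r"
  shows "norm (freq_monomial \<alpha> \<xi>) \<le> (1 + 2 * pi * norm \<xi>) ^ r"
proof -
  have "norm (freq_monomial \<alpha> \<xi>) = (\<Prod>i\<in>UNIV. (2 * pi * \<bar>\<xi> $ i\<bar>) ^ \<alpha> i)"
    by (simp add: freq_monomial_def prod_norm[symmetric] norm_power norm_mult)
  also have "\<dots> \<le> (\<Prod>i\<in>UNIV. (1 + 2 * pi * norm \<xi>) ^ \<alpha> i)"
  proof (intro prod_mono conjI power_mono)
    fix i
    have "2 * pi * \<bar>\<xi> $ i\<bar> \<le> 2 * pi * norm \<xi>"
      using component_le_norm_cart[of \<xi> i] by (intro mult_left_mono) auto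
    then show "2 * pi * \<bar>\<xi> $ i\<bar> \<le> 1 + 2 * pi * norm \<xi>" by linarith
  qed auto
  also have "\<dots> = (1 + 2 * pi * norm \<xi>) ^ sum \<alpha> UNIV" by (simp add: power_sum)
  also have "\<dots> \<le> (1 + 2 * pi * norm \<xi>) ^ r"
    using assms by (intro power_increasing) auto
  finally show ?thesis .
qed

text \<open>
  The step width is chosen such that \<open>2 \<pi> mesh x = x / 8\<close>: the unit interval then becomes the interval
  \<open>[0, 1/8]\<close> on which the one-dimensional discretisation converges.
\<close>

definition mesh :: real where "mesh = 1 / (16 * pi)"

definition grid :: "nat \<Rightarrow> ('n::finite \<Rightarrow> int) set" where
  "grid J = PiE UNIV (\<lambda>_. {-2 * int J..2 * int J})"

definition grid_freq :: "('n \<Rightarrow> int) \<Rightarrow> real ^ 'n" where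
  "grid_freq \<nu> = (\<chi> i. mesh * of_int (\<nu> i))"

lemma finite_grid: "finite (grid J)"
  unfolding grid_def by (intro finite_PiE) auto

lemma card_grid: "card (grid J :: ('n::finite \<Rightarrow> int) set) = (4 * J + 1) ^ CARD('n)"
  unfolding grid_def by (subst card_PiE) (auto simp: nat_add_distrib nat_mult_distrib)

lemma plane_wave_eq_prod: "plane_wave \<xi> x = (\<Prod>i\<in>UNIV. exp (2 * of_real pi * \<i> * of_real (\<xi> $ i * x $ i)))"
  for x :: "real ^ 'n"
  unfolding plane_wave_def by (simp add: inner_vec_def exp_sum[symmetric] sum_distrib_left)

text \<open>
  The bound for factors in the unit disc, rescaled.
\<close>

lemma norm_prod_diff_le:
  fixes z w :: "'a \<Rightarrow> complex"
  assumes I: "finite I" and Y: "1 \<le> Y" and zw: "\<And>i. i \<in> I \<Longrightarrow> norm (z i) \<le> Y" "\<And>i. i \<in> I \<Longrightarrow> norm (w i) \<le> Y"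
    and e: "\<And>i. i \<in> I \<Longrightarrow> norm (z i - w i) \<le> e" "0 \<le> e"
  shows "norm (prod z I - prod w I) \<le> Y ^ card I * (real (card I) * e)"
proof -
  have eq: "prod v I = of_real Y ^ card I * (\<Prod>i\<in>I. v i / of_real Y)" for v :: "'a \<Rightarrow> complex"
    using Y by (simp add: prod_dividef)
  have "norm ((\<Prod>i\<in>I. z i / of_real Y) - (\<Prod>i\<in>I. w i / of_real Y)) \<le> (\<Sum>i\<in>I. norm (z i / of_real Y - w i / of_real Y))"
    using zw Y by (intro norm_prod_diff) (auto simp: norm_divide)
  also have "\<dots> \<le> (\<Sum>i\<in>I. e)"
  proof (rule sum_mono)
    fix i assume i: "i \<in> I"
    have "norm (z i / of_real Y - w i / of_real Y) = norm (z i - w i) / Y"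
      using Y by (simp add: diff_divide_distrib[symmetric] norm_divide)
    also have "\<dots> \<le> norm (z i - w i)" using Y by (simp add: divide_le_eq mult_left_le_imp_le mult_le_cancel_left1)
    also have "\<dots> \<le> e" using e i by auto
    finally show "norm (z i / of_real Y - w i / of_real Y) \<le> e" .
  qed
  finally have "norm ((\<Prod>i\<in>I. z i / of_real Y) - (\<Prod>i\<in>I. w i / of_real Y)) \<le> real (card I) * e" by simp
  moreover have "norm (prod z I - prod w I) = Y ^ card I * norm ((\<Prod>i\<in>I. z i / of_real Y) - (\<Prod>i\<in>I. w i / of_real Y))"
    unfolding eq[of z] eq[of w] right_diff_distrib[symmetric] norm_mult using Y by (simp add: norm_power)
  ultimately show ?thesis using Y by (simp add: mult_left_mono)
qed

text \<open>
  The tensor product of the one-dimensional discretisations. If all coordinates of \<open>\<xi>\<close> are at most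
  of size \<open>J\<close> in units of the mesh, the error is a polynomial in \<open>J\<close> times \<open>(1/2)\<^sup>J\<close>, which is
  \<open>O(exp (- c1 J powr \<beta>))\<close> because \<open>\<beta> < 1\<close>. Otherwise all coefficients vanish, the error is the plane wave
  itself, and one half of the exponential weight pays for the monomial while the other half
  supplies the decay in \<open>J\<close>.
\<close>

lemma exp_grid_approximation:
  fixes \<beta> c :: real
  assumes \<beta>: "0 < \<beta>" "\<beta> < 1" and c: "0 < c"
  obtains cf :: "nat \<Rightarrow> ('n::finite \<Rightarrow> int) \<Rightarrow> real ^ 'n \<Rightarrow> complex" and c1 C where
    "0 < c1" "0 < C"
    "\<And>J \<nu>. cf J \<nu> \<in> borel_measurable borel"
    "\<And>J \<xi>. (\<Sum>\<nu>\<in>grid J. norm (cf J \<nu> \<xi>)) \<le> 5 ^ CARD('n)"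
    "\<And>J \<alpha> \<xi> x. sum \<alpha> UNIV \<le> r \<Longrightarrow> x \<in> interior unit_cube \<Longrightarrow>
      norm (spectral_kernel (grid J) (cf J) grid_freq \<alpha> \<xi> x)
        \<le> C * exp (- c1 * real J powr \<beta>) * exp (c * norm \<xi> powr \<beta>)"
proof -
  obtain b :: "nat \<Rightarrow> int \<Rightarrow> real \<Rightarrow> complex" where
    b_meas: "\<And>J \<kappa>. b J \<kappa> \<in> borel_measurable borel" and
    b_sum: "\<And>J \<tau>. (\<Sum>\<kappa>=-2*int J..2*int J. norm (b J \<kappa> \<tau>)) \<le> 5" and
    b_zero: "\<And>J \<kappa> \<tau>. int J < \<bar>\<lfloor>\<tau>\<rfloor>\<bar> \<Longrightarrow> b J \<kappa> \<tau> = 0" and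
    b_approx: "\<And>J \<tau> q w. \<bar>\<lfloor>\<tau>\<rfloor>\<bar> \<le> int J \<Longrightarrow> 0 \<le> w \<Longrightarrow> w \<le> 1 / 8 \<Longrightarrow>
       norm ((\<i> * of_real \<tau>) ^ q * exp (\<i> * of_real \<tau> * of_real w) -
         (\<Sum>\<kappa>=-2*int J..2*int J. b J \<kappa> \<tau> * (\<i> * of_int \<kappa>) ^ q * exp (\<i> * of_int \<kappa> * of_real w)))
       \<le> 5 * fact q * 8 ^ q * (1 / 2) ^ J"
    by (rule exp_discretization) blast
  define cf where "cf J \<nu> \<xi> = (\<Prod>i\<in>UNIV. b J (\<nu> i) (\<xi> $ i / mesh))" for J and \<nu> :: "'n \<Rightarrow> int" and \<xi> :: "real ^ 'n"
  define d where "d = CARD('n)"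
  define N where "N = r * d"
  define Kr where "Kr = (1 + 5 * fact r :: real)"
  define K where "K = Kr ^ d * (real d * (5 * fact r))"
  have Kr: "1 \<le> Kr" by (simp add: Kr_def)
  have K: "0 < K" using Kr by (simp add: K_def d_def)
  obtain C1 where C1: "0 < C1" "\<And>t. 0 \<le> t \<Longrightarrow> (1 + 2 * pi * t) ^ r \<le> C1 * exp (c / 2 * t powr \<beta>)"
    using power_le_exp_powr[of "c / 2" \<beta> r] \<beta> c by auto
  obtain C2 where C2: "0 < C2" "\<And>t. 0 \<le> t \<Longrightarrow> (1 + 2 * pi * t) ^ N \<le> C2 * exp (ln 2 / 2 * t powr 1)"
    using power_le_exp_powr[of "ln 2 / 2" 1 N] by auto
  \<comment> \<open>The first entry is the decay rate outside the grid, the second the one inside.\<close>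
  define c1 where "c1 = min (c / 2 * mesh powr \<beta>) (ln 2 / 2)"
  have mesh: "0 < mesh" by (simp add: mesh_def)
  then have c1: "0 < c1" using c by (simp add: c1_def)
  define C where "C = max C1 (K * C2)"
  have C: "0 < C" using C1 by (simp add: C_def less_max_iff_disj)
  \<comment> \<open>Plane waves, monomials and coefficients are all products over the coordinates.\<close>
  have factor: "spectral_kernel (grid J) (cf J) grid_freq \<alpha> \<xi> x =
      (\<Prod>i\<in>UNIV. (2 * of_real pi * \<i> * of_real (\<xi> $ i)) ^ \<alpha> i * exp (2 * of_real pi * \<i> * of_real (\<xi> $ i * x $ i))) -
      (\<Prod>i\<in>UNIV. \<Sum>\<kappa>=-2*int J..2*int J. b J \<kappa> (\<xi> $ i / mesh) *
        ((2 * of_real pi * \<i> * of_real (mesh * of_int \<kappa>)) ^ \<alpha> i * exp (2 * of_real pi * \<i> * of_real (mesh * of_int \<kappa> * x $ i))))"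
    for J \<alpha> \<xi> x
  proof -
    have "(\<Sum>\<nu>\<in>grid J. cf J \<nu> \<xi> * freq_monomial \<alpha> (grid_freq \<nu>) * plane_wave (grid_freq \<nu>) x)
        = (\<Sum>\<nu>\<in>grid J. \<Prod>i\<in>UNIV. b J (\<nu> i) (\<xi> $ i / mesh) *
        ((2 * of_real pi * \<i> * of_real (mesh * of_int (\<nu> i))) ^ \<alpha> i * exp (2 * of_real pi * \<i> * of_real (mesh * of_int (\<nu> i) * x $ i))))"
      by (simp add: cf_def freq_monomial_def plane_wave_eq_prod grid_freq_def prod.distrib mult.assoc)
    also have "\<dots> = (\<Prod>i\<in>UNIV. \<Sum>\<kappa>=-2*int J..2*int J. b J \<kappa> (\<xi> $ i / mesh) *
        ((2 * of_real pi * \<i> * of_real (mesh * of_int \<kappa>)) ^ \<alpha> i * exp (2 * of_real pi * \<i> * of_real (mesh * of_int \<kappa> * x $ i))))"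
      unfolding grid_def by (subst prod_sum_PiE) auto
    finally show ?thesis
      by (simp add: spectral_kernel_def freq_monomial_def plane_wave_eq_prod prod.distrib)
  qed
  have inside: "norm (spectral_kernel (grid J) (cf J) grid_freq \<alpha> \<xi> x) \<le> K * C2 * exp (- c1 * real J powr \<beta>)"
    if \<xi>: "\<And>i. \<bar>\<lfloor>\<xi> $ i / mesh\<rfloor>\<bar> \<le> int J" and \<alpha>: "sum \<alpha> UNIV \<le> r" and x: "x \<in> interior unit_cube" for J \<alpha> \<xi> x
  proof -
    define Y where "Y = Kr * (real J + 1) ^ r"
    define e where "e = 5 * fact r * (1 / 2 :: real) ^ J"
    have J1: "1 \<le> (real J + 1) ^ r" by simp
    have Y: "1 \<le> Y" using mult_mono[OF Kr J1] by (simp add: Y_def Kr_def)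
    define P where "P i = (2 * of_real pi * \<i> * of_real (\<xi> $ i)) ^ \<alpha> i * exp (2 * of_real pi * \<i> * of_real (\<xi> $ i * x $ i))" for i
    define Q where "Q i = (\<Sum>\<kappa>=-2*int J..2*int J. b J \<kappa> (\<xi> $ i / mesh) *
        ((2 * of_real pi * \<i> * of_real (mesh * of_int \<kappa>)) ^ \<alpha> i * exp (2 * of_real pi * \<i> * of_real (mesh * of_int \<kappa> * x $ i))))" for i
    have bounds: "norm (P i - Q i) \<le> e" "norm (P i) \<le> (real J + 1) ^ r" for i
    proof -
      have \<alpha>i: "\<alpha> i \<le> r"
        using \<alpha> member_le_sum[of i UNIV \<alpha>] by auto
      define \<tau> where "\<tau> = \<xi> $ i / mesh"
      define w where "w = x $ i / 8"
      have w: "0 \<le> w" "w \<le> 1 / 8"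
        using x unfolding interior_unit_cube by (auto simp: w_def mem_box_cart less_imp_le)
      have \<xi>i: "\<xi> $ i = mesh * \<tau>" using mesh by (simp add: \<tau>_def)
      have h1: "2 * of_real pi * \<i> * of_real (mesh * u) = \<i> * of_real u / 8" for u :: real
        by (simp add: mesh_def)
      have h2: "2 * of_real pi * \<i> * of_real (mesh * u * x $ i) = \<i> * of_real u * of_real w" for u :: real
        by (simp add: mesh_def w_def)
      have Pi: "P i = ((\<i> * of_real \<tau>) ^ \<alpha> i * exp (\<i> * of_real \<tau> * of_real w)) / 8 ^ \<alpha> i"
        unfolding P_def \<xi>i h1 h2 by (simp add: power_divide)
      have Qi: "Q i = (\<Sum>\<kappa>=-2*int J..2*int J. b J \<kappa> \<tau> * (\<i> * of_int \<kappa>) ^ \<alpha> i * exp (\<i> * of_int \<kappa> * of_real w)) / 8 ^ \<alpha> i"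
        unfolding Q_def h1 h2 \<tau>_def[symmetric] by (simp add: power_divide sum_divide_distrib mult.assoc)
      have "norm (P i - Q i) \<le> 5 * fact (\<alpha> i) * 8 ^ \<alpha> i * (1 / 2) ^ J / 8 ^ \<alpha> i"
      proof -
        have "norm (8 ^ \<alpha> i :: complex) = 8 ^ \<alpha> i" by (simp add: norm_power)
        moreover have "\<bar>\<lfloor>\<tau>\<rfloor>\<bar> \<le> int J" using \<xi>[of i] by (simp only: \<tau>_def)
        ultimately show ?thesis
          unfolding Pi Qi diff_divide_distrib[symmetric] norm_divide
          using b_approx[OF _ w] by (simp only:) (intro divide_right_mono, auto)
      qed
      also have "\<dots> = 5 * fact (\<alpha> i) * (1 / 2) ^ J" by simp
      also have "\<dots> \<le> e"
        unfolding e_def using fact_mono[OF \<alpha>i, where 'a = real] by (intro mult_right_mono) auto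
      finally show "norm (P i - Q i) \<le> e" .
      have "\<bar>\<tau>\<bar> \<le> real J + 1"
        using \<xi>[of i] unfolding \<tau>_def[symmetric] by linarith
      then have "\<bar>\<tau>\<bar> ^ \<alpha> i \<le> (real J + 1) ^ \<alpha> i" by (intro power_mono) auto
      also have "\<dots> \<le> (real J + 1) ^ r" using \<alpha>i by (intro power_increasing) auto
      finally have "\<bar>\<tau>\<bar> ^ \<alpha> i \<le> (real J + 1) ^ r" .
      moreover have "norm (P i) \<le> \<bar>\<tau>\<bar> ^ \<alpha> i"
      proof -
        have "norm (P i) = \<bar>\<tau>\<bar> ^ \<alpha> i / 8 ^ \<alpha> i"
          unfolding Pi by (simp add: norm_divide norm_mult norm_power)
        also have "\<dots> \<le> \<bar>\<tau>\<bar> ^ \<alpha> i / 1"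
          by (intro divide_left_mono) auto
        finally show ?thesis by simp
      qed
      ultimately show "norm (P i) \<le> (real J + 1) ^ r" by linarith
    qed
    have e: "0 \<le> e" "e \<le> 5 * fact r * (real J + 1) ^ r"
    proof -
      have "(1 / 2 :: real) ^ J \<le> 1" by (simp add: power_le_one)
      then have "(1 / 2 :: real) ^ J \<le> (real J + 1) ^ r" using J1 by linarith
      then show "e \<le> 5 * fact r * (real J + 1) ^ r" unfolding e_def by (intro mult_left_mono) auto
    qed (simp add: e_def)
    have Y_eq: "Y = (real J + 1) ^ r + 5 * fact r * (real J + 1) ^ r" by (simp add: Y_def Kr_def algebra_simps)
    have "norm (prod P UNIV - prod Q UNIV) \<le> Y ^ card (UNIV :: 'n set) * (real (card (UNIV :: 'n set)) * e)"
    proof (rule norm_prod_diff_le)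
      show "norm (P i) \<le> Y" for i using bounds(2)[of i] by (simp add: Y_eq add_increasing2)
      show "norm (Q i) \<le> Y" for i
        using norm_triangle_ineq4[of "P i" "P i - Q i"] bounds[of i] e unfolding Y_eq by simp
    qed (use Y bounds e in auto)
    also have "\<dots> = K * ((real J + 1) ^ N * (1 / 2) ^ J)"
      by (simp add: Y_def e_def K_def N_def d_def power_mult_distrib power_mult mult_ac)
    also have "\<dots> \<le> K * (C2 * exp (- c1 * real J powr \<beta>))"
    proof (rule mult_left_mono)
      have "real J * 1 \<le> real J * (2 * pi)" using pi_ge_two by (intro mult_left_mono) auto
      then have "(real J + 1) ^ N \<le> (1 + 2 * pi * real J) ^ N"
        by (intro power_mono) (auto simp: mult_ac)
      also have "\<dots> \<le> C2 * exp (ln 2 / 2 * real J powr 1)" by (rule C2) simp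
      finally have "(real J + 1) ^ N * (1 / 2) ^ J \<le> C2 * exp (ln 2 / 2 * real J) * (1 / 2) ^ J"
        by (intro mult_right_mono) auto
      also have "\<dots> = C2 * exp (- (ln 2 / 2) * real J)"
      proof -
        have "(1 / 2 :: real) ^ J = exp (- ln 2 * real J)"
          by (simp add: exp_minus exp_of_nat2_mult power_one_over inverse_eq_divide)
        then show ?thesis by (simp add: exp_add[symmetric] mult.assoc)
      qed
      also have "\<dots> \<le> C2 * exp (- c1 * real J powr \<beta>)"
      proof -
        have "real J powr \<beta> \<le> real J"
        proof (cases "J = 0")
          case False
          then have "real J powr \<beta> \<le> real J powr 1" using \<beta> by (intro powr_mono) auto
          then show ?thesis by simp
        qed simp
        then have "c1 * real J powr \<beta> \<le> ln 2 / 2 * real J"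
          using c1 by (intro mult_mono) (auto simp: c1_def)
        then show ?thesis using C2(1) by simp
      qed
      finally show "(real J + 1) ^ N * (1 / 2) ^ J \<le> C2 * exp (- c1 * real J powr \<beta>)" .
    qed (use K in simp)
    finally show ?thesis unfolding factor P_def Q_def by (simp add: mult.assoc)
  qed
  have outside: "norm (spectral_kernel (grid J) (cf J) grid_freq \<alpha> \<xi> x) \<le> C1 * exp (- c1 * real J powr \<beta>) * exp (c * norm \<xi> powr \<beta>)"
    if i: "int J < \<bar>\<lfloor>\<xi> $ i / mesh\<rfloor>\<bar>" and \<alpha>: "sum \<alpha> UNIV \<le> r" for J \<alpha> \<xi> x i
  proof -
    have "cf J \<nu> \<xi> = 0" for \<nu>
      unfolding cf_def using b_zero[OF i] by (intro prod_zero) auto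
    then have "norm (spectral_kernel (grid J) (cf J) grid_freq \<alpha> \<xi> x) = norm (freq_monomial \<alpha> \<xi>)"
      by (simp add: spectral_kernel_def norm_mult)
    also have "\<dots> \<le> (1 + 2 * pi * norm \<xi>) ^ r" by (rule norm_freq_monomial_le[OF \<alpha>])
    also have "\<dots> \<le> C1 * exp (c / 2 * norm \<xi> powr \<beta>)" by (rule C1) simp
    also have "\<dots> \<le> C1 * (exp (- c1 * real J powr \<beta>) * exp (c * norm \<xi> powr \<beta>))"
    proof -
      have "real J \<le> \<bar>\<xi> $ i / mesh\<bar>" using i by linarith
      then have "mesh * real J \<le> \<bar>\<xi> $ i\<bar>" using mesh by (simp add: pos_le_divide_eq mult.commute)
      also have "\<dots> \<le> norm \<xi>" by (rule component_le_norm_cart)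
      finally have "(mesh * real J) powr \<beta> \<le> norm \<xi> powr \<beta>" using \<beta> mesh by (intro powr_mono2) auto
      then have "c / 2 * (mesh powr \<beta> * real J powr \<beta>) \<le> c / 2 * norm \<xi> powr \<beta>"
        using mesh c by (simp add: powr_mult)
      moreover have "c1 * real J powr \<beta> \<le> c / 2 * mesh powr \<beta> * real J powr \<beta>"
        by (intro mult_right_mono) (auto simp: c1_def)
      ultimately have "c / 2 * norm \<xi> powr \<beta> \<le> - c1 * real J powr \<beta> + c * norm \<xi> powr \<beta>"
        by (simp add: mult.assoc)
      then show ?thesis using C1(1) unfolding exp_add[symmetric] by simp
    qed
    finally show ?thesis by (simp add: mult.assoc)
  qed
  show ?thesis
  proof (rule that[OF c1 C, of cf])
    show "cf J \<nu> \<in> borel_measurable borel" for J \<nu>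
    proof -
      have [measurable]: "(\<lambda>\<xi>::real ^ 'n. b J (\<nu> i) (\<xi> $ i / mesh)) \<in> borel_measurable borel" for i
        by (rule measurable_compose[OF _ b_meas]) (auto intro!: borel_measurable_continuous_onI continuous_intros simp: mesh_def)
      show ?thesis unfolding cf_def[abs_def] by measurable
    qed
    show "(\<Sum>\<nu>\<in>grid J. norm (cf J \<nu> \<xi>)) \<le> 5 ^ CARD('n)" for J \<xi>
    proof -
      have "(\<Sum>\<nu>\<in>grid J. norm (cf J \<nu> \<xi>)) = (\<Prod>i\<in>UNIV. \<Sum>\<kappa>=-2*int J..2*int J. norm (b J \<kappa> (\<xi> $ i / mesh)))"
        unfolding grid_def cf_def by (subst prod_sum_PiE) (auto simp: prod_norm)
      also have "\<dots> \<le> (\<Prod>i\<in>(UNIV :: 'n set). 5)"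
        by (intro prod_mono conjI sum_nonneg b_sum norm_ge_zero)
      finally show ?thesis by simp
    qed
    fix J :: nat and \<alpha> :: "'n \<Rightarrow> nat" and \<xi> x :: "real ^ 'n"
    assume \<alpha>: "sum \<alpha> UNIV \<le> r" and x: "x \<in> interior unit_cube"
    show "norm (spectral_kernel (grid J) (cf J) grid_freq \<alpha> \<xi> x)
        \<le> C * exp (- c1 * real J powr \<beta>) * exp (c * norm \<xi> powr \<beta>)"
    proof (cases "\<forall>i. \<bar>\<lfloor>\<xi> $ i / mesh\<rfloor>\<bar> \<le> int J")
      case True
      have "norm (spectral_kernel (grid J) (cf J) grid_freq \<alpha> \<xi> x) \<le> K * C2 * exp (- c1 * real J powr \<beta>)"
        using True \<alpha> x by (intro inside) auto
      also have "\<dots> \<le> C * exp (- c1 * real J powr \<beta>)"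
        by (intro mult_right_mono) (auto simp: C_def)
      also have "\<dots> \<le> C * exp (- c1 * real J powr \<beta>) * exp (c * norm \<xi> powr \<beta>)"
        using C c mult_left_mono[of 1 "exp (c * norm \<xi> powr \<beta>)" "C * exp (- c1 * real J powr \<beta>)"] by simp
      finally show ?thesis .
    next
      case False
      then obtain i where "int J < \<bar>\<lfloor>\<xi> $ i / mesh\<rfloor>\<bar>" by (auto simp: not_le)
      then have "norm (spectral_kernel (grid J) (cf J) grid_freq \<alpha> \<xi> x) \<le> C1 * exp (- c1 * real J powr \<beta>) * exp (c * norm \<xi> powr \<beta>)"
        by (rule outside[OF _ \<alpha>])
      also have "\<dots> \<le> C * exp (- c1 * real J powr \<beta>) * exp (c * norm \<xi> powr \<beta>)"
        by (intro mult_right_mono) (auto simp: C_def)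
      finally show ?thesis .
    qed
  qed
qed

section \<open>Exponential approximation rate\<close>

text \<open>
  Enumerates the frequencies and pads with zero coefficients up to \<open>n\<close> terms.
\<close>

lemma exp_sums_plane_waveI:
  fixes \<theta> :: "'k \<Rightarrow> real ^ 'n"
  assumes A: "finite A" "card A \<le> n" and M: "(\<Sum>k\<in>A. norm (a k)) \<le> M"
  shows "(\<lambda>x. \<Sum>k\<in>A. a k * plane_wave (\<theta> k) x) \<in> exp_sums n M"
proof -
  obtain h where h: "bij_betw h {..<card A} A"
    using ex_bij_betw_nat_finite[OF A(1)] by (auto simp: atLeast0LessThan)
  define a' where "a' j = (if j < card A then a (h j) else 0)" for j
  have sum_eq: "(\<Sum>j<n. F j (a' j)) = (\<Sum>k\<in>A. F' k (a k))"
    if "\<And>j. F j 0 = 0" "\<And>j. j < card A \<Longrightarrow> F j (a (h j)) = F' (h j) (a (h j))"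
    for F :: "nat \<Rightarrow> complex \<Rightarrow> 'c::comm_monoid_add" and F'
  proof -
    have "(\<Sum>j<n. F j (a' j)) = (\<Sum>j<card A. F j (a' j))"
      using A that by (intro sum.mono_neutral_right) (auto simp: a'_def)
    also have "\<dots> = (\<Sum>j<card A. F' (h j) (a (h j)))"
      using that by (intro sum.cong) (auto simp: a'_def)
    also have "\<dots> = (\<Sum>k\<in>A. F' k (a k))"
      by (rule sum.reindex_bij_betw[OF h])
    finally show ?thesis .
  qed
  show ?thesis
    unfolding exp_sums_def
  proof (intro CollectI exI[of _ a'] exI[of _ "\<lambda>j. \<theta> (h j)"] conjI ext)
    show "(\<Sum>k\<in>A. a k * plane_wave (\<theta> k) x)
        = (\<Sum>j<n. a' j * exp (2 * of_real pi * \<i> * of_real (\<theta> (h j) \<bullet> x)))" for x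
      by (rule sum_eq[symmetric, of "\<lambda>j z. z * exp (2 * of_real pi * \<i> * of_real (\<theta> (h j) \<bullet> x))"
            "\<lambda>k z. z * plane_wave (\<theta> k) x"]) (auto simp: plane_wave_def)
    have "(\<Sum>j<n. norm (a' j)) = (\<Sum>k\<in>A. norm (a k))"
      by (rule sum_eq) auto
    then show "(\<Sum>j<n. norm (a' j)) \<le> M" using M by simp
  qed
qed

text \<open>
  Integrates a bound for the kernel against \<open>fourier fe\<close>. The coefficients of the exponential sum are
  the integrals of \<open>fourier fe\<close> against the coefficients \<open>cf k\<close>, so a pointwise bound on the
  coefficient sum is inherited by the exponential sum.
\<close>

lemma sobolev_norm_le_kernel_bound:
  fixes m c \<beta> :: real
  assumes \<beta>: "0 < \<beta>" and c: "0 < c"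
  obtains K where "0 < K"
    "\<And>(f :: real ^ 'n \<Rightarrow> real) fe (A :: ('n \<Rightarrow> int) set) cf \<theta> \<epsilon> B L.
      fe \<in> L1_extensions unit_cube f \<Longrightarrow>
      (\<integral>\<^sup>+ \<xi>. ennreal (exp (c * norm \<xi> powr \<beta>) * norm (fourier fe \<xi>)) \<partial>lebesgue) = ennreal B \<Longrightarrow> 0 \<le> B \<Longrightarrow> 0 \<le> \<epsilon> \<Longrightarrow>
      finite A \<Longrightarrow> (\<And>k. k \<in> A \<Longrightarrow> cf k \<in> borel_measurable borel) \<Longrightarrow> (\<And>\<xi>. (\<Sum>k\<in>A. norm (cf k \<xi>)) \<le> L) \<Longrightarrow>
      (\<And>\<alpha> \<xi> x. sum \<alpha> UNIV \<le> Suc (nat \<lfloor>m\<rfloor>) \<Longrightarrow> x \<in> interior unit_cube \<Longrightarrow>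
        norm (spectral_kernel A cf \<theta> \<alpha> \<xi> x) \<le> \<epsilon> * exp (c * norm \<xi> powr \<beta>)) \<Longrightarrow>
      (\<Sum>k\<in>A. norm (LINT \<xi>|lborel. fourier fe \<xi> * cf k \<xi>)) \<le> L * B \<and>
      sobolev_norm m (interior unit_cube)
        (\<lambda>x. of_real (f x) - (\<Sum>k\<in>A. (LINT \<xi>|lborel. fourier fe \<xi> * cf k \<xi>) * plane_wave (\<theta> k) x))
        \<le> ennreal (K * (\<epsilon> * B))"
proof -
  let ?U = "interior unit_cube :: (real ^ 'n) set"
  let ?q = "nat \<lfloor>m\<rfloor>"
  obtain K0 where K0: "0 < K0" "\<And>(u :: real ^ 'n \<Rightarrow> complex) D \<epsilon>. 0 \<le> \<epsilon> \<Longrightarrow>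
    (\<And>\<alpha>. sum \<alpha> UNIV \<le> nat \<lfloor>m\<rfloor> \<Longrightarrow> has_weak_deriv ?U \<alpha> u (D \<alpha>)) \<Longrightarrow>
    (\<And>\<alpha> x. sum \<alpha> UNIV \<le> nat \<lfloor>m\<rfloor> \<Longrightarrow> x \<in> ?U \<Longrightarrow> norm (D \<alpha> x) \<le> \<epsilon>) \<Longrightarrow>
    (\<And>\<alpha> x y. sum \<alpha> UNIV = nat \<lfloor>m\<rfloor> \<Longrightarrow> x \<in> ?U \<Longrightarrow> y \<in> ?U \<Longrightarrow>
       norm (D \<alpha> x - D \<alpha> y) \<le> \<epsilon> * norm (x - y)) \<Longrightarrow>
    sobolev_norm m ?U u \<le> ennreal (K0 * \<epsilon>)"
    by (rule sobolev_norm_le_of_bounded_weak_derivs[of m, where 'n = 'n]) blast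
  obtain C0 where C0: "0 < C0" "\<And>t. 0 \<le> t \<Longrightarrow> (1 + 2 * pi * t) ^ ?q \<le> C0 * exp (c * t powr \<beta>)"
    by (rule power_le_exp_powr[OF c \<beta>, of ?q]) blast
  let ?d = "real CARD('n)"
  have d: "1 \<le> ?d" by (simp add: Suc_leI)
  show ?thesis
  proof (rule that[of "K0 * ?d"])
    show "0 < K0 * ?d" using K0 by simp
    fix f :: "real ^ 'n \<Rightarrow> real" and fe and A :: "('n \<Rightarrow> int) set" and cf \<theta> and \<epsilon> B L :: real
    assume fe: "fe \<in> L1_extensions unit_cube f"
      and B: "(\<integral>\<^sup>+ \<xi>. ennreal (exp (c * norm \<xi> powr \<beta>) * norm (fourier fe \<xi>)) \<partial>lebesgue) = ennreal B" "0 \<le> B"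
      and \<epsilon>: "0 \<le> \<epsilon>" and A: "finite A"
      and cf [measurable]: "\<And>k. k \<in> A \<Longrightarrow> cf k \<in> borel_measurable borel"
      and cf_sum: "\<And>\<xi>. (\<Sum>k\<in>A. norm (cf k \<xi>)) \<le> L"
      and kernel: "\<And>\<alpha> \<xi> x. sum \<alpha> UNIV \<le> Suc ?q \<Longrightarrow> x \<in> ?U \<Longrightarrow>
        norm (spectral_kernel A cf \<theta> \<alpha> \<xi> x) \<le> \<epsilon> * exp (c * norm \<xi> powr \<beta>)"
    define h where "h = fourier fe"
    define w where "w \<xi> = exp (c * norm \<xi> powr \<beta>) * norm (h \<xi>)" for \<xi>
    have [measurable]: "h \<in> borel_measurable borel"
    proof -
      have "integrable lebesgue fe" using fe by (simp add: L1_extensions_def)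
      then obtain g where g: "integrable lborel g" "\<And>\<xi>. fourier fe \<xi> = (LINT x|lborel. g x * plane_wave (- \<xi>) x)"
        by (rule lebesgue_integrable_borel_version) blast
      have [measurable]: "g \<in> borel_measurable borel" using g(1) by (auto dest: borel_measurable_integrable)
      have "h = (\<lambda>\<xi>. LINT x|lborel. g x * plane_wave (- \<xi>) x)" unfolding h_def using g(2) by (rule ext)
      also have "\<dots> \<in> borel_measurable borel" by measurable
      finally show ?thesis .
    qed
    have w_meas [measurable]: "w \<in> borel_measurable borel" unfolding w_def by measurable
    have w_nn: "(\<integral>\<^sup>+ \<xi>. ennreal (w \<xi>) \<partial>lborel) = ennreal B"
      using B(1) by (simp add: nn_integral_completion w_def h_def)
    have w_int: "integrable lborel w" and w_B: "(LINT \<xi>|lborel. w \<xi>) = B"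
      using w_nn B(2) by (auto simp: w_def intro!: integrableI_nonneg integral_eq_nn_integral[THEN trans])
    have h_le: "norm (h \<xi>) \<le> w \<xi>" for \<xi>
      using mult_right_mono[of 1 "exp (c * norm \<xi> powr \<beta>)" "norm (h \<xi>)"] c by (simp add: w_def)
    have w0: "0 \<le> w \<xi>" for \<xi> by (simp add: w_def)
    have bounded_int: "integrable lborel (\<lambda>\<xi>. h \<xi> * \<rho> \<xi>)" "norm (LINT \<xi>|lborel. h \<xi> * \<rho> \<xi>) \<le> b * B"
      if [measurable]: "\<rho> \<in> borel_measurable borel" and \<rho>: "\<And>\<xi>. norm (\<rho> \<xi>) \<le> b * exp (c * norm \<xi> powr \<beta>)" for \<rho> b
    proof -
      have le: "norm (h \<xi> * \<rho> \<xi>) \<le> b * w \<xi>" for \<xi>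
        using mult_left_mono[OF \<rho>, of "norm (h \<xi>)" \<xi>] by (simp add: norm_mult w_def mult_ac)
      show int: "integrable lborel (\<lambda>\<xi>. h \<xi> * \<rho> \<xi>)"
      proof (rule Bochner_Integration.integrable_bound)
        show "integrable lborel (\<lambda>\<xi>. b * w \<xi>)" using w_int by simp
        show "AE \<xi> in lborel. norm (h \<xi> * \<rho> \<xi>) \<le> norm (b * w \<xi>)"
          using le by (intro AE_I2) (smt (verit) real_norm_def)
      qed measurable
      have "norm (LINT \<xi>|lborel. h \<xi> * \<rho> \<xi>) \<le> (LINT \<xi>|lborel. b * w \<xi>)"
        using int w_int le by (intro Bochner_Integration.integral_norm_bound_integral) auto
      then show "norm (LINT \<xi>|lborel. h \<xi> * \<rho> \<xi>) \<le> b * B" using w_B by simp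
    qed
    have exp1: "1 \<le> exp (c * norm \<xi> powr \<beta>)" for \<xi> :: "real ^ 'n" using c by simp
    have int_mon: "integrable lborel (\<lambda>\<xi>. h \<xi> * freq_monomial \<alpha> \<xi>)" if "sum \<alpha> UNIV \<le> ?q" for \<alpha>
    proof (rule bounded_int(1))
      show "norm (freq_monomial \<alpha> \<xi>) \<le> C0 * exp (c * norm \<xi> powr \<beta>)" for \<xi>
        using norm_freq_monomial_le[OF that, of \<xi>] C0(2)[of "norm \<xi>"] by simp
    qed measurable
    have L0: "0 \<le> L" using cf_sum[of 0] sum_nonneg[of A "\<lambda>k. norm (cf k 0)"] by simp
    have cf_le: "norm (cf k \<xi>) \<le> L * exp (c * norm \<xi> powr \<beta>)" if "k \<in> A" for k \<xi>
    proof -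
      have "norm (cf k \<xi>) \<le> L"
        using member_le_sum[OF that, of "\<lambda>k. norm (cf k \<xi>)"] A cf_sum[of \<xi>] by simp
      also have "\<dots> \<le> L * exp (c * norm \<xi> powr \<beta>)"
        using mult_left_mono[OF exp1 L0, of \<xi>] by simp
      finally show ?thesis .
    qed
    have int_cf: "integrable lborel (\<lambda>\<xi>. h \<xi> * cf k \<xi>)" if "k \<in> A" for k
      using that cf_le by (intro bounded_int(1)[of _ L]) auto
    have "(\<Sum>k\<in>A. norm (LINT \<xi>|lborel. h \<xi> * cf k \<xi>)) \<le> (\<Sum>k\<in>A. (LINT \<xi>|lborel. norm (h \<xi> * cf k \<xi>)))"
      by (intro sum_mono integral_norm_bound)
    also have "\<dots> = (LINT \<xi>|lborel. (\<Sum>k\<in>A. norm (h \<xi> * cf k \<xi>)))"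
      by (subst Bochner_Integration.integral_sum) (auto intro: int_cf)
    also have "\<dots> \<le> (LINT \<xi>|lborel. L * w \<xi>)"
    proof (rule integral_mono)
      show "(\<Sum>k\<in>A. norm (h \<xi> * cf k \<xi>)) \<le> L * w \<xi>" for \<xi>
      proof -
        have "(\<Sum>k\<in>A. norm (h \<xi> * cf k \<xi>)) = norm (h \<xi>) * (\<Sum>k\<in>A. norm (cf k \<xi>))"
          by (simp add: norm_mult sum_distrib_left)
        also have "\<dots> \<le> w \<xi> * L" by (intro mult_mono h_le cf_sum w0 sum_nonneg) auto
        finally show ?thesis by (simp add: mult.commute)
      qed
    qed (use int_cf w_int in \<open>auto intro!: Bochner_Integration.integrable_sum\<close>)
    finally have part1: "(\<Sum>k\<in>A. norm (LINT \<xi>|lborel. h \<xi> * cf k \<xi>)) \<le> L * B" using w_B by simp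
    define a where "a k = (LINT \<xi>|lborel. h \<xi> * cf k \<xi>)" for k
    define D where "D = spectral_deriv h A a \<theta>"
    have ker_meas [measurable]: "(\<lambda>\<xi>. spectral_kernel A cf \<theta> \<alpha> \<xi> x) \<in> borel_measurable borel" for \<alpha> x
      unfolding spectral_kernel_def using A by measurable
    have D_eq: "D \<alpha> x = (LINT \<xi>|lborel. h \<xi> * spectral_kernel A cf \<theta> \<alpha> \<xi> x)"
      "integrable lborel (\<lambda>\<xi>. h \<xi> * spectral_kernel A cf \<theta> \<alpha> \<xi> x)" if "sum \<alpha> UNIV \<le> ?q" for \<alpha> x
      unfolding D_def a_def
      using spectral_deriv_eq_integral_kernel[OF int_mon[OF that] int_cf, where A = A and \<theta> = \<theta> and x = x] by auto
    have "sobolev_norm m ?U (\<lambda>x. of_real (f x) - (\<Sum>k\<in>A. a k * plane_wave (\<theta> k) x)) \<le> ennreal (K0 * (?d * (\<epsilon> * B)))"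
    proof (rule K0(2)[where D = D])
      show "0 \<le> ?d * (\<epsilon> * B)" using \<epsilon> B by simp
      fix \<alpha> :: "'n \<Rightarrow> nat" assume \<alpha>: "sum \<alpha> UNIV \<le> ?q"
      have h_int: "integrable lborel h"
        using bounded_int(1)[of "\<lambda>_. 1" 1] c by simp
      show "has_weak_deriv ?U \<alpha> (\<lambda>x. of_real (f x) - (\<Sum>k\<in>A. a k * plane_wave (\<theta> k) x)) (D \<alpha>)"
        unfolding D_def h_def
        by (rule has_weak_deriv_spectral_deriv[OF fe])
          (use h_int int_mon[OF \<alpha>] A in \<open>auto simp: h_def interior_subset\<close>)
      fix x assume x: "x \<in> ?U"
      have "norm (D \<alpha> x) \<le> \<epsilon> * B"
        unfolding D_eq(1)[OF \<alpha>] by (rule bounded_int(2)) (use \<alpha> x in \<open>auto intro: kernel\<close>)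
      also have "\<dots> \<le> ?d * (\<epsilon> * B)"
        using d \<epsilon> B mult_right_mono[of 1 ?d "\<epsilon> * B"] by simp
      finally show "norm (D \<alpha> x) \<le> ?d * (\<epsilon> * B)" .
    next
      fix \<alpha> :: "'n \<Rightarrow> nat" and x y
      assume \<alpha>: "sum \<alpha> UNIV = ?q" and xy: "x \<in> ?U" "y \<in> ?U"
      have \<alpha>': "sum \<alpha> UNIV \<le> ?q" using \<alpha> by simp
      have "D \<alpha> x - D \<alpha> y = (LINT \<xi>|lborel. h \<xi> * (spectral_kernel A cf \<theta> \<alpha> \<xi> x - spectral_kernel A cf \<theta> \<alpha> \<xi> y))"
        unfolding D_eq(1)[OF \<alpha>'] using D_eq(2)[OF \<alpha>']
        by (subst Bochner_Integration.integral_diff[symmetric]) (auto simp: right_diff_distrib)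
      also have "norm \<dots> \<le> (?d * \<epsilon> * norm (x - y)) * B"
      proof (rule bounded_int(2))
        fix \<xi>
        have "norm (spectral_kernel A cf \<theta> \<alpha> \<xi> x - spectral_kernel A cf \<theta> \<alpha> \<xi> y)
            \<le> ?d * (\<epsilon> * exp (c * norm \<xi> powr \<beta>)) * norm (x - y)"
        proof (rule spectral_kernel_Lipschitz[of ?U])
          show "convex ?U" by (simp add: interior_unit_cube convex_box)
          fix i z assume z: "z \<in> ?U"
          have "sum (\<alpha>(i := Suc (\<alpha> i))) UNIV = Suc (sum \<alpha> UNIV)"
            by (subst (1 2) sum.remove[of UNIV i]) auto
          then show "norm (spectral_kernel A cf \<theta> (\<alpha>(i := Suc (\<alpha> i))) \<xi> z) \<le> \<epsilon> * exp (c * norm \<xi> powr \<beta>)"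
            using z \<alpha> by (intro kernel) auto
        qed (use xy in auto)
        then show "norm (spectral_kernel A cf \<theta> \<alpha> \<xi> x - spectral_kernel A cf \<theta> \<alpha> \<xi> y)
            \<le> ?d * \<epsilon> * norm (x - y) * exp (c * norm \<xi> powr \<beta>)" by (simp add: mult_ac)
      qed measurable
      finally show "norm (D \<alpha> x - D \<alpha> y) \<le> ?d * (\<epsilon> * B) * norm (x - y)" by (simp add: mult_ac)
    qed
    with part1 show "(\<Sum>k\<in>A. norm (LINT \<xi>|lborel. fourier fe \<xi> * cf k \<xi>)) \<le> L * B \<and>
      sobolev_norm m ?U
        (\<lambda>x. of_real (f x) - (\<Sum>k\<in>A. (LINT \<xi>|lborel. fourier fe \<xi> * cf k \<xi>) * plane_wave (\<theta> k) x))
        \<le> ennreal (K0 * ?d * (\<epsilon> * B))"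
      by (simp add: a_def h_def mult.assoc)
  qed
qed

text \<open>
  The largest grid with at most \<open>n\<close> points has \<open>J\<close> of order \<open>n powr (1 / d)\<close>. The summand 1
  covers the case \<open>J = 0\<close>.
\<close>

lemma grid_size_exists:
  fixes \<beta> :: real
  assumes \<beta>: "0 < \<beta>" "\<beta> < 1" and n: "1 \<le> n" and d: "1 \<le> (d :: nat)"
  obtains J where "(4 * J + 1) ^ d \<le> n" "real n powr (\<beta> / real d) \<le> 9 * (real J powr \<beta> + 1)"
proof -
  define s where "s = real n powr (1 / real d)"
  have s1: "1 \<le> s" using n unfolding s_def by (intro ge_one_powr_ge_zero) auto
  have sd: "s ^ d = real n"
    using n d by (simp add: s_def powr_realpow[symmetric] powr_powr)
  define J where "J = nat \<lfloor>(s - 1) / 4\<rfloor>"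
  have J: "real J \<le> (s - 1) / 4" "(s - 1) / 4 < real J + 1"
  proof -
    have "real J = of_int \<lfloor>(s - 1) / 4\<rfloor>" using s1 by (simp add: J_def)
    then show "real J \<le> (s - 1) / 4" "(s - 1) / 4 < real J + 1" by linarith+
  qed
  show ?thesis
  proof (rule that[of J])
    have "real (4 * J + 1) ^ d \<le> s ^ d" using J by (intro power_mono) auto
    then show "(4 * J + 1) ^ d \<le> n" unfolding sd of_nat_power[symmetric] by (simp only: of_nat_le_iff)
    define u where "u = max (real J) 1"
    have "s \<le> 9 * u" using J by (simp add: u_def)
    then have "s powr \<beta> \<le> (9 * u) powr \<beta>" using s1 \<beta> by (intro powr_mono2) auto
    also have "\<dots> = 9 powr \<beta> * u powr \<beta>" by (simp add: powr_mult u_def)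
    also have "\<dots> \<le> 9 powr 1 * (real J powr \<beta> + 1)"
      using \<beta> by (intro mult_mono powr_mono) (auto simp: u_def max_def)
    finally show "real n powr (\<beta> / real d) \<le> 9 * (real J powr \<beta> + 1)"
      by (simp add: s_def powr_powr)
  qed
qed

theorem theorem2:
  fixes \<beta> c m :: real
  assumes "0 < \<beta>" and "\<beta> < 1" and "0 < c" and "0 \<le> m"
  shows "\<exists>c' C :: real. 0 < c' \<and> 0 < C \<and>
    (\<forall>f \<in> barron_space \<beta> c (unit_cube :: (real ^ 'n) set).
       \<exists>M :: real. 0 \<le> M \<and> ennreal M \<le> ennreal C * barron_norm \<beta> c unit_cube f \<and>
         (\<forall>n :: nat. 1 \<le> n \<longrightarrow>
            (INF g \<in> exp_sums n M.
               sobolev_norm m (interior unit_cube) (\<lambda>x. complex_of_real (f x) - g x))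
            \<le> ennreal C * barron_norm \<beta> c unit_cube f *
                ennreal (exp (- c' * real n powr (\<beta> / real CARD('n))))))"
proof -
  let ?U = "interior unit_cube :: (real ^ 'n) set"
  let ?r = "Suc (nat \<lfloor>m\<rfloor>)"
  let ?I = "\<lambda>fe :: real ^ 'n \<Rightarrow> complex. \<integral>\<^sup>+ \<xi>. ennreal (exp (c * norm \<xi> powr \<beta>) * norm (fourier fe \<xi>)) \<partial>lebesgue"
  define L where "L = (5 :: real) ^ CARD('n)"
  obtain K where K: "0 < K"
    "\<And>(f :: real ^ 'n \<Rightarrow> real) fe (A :: ('n \<Rightarrow> int) set) cf \<theta> \<epsilon> B L.
      fe \<in> L1_extensions unit_cube f \<Longrightarrow> ?I fe = ennreal B \<Longrightarrow> 0 \<le> B \<Longrightarrow> 0 \<le> \<epsilon> \<Longrightarrow>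
      finite A \<Longrightarrow> (\<And>k. k \<in> A \<Longrightarrow> cf k \<in> borel_measurable borel) \<Longrightarrow> (\<And>\<xi>. (\<Sum>k\<in>A. norm (cf k \<xi>)) \<le> L) \<Longrightarrow>
      (\<And>\<alpha> \<xi> x. sum \<alpha> UNIV \<le> ?r \<Longrightarrow> x \<in> ?U \<Longrightarrow>
        norm (spectral_kernel A cf \<theta> \<alpha> \<xi> x) \<le> \<epsilon> * exp (c * norm \<xi> powr \<beta>)) \<Longrightarrow>
      (\<Sum>k\<in>A. norm (LINT \<xi>|lborel. fourier fe \<xi> * cf k \<xi>)) \<le> L * B \<and>
      sobolev_norm m ?U
        (\<lambda>x. of_real (f x) - (\<Sum>k\<in>A. (LINT \<xi>|lborel. fourier fe \<xi> * cf k \<xi>) * plane_wave (\<theta> k) x))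
        \<le> ennreal (K * (\<epsilon> * B))"
    by (rule sobolev_norm_le_kernel_bound[OF assms(1,3), where 'n = 'n and m = m]) blast
  obtain cf :: "nat \<Rightarrow> ('n \<Rightarrow> int) \<Rightarrow> real ^ 'n \<Rightarrow> complex" and c1 C1 where
    c1: "0 < c1" and C1: "0 < C1" and
    cf: "\<And>J \<nu>. cf J \<nu> \<in> borel_measurable borel"
      "\<And>J \<xi>. (\<Sum>\<nu>\<in>grid J. norm (cf J \<nu> \<xi>)) \<le> L"
      "\<And>J \<alpha> \<xi> x. sum \<alpha> UNIV \<le> ?r \<Longrightarrow> x \<in> ?U \<Longrightarrow>
        norm (spectral_kernel (grid J) (cf J) grid_freq \<alpha> \<xi> x)
          \<le> C1 * exp (- c1 * real J powr \<beta>) * exp (c * norm \<xi> powr \<beta>)"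
    unfolding L_def by (rule exp_grid_approximation[OF assms(1-3), where 'n = 'n and r = ?r]) blast
  obtain C0 where C0: "0 < C0" "\<And>t. 0 \<le> t \<Longrightarrow> (1 + 2 * pi * t) ^ ?r \<le> C0 * exp (c * t powr \<beta>)"
    by (rule power_le_exp_powr[OF assms(3,1), of ?r]) blast
  define c' where "c' = c1 / 9"
  define C where "C = max (2 * L) (2 * K * C1 * exp c1)"
  have L: "0 < L" by (simp add: L_def)
  show ?thesis
  proof (rule exI[of _ c'], rule exI[of _ C], intro conjI ballI)
    show "0 < c'" using c1 by (simp add: c'_def)
    show "0 < C" using L by (simp add: C_def less_max_iff_disj)
    fix f assume "f \<in> barron_space \<beta> c (unit_cube :: (real ^ 'n) set)"
    then obtain b where b: "0 \<le> b" "barron_norm \<beta> c unit_cube f = ennreal b"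
      unfolding barron_space_def by (cases "barron_norm \<beta> c unit_cube f") auto
    have ext: "\<exists>fe B. fe \<in> L1_extensions unit_cube f \<and> ?I fe = ennreal B \<and> 0 \<le> B \<and> B < e" if "b < e" for e
    proof -
      have "barron_norm \<beta> c unit_cube f < ennreal e" using that b by (simp add: ennreal_less_iff)
      then obtain fe where fe: "fe \<in> L1_extensions unit_cube f" "?I fe < ennreal e"
        unfolding barron_norm_def by (auto simp: INF_less_iff)
      then obtain B where "0 \<le> B" "?I fe = ennreal B" by (cases "?I fe") auto
      then show ?thesis using fe by (auto simp: ennreal_less_iff)
    qed
    show "\<exists>M. 0 \<le> M \<and> ennreal M \<le> ennreal C * barron_norm \<beta> c unit_cube f \<and>
         (\<forall>n :: nat. 1 \<le> n \<longrightarrow>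
            (INF g \<in> exp_sums n M. sobolev_norm m ?U (\<lambda>x. complex_of_real (f x) - g x))
            \<le> ennreal C * barron_norm \<beta> c unit_cube f * ennreal (exp (- c' * real n powr (\<beta> / real CARD('n)))))"
    proof (cases "b = 0")
      case True
      \<comment> \<open>There are extensions of arbitrarily small weighted norm; comparing \<open>f\<close> with the empty sum shows that its Sobolev norm vanishes.\<close>
      have zero: "sobolev_norm m ?U (\<lambda>x. complex_of_real (f x)) \<le> 0"
      proof (rule ennreal_le_epsilon)
        fix e :: real assume e: "0 < e"
        then obtain fe B where fe: "fe \<in> L1_extensions unit_cube f" "?I fe = ennreal B" "0 \<le> B" "B < e / (K * C0)"
          using ext[of "e / (K * C0)"] True K C0 by auto
        have "norm (spectral_kernel {} (\<lambda>(_::'n \<Rightarrow> int) _. 0) (\<lambda>_. 0) \<alpha> \<xi> x) \<le> C0 * exp (c * norm \<xi> powr \<beta>)"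
          if "sum \<alpha> UNIV \<le> ?r" for \<alpha> and \<xi> x :: "real ^ 'n"
          using norm_freq_monomial_le[OF that, of \<xi>] C0(2)[of "norm \<xi>"] by (simp add: spectral_kernel_def norm_mult)
        then have "sobolev_norm m ?U (\<lambda>x. complex_of_real (f x)) \<le> ennreal (K * (C0 * B))"
          using K(2)[OF fe(1-3), of C0 "{}" "\<lambda>_ _. 0" 0 "\<lambda>_. 0"] C0 by simp
        also have "\<dots> \<le> ennreal e"
          using fe(4) K C0 by (intro ennreal_leI) (simp add: pos_less_divide_eq mult_ac)
        finally show "sobolev_norm m ?U (\<lambda>x. complex_of_real (f x)) \<le> 0 + ennreal e" by simp
      qed
      show ?thesis
      proof (intro exI[of _ 0] conjI allI impI)
        fix n :: nat assume "1 \<le> n"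
        have "(\<lambda>x. \<Sum>k\<in>({} :: nat set). 0 * plane_wave 0 x) \<in> (exp_sums n 0 :: (real ^ 'n \<Rightarrow> complex) set)"
          by (rule exp_sums_plane_waveI) auto
        then have "(INF g \<in> exp_sums n 0. sobolev_norm m ?U (\<lambda>x. complex_of_real (f x) - g x))
            \<le> sobolev_norm m ?U (\<lambda>x. complex_of_real (f x) - (\<Sum>k\<in>({} :: nat set). 0 * plane_wave 0 x))"
          by (rule INF_lower)
        also have "\<dots> \<le> 0" using zero by simp
        finally show "(INF g \<in> exp_sums n 0. sobolev_norm m ?U (\<lambda>x. complex_of_real (f x) - g x))
            \<le> ennreal C * barron_norm \<beta> c unit_cube f * ennreal (exp (- c' * real n powr (\<beta> / real CARD('n))))"
          by simp
      qed auto
    next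
      case False
      \<comment> \<open>The infimum need not be attained, but a nearly optimal extension costs a factor 2 only.\<close>
      then obtain fe B where fe: "fe \<in> L1_extensions unit_cube f" "?I fe = ennreal B" "0 \<le> B" "B < 2 * b"
        using ext[of "2 * b"] b by auto
      show ?thesis
      proof (intro exI[of _ "L * B"] conjI allI impI)
        show "0 \<le> L * B" using L fe by simp
        have "L * B \<le> L * (2 * b)" using fe L by (intro mult_left_mono) auto
        also have "\<dots> \<le> C * b" using mult_right_mono[of "2 * L" C b] b by (simp add: C_def)
        finally show "ennreal (L * B) \<le> ennreal C * barron_norm \<beta> c unit_cube f"
          using b \<open>0 < C\<close> by (simp add: ennreal_mult'[symmetric] ennreal_leI)
        fix n :: nat assume n: "1 \<le> n"
        obtain J where J: "(4 * J + 1) ^ CARD('n) \<le> n"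
          "real n powr (\<beta> / real CARD('n)) \<le> 9 * (real J powr \<beta> + 1)"
          by (rule grid_size_exists[OF assms(1,2) n, of "CARD('n)"]) (simp_all add: Suc_leI)
        define a where "a \<nu> = (LINT \<xi>|lborel. fourier fe \<xi> * cf J \<nu> \<xi>)" for \<nu>
        define g where "g x = (\<Sum>\<nu>\<in>grid J. a \<nu> * plane_wave (grid_freq \<nu>) x)" for x
        let ?\<epsilon> = "C1 * exp (- c1 * real J powr \<beta>)"
        have est: "(\<Sum>\<nu>\<in>grid J. norm (a \<nu>)) \<le> L * B"
          "sobolev_norm m ?U (\<lambda>x. complex_of_real (f x) - g x) \<le> ennreal (K * (?\<epsilon> * B))"
          unfolding a_def g_def
          using K(2)[OF fe(1-3) _ finite_grid cf] C1 by auto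
        have "g \<in> exp_sums n (L * B)"
          unfolding g_def
        proof (rule exp_sums_plane_waveI[OF finite_grid _ est(1)])
          show "card (grid J :: ('n \<Rightarrow> int) set) \<le> n" using J(1) by (simp only: card_grid)
        qed
        then have "(INF g \<in> exp_sums n (L * B). sobolev_norm m ?U (\<lambda>x. complex_of_real (f x) - g x))
            \<le> sobolev_norm m ?U (\<lambda>x. complex_of_real (f x) - g x)"
          by (rule INF_lower)
        also have "\<dots> \<le> ennreal (K * (?\<epsilon> * B))" by (rule est)
        also have "\<dots> \<le> ennreal (C * b * exp (- c' * real n powr (\<beta> / real CARD('n))))"
        proof (rule ennreal_leI)
          have "c' * real n powr (\<beta> / real CARD('n)) \<le> c' * (9 * (real J powr \<beta> + 1))"
            using J(2) \<open>0 < c'\<close> by (intro mult_left_mono) auto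
          then have "- c1 * real J powr \<beta> \<le> c1 + - c' * real n powr (\<beta> / real CARD('n))"
            by (simp add: c'_def algebra_simps)
          then have "exp (- c1 * real J powr \<beta>) \<le> exp c1 * exp (- c' * real n powr (\<beta> / real CARD('n)))"
            unfolding exp_add[symmetric] by (simp only: exp_le_cancel_iff)
          then have "K * (?\<epsilon> * B) \<le> K * (C1 * (exp c1 * exp (- c' * real n powr (\<beta> / real CARD('n)))) * (2 * b))"
            using K C1 fe b by (intro mult_left_mono mult_mono) auto
          also have "\<dots> = (2 * K * C1 * exp c1) * (b * exp (- c' * real n powr (\<beta> / real CARD('n))))"
            by (simp add: mult_ac)
          also have "\<dots> \<le> C * (b * exp (- c' * real n powr (\<beta> / real CARD('n))))"
            using b by (intro mult_right_mono) (auto simp: C_def)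
          finally show "K * (?\<epsilon> * B) \<le> C * b * exp (- c' * real n powr (\<beta> / real CARD('n)))" by (simp add: mult.assoc)
        qed
        also have "\<dots> = ennreal C * barron_norm \<beta> c unit_cube f * ennreal (exp (- c' * real n powr (\<beta> / real CARD('n))))"
          using b \<open>0 < C\<close> by (simp add: ennreal_mult')
        finally show "(INF g \<in> exp_sums n (L * B). sobolev_norm m ?U (\<lambda>x. complex_of_real (f x) - g x))
            \<le> ennreal C * barron_norm \<beta> c unit_cube f * ennreal (exp (- c' * real n powr (\<beta> / real CARD('n))))" .
      qed
    qed
  qed
qed

end
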